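(* Up to equivalence there are exactly four distinct $\mathbb{G}_a^3$-structures on $\mathbb{P}^3$. They correspond to the quotients of $F[S_1,S_2,S_3]$ by the following ideals: $$I_1=(S_1^2-S_2,\;S_1S_2-S_3,\;S_1S_3),$$ $$I_2=(S_1^2-S_2,\;S_1S_2,\;S_1S_3,\;S_3^2),$$ $$I_3=(S_1^2,\;S_1S_2-S_3,\;S_2^2),$$ $$I_4=(S_1^2,\;S_1S_2,\;S_2^2,\;S_2S_3,\;S_3^2,\;S_1S_3).$$
   Context: The base field is $F=\overline{\mathbb{Q}}$. For a connected linear algebraic group $\mathbb{G}$, a $\mathbb{G}$-variety is a variety $X$ with a fixed left $\mathbb{G}$-action such that the stabilizer of a generic point is trivial and the orbit of a generic point is dense. A $\mathbb{G}$-structure on a variety $Y$ is a $\mathbb{G}$-action making $Y$ a $\mathbb{G}$-variety. Two $\mathbb{G}$-varieties $X_1,X_2$ are equivalent if there are $\alpha\in\mathrm{Aut}(\mathbb{G})$ and an isomorphism of varieties $j:X_1\to X_2$ with $j(g\cdot x)=\alpha(g)\cdot j(x)$. Correspondence with algebras: if $R=F[S_1,\dots,S_n]/I$ is an Artinian local algebra of length $n+1$ in which the images of $S_1,\dots,S_n$ form a basis of the maximal ideal, the corresponding $\mathbb{G}_a^n$-structure on $\mathbb{P}(R)\cong\mathbb{P}^n$ (lines in $R$) is the one in which $(a_1,\dots,a_n)$ acts by multiplication by $\exp(a_1S_1+\dots+a_nS_n)$. *)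

theory Defs
  imports
    "HOL-Analysis.Analysis"
    "HOL-Library.Poly_Mapping"
    "HOL-Algebra.Algebra"
    "HOL-Algebra.Algebraic_Closure_Type"
begin

text \<open>These two would shadow the variable name \<open>X\<close> and the topological infix \<open>closure_of\<close>.\<close>

no_notation Polynomials.var (\<open>X\<index>\<close>)
no_notation eq_closure_of (\<open>closure'_of\<index>\<close>)

type_synonym qbar = "rat alg_closure"


section \<open>Multivariate polynomials\<close>

text \<open>Polynomials over \<open>'k\<close> in the variables indexed by the finite type \<open>'n\<close>: finitely supported
  maps from exponent vectors to coefficients, with the convolution product of
  \<^theory>\<open>HOL-Library.Poly_Mapping\<close>.\<close>

type_synonym ('n, 'k) mpoly = "('n \<Rightarrow>\<^sub>0 nat) \<Rightarrow>\<^sub>0 'k"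

definition mpoly_var :: "'n \<Rightarrow> ('n, 'k::comm_ring_1) mpoly"
  where "mpoly_var i = Poly_Mapping.single (Poly_Mapping.single i 1) 1"

definition mpoly_const :: "'k \<Rightarrow> ('n, 'k::comm_ring_1) mpoly"
  where "mpoly_const c = Poly_Mapping.single 0 c"

definition mpoly_eval :: "('n::finite, 'k::comm_ring_1) mpoly \<Rightarrow> 'k ^ 'n \<Rightarrow> 'k"
  where "mpoly_eval p x =
    (\<Sum>m\<in>Poly_Mapping.keys p. Poly_Mapping.lookup p m * (\<Prod>i\<in>UNIV. x $ i ^ Poly_Mapping.lookup m i))"

definition homogeneous :: "nat \<Rightarrow> ('n::finite, 'k::comm_ring_1) mpoly \<Rightarrow> bool"
  where "homogeneous d p \<longleftrightarrow> (\<forall>m\<in>Poly_Mapping.keys p. (\<Sum>i\<in>UNIV. Poly_Mapping.lookup m i) = d)"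


section \<open>Varieties as spaces with functions\<close>

text \<open>Classical varieties over an algebraically closed field in the sense of Serre: a set of
  closed points with its Zariski topology and, for every open \<open>U\<close>, the \<open>'k\<close>-valued functions
  that are regular on \<open>U\<close>. Functions are total; \<open>regular_on X U f\<close> concerns only the
  values of \<open>f\<close> on \<open>U\<close>.\<close>

record ('p, 'k) function_space =
  zariski :: "'p topology"
  regular_on :: "'p set \<Rightarrow> ('p \<Rightarrow> 'k) \<Rightarrow> bool"

abbreviation points :: "('p, 'k) function_space \<Rightarrow> 'p set"
  where "points X \<equiv> topspace (zariski X)"

definition morphism ::
    "('p, 'k) function_space \<Rightarrow> ('q, 'k) function_space \<Rightarrow> ('p \<Rightarrow> 'q) \<Rightarrow> bool"
  where "morphism X Y f \<longleftrightarrow>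
    continuous_map (zariski X) (zariski Y) f \<and>
    (\<forall>V g. openin (zariski Y) V \<and> regular_on Y V g \<longrightarrow>
       regular_on X {x \<in> points X. f x \<in> V} (g \<circ> f))"

definition isomorphism ::
    "('p, 'k) function_space \<Rightarrow> ('q, 'k) function_space \<Rightarrow> ('p \<Rightarrow> 'q) \<Rightarrow> bool"
  where "isomorphism X Y f \<longleftrightarrow> morphism X Y f \<and>
    (\<exists>g. morphism Y X g \<and> (\<forall>x\<in>points X. g (f x) = x) \<and> (\<forall>y\<in>points Y. f (g y) = y))"

definition affine_variety :: "('k::field ^ 'n::finite, 'k) function_space"
  where "affine_variety =
    (let T = topology_generated_by (range (\<lambda>p. {x. mpoly_eval p x \<noteq> 0}))
     in \<lparr> zariski = T,
          regular_on = (\<lambda>U f. \<forall>x\<in>U. \<exists>W p q. openin T W \<and> x \<in> W \<and> W \<subseteq> U \<and>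
            (\<forall>y\<in>W. mpoly_eval q y \<noteq> 0 \<and> f y = mpoly_eval p y / mpoly_eval q y)) \<rparr>)"

text \<open>The points are the lines through the origin of \<open>'k ^ 'm\<close>, so the dimension is
  \<open>CARD('m) - 1\<close>.\<close>

definition lines :: "('k::field ^ 'm::finite) set set"
  where "lines = {L. vec.subspace L \<and> vec.dim L = 1}"

definition projective_variety :: "(('k::field ^ 'm::finite) set, 'k) function_space"
  where "projective_variety =
    (let T = topology_generated_by
           {{L \<in> lines. \<forall>x\<in>L - {0}. mpoly_eval p x \<noteq> 0} | p. \<exists>d. homogeneous d p}
     in \<lparr> zariski = T,
          regular_on = (\<lambda>U f. \<forall>L\<in>U. \<exists>W p q d. openin T W \<and> L \<in> W \<and> W \<subseteq> U \<and>
            homogeneous d p \<and> homogeneous d q \<and>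
            (\<forall>M\<in>W. \<forall>x\<in>M - {0}. mpoly_eval q x \<noteq> 0 \<and> f M = mpoly_eval p x / mpoly_eval q x)) \<rparr>)"

text \<open>The product in the category of spaces with functions; for varieties it is the usual product
  variety (whose topology is finer than the product topology).\<close>

definition product_functions ::
    "('p, 'k::field) function_space \<Rightarrow> ('q, 'k) function_space \<Rightarrow> 'p set \<Rightarrow> 'q set
      \<Rightarrow> ('p \<times> 'q \<Rightarrow> 'k) set"
  where "product_functions X Y U V =
    {\<lambda>(x, y). \<Sum>i<n. f i x * g i y | (n::nat) f g.
       \<forall>i<n. regular_on X U (f i) \<and> regular_on Y V (g i)}"

definition product_variety ::
    "('p, 'k::field) function_space \<Rightarrow> ('q, 'k) function_space \<Rightarrow> ('p \<times> 'q, 'k) function_space"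
  where "product_variety X Y =
    (let T = topology_generated_by
           {{z \<in> U \<times> V. h z \<noteq> 0} | U V h.
              openin (zariski X) U \<and> openin (zariski Y) V \<and> h \<in> product_functions X Y U V}
     in \<lparr> zariski = T,
          regular_on = (\<lambda>W f. \<forall>z\<in>W. \<exists>W' U V h k. openin T W' \<and> z \<in> W' \<and> W' \<subseteq> W \<and>
            openin (zariski X) U \<and> openin (zariski Y) V \<and> W' \<subseteq> U \<times> V \<and>
            h \<in> product_functions X Y U V \<and> k \<in> product_functions X Y U V \<and>
            (\<forall>w\<in>W'. k w \<noteq> 0 \<and> f w = h w / k w)) \<rparr>)"


section \<open>Algebraic groups and their structures on varieties\<close>

record ('g, 'k) algebraic_group = "'g monoid" +
  variety :: "('g, 'k) function_space"

definition additive_group :: "('k::field ^ 'n::finite, 'k) algebraic_group"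
  where "additive_group =
    \<lparr> carrier = UNIV, mult = (+), one = 0, variety = affine_variety \<rparr>"

definition algebraic_automorphism :: "('g, 'k) algebraic_group \<Rightarrow> ('g \<Rightarrow> 'g) \<Rightarrow> bool"
  where "algebraic_automorphism G \<alpha> \<longleftrightarrow> \<alpha> \<in> iso G G \<and> isomorphism (variety G) (variety G) \<alpha>"

text \<open>The property required of a generic point is that it holds on a dense open subset. In
  characteristic 0 stabilizers are reduced, so their triviality can be read off from closed
  points. By the convention of the library, \<open>\<phi> g\<close> is undefined outside \<open>points X\<close>.\<close>

definition is_structure ::
    "('g, 'k::field_char_0) algebraic_group \<Rightarrow> ('p, 'k) function_space \<Rightarrow> ('g \<Rightarrow> 'p \<Rightarrow> 'p) \<Rightarrow> bool"
  where "is_structure G X \<phi> \<longleftrightarrow>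
    group_action G (points X) \<phi> \<and>
    morphism (product_variety (variety G) X) X (\<lambda>(g, x). \<phi> g x) \<and>
    (\<exists>U. openin (zariski X) U \<and> zariski X closure_of U = points X \<and>
       (\<forall>x\<in>U. stabilizer G \<phi> x = {\<one>\<^bsub>G\<^esub>} \<and> zariski X closure_of (orbit G \<phi> x) = points X))"

definition equivalent ::
    "('g, 'k) algebraic_group \<Rightarrow> ('p, 'k) function_space \<Rightarrow> ('g \<Rightarrow> 'p \<Rightarrow> 'p)
      \<Rightarrow> ('q, 'k) function_space \<Rightarrow> ('g \<Rightarrow> 'q \<Rightarrow> 'q) \<Rightarrow> bool"
  where "equivalent G X \<phi> Y \<psi> \<longleftrightarrow>
    (\<exists>\<alpha> j. algebraic_automorphism G \<alpha> \<and> isomorphism X Y j \<and>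
       (\<forall>g\<in>carrier G. \<forall>x\<in>points X. j (\<phi> g x) = \<psi> (\<alpha> g) (j x)))"

definition structures ::
    "('g, 'k::field_char_0) algebraic_group \<Rightarrow> ('p, 'k) function_space \<Rightarrow> ('g \<Rightarrow> 'p \<Rightarrow> 'p) set"
  where "structures G X = {\<phi>. is_structure G X \<phi>}"

definition equivalence_rel ::
    "('g, 'k::field_char_0) algebraic_group \<Rightarrow> ('p, 'k) function_space \<Rightarrow> ('g \<Rightarrow> 'p \<Rightarrow> 'p) rel"
  where "equivalence_rel G X =
    {(\<phi>, \<psi>). \<phi> \<in> structures G X \<and> \<psi> \<in> structures G X \<and> equivalent G X \<phi> X \<psi>}"


section \<open>Structures on projective space from local algebras\<close>

abbreviation poly_ring :: "('n, 'k::comm_ring_1) mpoly ring"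
  where "poly_ring \<equiv> ring_of_type_algebra"

definition artinian :: "('a, 'b) ring_scheme \<Rightarrow> bool"
  where "artinian R \<longleftrightarrow> wf {(J, K). ideal J R \<and> ideal K R \<and> J \<subset> K}"

definition local_ring :: "('a, 'b) ring_scheme \<Rightarrow> bool"
  where "local_ring R \<longleftrightarrow> cring R \<and> (\<exists>!M. maximalideal M R)"

text \<open>Length of a commutative ring as a module over itself: the maximal number of strict
  inclusions in a chain of ideals.\<close>

definition has_length :: "('a, 'b) ring_scheme \<Rightarrow> nat \<Rightarrow> bool"
  where "has_length R l \<longleftrightarrow>
    (let chains = {C. finite C \<and> (\<forall>J\<in>C. ideal J R) \<and> (\<forall>J\<in>C. \<forall>K\<in>C. J \<subseteq> K \<or> K \<subseteq> J)}
     in (\<exists>C\<in>chains. card C = l + 1) \<and> (\<forall>C\<in>chains. card C \<le> l + 1))"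

definition linear_form :: "'k ^ 'n \<Rightarrow> ('n::finite, 'k::comm_ring_1) mpoly"
  where "linear_form a = (\<Sum>i\<in>UNIV. mpoly_const (a $ i) * mpoly_var i)"

text \<open>The last conjunct says that the images of the variables form a \<open>'k\<close>-basis of the maximal
  ideal.\<close>

definition defines_structure :: "('n::finite, 'k::field) mpoly set \<Rightarrow> bool"
  where "defines_structure I \<longleftrightarrow> ideal I poly_ring \<and>
    (let R = poly_ring Quot I
     in artinian R \<and> local_ring R \<and> has_length R (CARD('n) + 1) \<and>
        bij_betw (\<lambda>c. I +>\<^bsub>poly_ring\<^esub> linear_form c) UNIV (THE M. maximalideal M R))"

text \<open>The class of the following polynomial modulo \<open>I\<close> is the exponential of the class of \<open>p\<close>, if
  the latter is nilpotent: the terms left out are those vanishing in the quotient.\<close>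

definition exp_mod :: "('n::finite, 'k::field_char_0) mpoly set \<Rightarrow> ('n, 'k) mpoly \<Rightarrow> ('n, 'k) mpoly"
  where "exp_mod I p = (\<Sum>k | p ^ k \<notin> I. mpoly_const (1 / fact k) * p ^ k)"

text \<open>With \<open>n = CARD('n)\<close>, the homogeneous coordinates of projective \<open>n\<close>-space are indexed by
  \<open>'n option\<close>. The quotient \<open>R\<close> by \<open>I\<close> is identified with \<open>'k ^ 'n option\<close> by means of
  its basis \<open>1, S_1, ..., S_n\<close>, the coordinate \<open>None\<close> belonging to \<open>1\<close>; this identifies the
  projective space of lines in \<open>R\<close> with \<open>projective_variety\<close>.\<close>

definition to_quotient ::
    "('n::finite, 'k::field) mpoly set \<Rightarrow> 'k ^ 'n option \<Rightarrow> ('n, 'k) mpoly set"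
  where "to_quotient I x =
    I +>\<^bsub>poly_ring\<^esub> (mpoly_const (x $ None) + linear_form (\<chi> i. x $ Some i))"

definition structure_of ::
    "('n::finite, 'k::field_char_0) mpoly set
      \<Rightarrow> 'k ^ 'n \<Rightarrow> ('k ^ 'n option) set \<Rightarrow> ('k ^ 'n option) set"
  where "structure_of I a = (\<lambda>L\<in>lines.
    {y. \<exists>x\<in>L. to_quotient I y =
      (I +>\<^bsub>poly_ring\<^esub> exp_mod I (linear_form a)) \<otimes>\<^bsub>poly_ring Quot I\<^esub> to_quotient I x})"


section \<open>The case of dimension three\<close>

abbreviation Ga3 :: "(qbar ^ 3, qbar) algebraic_group"
  where "Ga3 \<equiv> additive_group"

abbreviation P3 :: "((qbar ^ 3 option) set, qbar) function_space"
  where "P3 \<equiv> projective_variety"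

abbreviation S1 :: "(3, qbar) mpoly" where "S1 \<equiv> mpoly_var 1"
abbreviation S2 :: "(3, qbar) mpoly" where "S2 \<equiv> mpoly_var 2"
abbreviation S3 :: "(3, qbar) mpoly" where "S3 \<equiv> mpoly_var 3"

definition I1 :: "(3, qbar) mpoly set"
  where "I1 = genideal poly_ring {S1\<^sup>2 - S2, S1 * S2 - S3, S1 * S3}"

definition I2 :: "(3, qbar) mpoly set"
  where "I2 = genideal poly_ring {S1\<^sup>2 - S2, S1 * S2, S1 * S3, S3\<^sup>2}"

definition I3 :: "(3, qbar) mpoly set"
  where "I3 = genideal poly_ring {S1\<^sup>2, S1 * S2 - S3, S2\<^sup>2}"

definition I4 :: "(3, qbar) mpoly set"
  where "I4 = genideal poly_ring {S1\<^sup>2, S1 * S2, S2\<^sup>2, S2 * S3, S3\<^sup>2, S1 * S3}"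

end

theory Submission
  imports Defs
begin

text \<open>A structure extends to a morphism from the product of affine and projective 3-space to projective
  3-space. Locally such a morphism is a tuple of polynomials that are homogeneous in the projective
  coordinates; dividing by a greatest common divisor (unique factorization in seven variables) makes the
  tuple global and free of zeros. At the neutral element it is proportional to the identity, so its degree
  is 1 and the action is given by matrices depending polynomially on the group element. These can be
  normalized to a representation, which is the exponential of commuting nilpotent matrices \<open>D v\<close>. If
  \<open>w\<close> spans a line with dense orbit and trivial stabilizer, a matrix commuting with the representation is
  determined by its value at \<open>w\<close>; hence the scalars and the matrices \<open>D v\<close> form a 4-dimensional commutative
  local algebra whose maximal ideal consists of the \<open>D v\<close>, and the structure is the one attached to this
  algebra. Up to isomorphism there are four such algebras, and the corresponding structures are told apart
  by the number of stabilizers of points.\<close>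

text \<open>A line fixes its spanning vector only up to a scalar, so the matrices of an action first
  satisfy the group law up to a factor \<open>k a b\<close>. The remedy is that a univariate
  polynomial without zeros over an algebraically closed field is constant: it forces all
  determinants to be 1, so \<open>k a b\<close> is a fourth root of unity (4 being the number of
  homogeneous coordinates), and a polynomial identity along lines then gives 1. The same principle
  fixes the degree in the projective coordinates. The products \<open>D u ** D v\<close> stay in the
  span of the \<open>D v\<close> for a dimension reason: evaluation at \<open>w\<close> is injective
  on the commutant, while the scalars and the \<open>D v\<close> already fill the 4-dimensional
  space. Nilpotency excludes a scalar part. An equivalence transports stabilizers by the
  automorphism of the group. Nontrivial ones occur only on the invariant hyperplane of lines in the
  maximal ideal. Together with the trivial group there are 4, 3 and 2 stabilizers for
  \<open>I1\<close>, \<open>I2\<close> and \<open>I4\<close>; for \<open>I3\<close> a pencil of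
  planes makes the number infinite, which \<open>card\<close> records as 0.\<close>

no_notation fps_nth (infixl \<open>$\<close> 75)

section \<open>Polynomial functions\<close>

lemma mpoly_single_induct [case_names single add]:
  fixes p :: "('n, 'k::comm_ring_1) mpoly"
  assumes single: "\<And>m c. P (Poly_Mapping.single m c)"
    and add: "\<And>p q. P p \<Longrightarrow> P q \<Longrightarrow> P (p + q)"
  shows "P p"
proof (induction p rule: update_induct)
  case const
  have "P (Poly_Mapping.single 0 0)" by (rule single)
  thus ?case by simp
next
  case (update f a b)
  have "Poly_Mapping.update a b f = f + Poly_Mapping.single a b"
    using update by (intro poly_mapping_eqI)
      (auto simp: lookup_update lookup_add lookup_single when_def in_keys_iff)
  thus ?case using add single update by simp
qed

definition monom_eval :: "('n::finite \<Rightarrow>\<^sub>0 nat) \<Rightarrow> 'k::comm_ring_1 ^ 'n \<Rightarrow> 'k"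
  where "monom_eval m x = (\<Prod>i\<in>UNIV. x $ i ^ Poly_Mapping.lookup m i)"

lemma monom_eval_add: "monom_eval (m + n) x = monom_eval m x * monom_eval n x"
  by (simp add: monom_eval_def lookup_add power_add prod.distrib)

lemma mpoly_eval_superset:
  assumes "finite A" "Poly_Mapping.keys p \<subseteq> A"
  shows "mpoly_eval p x = (\<Sum>m\<in>A. Poly_Mapping.lookup p m * monom_eval m x)"
  unfolding mpoly_eval_def monom_eval_def
  by (rule sum.mono_neutral_left) (use assms in \<open>auto simp: in_keys_iff\<close>)

lemma mpoly_eval_single: "mpoly_eval (Poly_Mapping.single m c) x = c * monom_eval m x"
  by (subst mpoly_eval_superset[of "{m}"]) auto

lemma mpoly_eval_add: "mpoly_eval (p + q) x = mpoly_eval p x + mpoly_eval q x"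
proof -
  let ?A = "Poly_Mapping.keys p \<union> Poly_Mapping.keys q"
  have "Poly_Mapping.keys (p + q) \<subseteq> ?A" by (rule keys_add)
  thus ?thesis
    by (simp add: mpoly_eval_superset[of ?A] lookup_add sum.distrib distrib_right)
qed

lemma mpoly_eval_0: "mpoly_eval 0 x = 0"
  by (simp add: mpoly_eval_def)

lemma mpoly_eval_mult: "mpoly_eval (p * q) x = mpoly_eval p x * mpoly_eval q x"
proof (induction p rule: mpoly_single_induct)
  case (single m c)
  show ?case
    by (induction q rule: mpoly_single_induct)
      (simp_all add: mult_single mpoly_eval_single monom_eval_add mpoly_eval_add distrib_left)
qed (simp add: distrib_right mpoly_eval_add)

lemma mpoly_eval_const: "mpoly_eval (mpoly_const c) x = c"
  by (simp add: mpoly_const_def mpoly_eval_single monom_eval_def)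

lemma mpoly_eval_1: "mpoly_eval 1 x = 1"
  by (metis mpoly_const_def mpoly_eval_const single_one)

lemma monom_eval_single: "monom_eval (Poly_Mapping.single i n) x = x $ i ^ n"
  unfolding monom_eval_def lookup_single
  by (subst prod.remove[of _ i]) (auto simp: when_def)

lemma mpoly_eval_var: "mpoly_eval (mpoly_var i) x = x $ i"
  by (simp add: mpoly_var_def mpoly_eval_single monom_eval_single)

lemma mpoly_eval_sum: "mpoly_eval (\<Sum>i\<in>A. f i) x = (\<Sum>i\<in>A. mpoly_eval (f i) x)"
  by (induction A rule: infinite_finite_induct) (auto simp: mpoly_eval_0 mpoly_eval_add)

lemma mpoly_eval_linear_form: "mpoly_eval (linear_form a) x = (\<Sum>i\<in>UNIV. a $ i * x $ i)"
  by (simp add: linear_form_def mpoly_eval_sum mpoly_eval_mult mpoly_eval_const mpoly_eval_var)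

lemma homogeneous_add: "homogeneous d p \<Longrightarrow> homogeneous d q \<Longrightarrow> homogeneous d (p + q)"
  using keys_add[of p q] by (auto simp: homogeneous_def)

lemma homogeneous_0: "homogeneous d 0"
  by (simp add: homogeneous_def)

lemma homogeneous_sum: "(\<And>i. i \<in> A \<Longrightarrow> homogeneous d (f i)) \<Longrightarrow> homogeneous d (\<Sum>i\<in>A. f i)"
  by (induction A rule: infinite_finite_induct) (auto simp: homogeneous_0 homogeneous_add)

lemma homogeneous_mult:
  assumes "homogeneous d p" "homogeneous e q"
  shows "homogeneous (d + e) (p * q)"
  unfolding homogeneous_def
proof
  fix m assume "m \<in> Poly_Mapping.keys (p * q)"
  then obtain a b where "m = a + b" "a \<in> Poly_Mapping.keys p" "b \<in> Poly_Mapping.keys q"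
    using keys_mult[of p q] by blast
  thus "(\<Sum>i\<in>UNIV. Poly_Mapping.lookup m i) = d + e"
    using assms by (simp add: homogeneous_def lookup_add sum.distrib)
qed

lemma homogeneous_const: "homogeneous 0 (mpoly_const c)"
  by (simp add: homogeneous_def mpoly_const_def)

lemma homogeneous_1: "homogeneous 0 1"
  by (metis homogeneous_const mpoly_const_def single_one)

lemma homogeneous_var: "homogeneous 1 (mpoly_var i)"
  by (simp add: homogeneous_def mpoly_var_def lookup_single when_def)

lemma homogeneous_power: "homogeneous d p \<Longrightarrow> homogeneous (n * d) (p ^ n)"
  by (induction n) (auto simp: homogeneous_1 intro: homogeneous_mult)

lemma homogeneous_linear_form: "homogeneous 1 (linear_form a)"
  unfolding linear_form_def
  using homogeneous_mult[OF homogeneous_const homogeneous_var] by (auto intro!: homogeneous_sum)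

lemma mpoly_eval_scale:
  assumes "homogeneous d p"
  shows "mpoly_eval p (c *s x) = c ^ d * mpoly_eval p x"
proof -
  have "monom_eval m (c *s x) = c ^ d * monom_eval m x" if "m \<in> Poly_Mapping.keys p" for m
  proof -
    have "(\<Sum>i\<in>UNIV. Poly_Mapping.lookup m i) = d"
      using that assms by (simp add: homogeneous_def)
    thus ?thesis by (simp add: monom_eval_def power_mult_distrib prod.distrib flip: power_sum)
  qed
  thus ?thesis
    by (simp add: mpoly_eval_superset[OF finite_keys order.refl] sum_distrib_left mult.left_commute)
qed

section \<open>Algebras of functions generated by coordinate functions\<close>

inductive poly_on :: "('p \<Rightarrow> 'k::comm_ring_1) set \<Rightarrow> ('p \<Rightarrow> 'k) \<Rightarrow> bool" for C where
  const: "poly_on C (\<lambda>_. c)"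
| coord: "c \<in> C \<Longrightarrow> poly_on C c"
| add: "poly_on C f \<Longrightarrow> poly_on C g \<Longrightarrow> poly_on C (\<lambda>z. f z + g z)"
| mult: "poly_on C f \<Longrightarrow> poly_on C g \<Longrightarrow> poly_on C (\<lambda>z. f z * g z)"

lemma poly_on_sum: "(\<And>i. i \<in> A \<Longrightarrow> poly_on C (f i)) \<Longrightarrow> poly_on C (\<lambda>z. \<Sum>i\<in>A. f i z)"
  by (induction A rule: infinite_finite_induct) (auto intro: poly_on.intros)

lemma poly_on_prod: "(\<And>i. i \<in> A \<Longrightarrow> poly_on C (f i)) \<Longrightarrow> poly_on C (\<lambda>z. \<Prod>i\<in>A. f i z)"
  by (induction A rule: infinite_finite_induct) (auto intro: poly_on.intros)

lemma poly_on_power: "poly_on C f \<Longrightarrow> poly_on C (\<lambda>z. f z ^ n)"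
  by (induction n) (auto intro: poly_on.intros)

lemma poly_on_minus: "poly_on C f \<Longrightarrow> poly_on C (\<lambda>z. - f z)"
  using poly_on.mult[OF poly_on.const[of C "-1"], of f] by simp

lemma poly_on_diff: "poly_on C f \<Longrightarrow> poly_on C g \<Longrightarrow> poly_on C (\<lambda>z. f z - g z)"
  using poly_on.add[OF _ poly_on_minus, of C f g] by simp

lemma poly_on_mono: "poly_on C f \<Longrightarrow> C \<subseteq> D \<Longrightarrow> poly_on D f"
  by (induction rule: poly_on.induct) (auto intro: poly_on.intros)

lemma poly_on_cong_coords:
  "poly_on C f \<Longrightarrow> (\<And>c. c \<in> C \<Longrightarrow> c z = c z') \<Longrightarrow> f z = f z'"
  by (induction rule: poly_on.induct) auto

lemma poly_on_mpoly_eval: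
  assumes "\<And>i. poly_on C (\<lambda>z. h z $ i)"
  shows "poly_on C (\<lambda>z. mpoly_eval p (h z))"
  unfolding mpoly_eval_def
  by (intro poly_on_sum poly_on.mult poly_on.const poly_on_prod poly_on_power assms)

text \<open>Iterated univariate polynomial rings give such faithful models of rings of polynomial functions, and
  make unique factorization available.\<close>

definition poly_model :: "('r::comm_ring_1 \<Rightarrow> 'p \<Rightarrow> 'k::comm_ring_1) \<Rightarrow> ('p \<Rightarrow> 'k) set \<Rightarrow> bool"
  where "poly_model ev C \<longleftrightarrow>
    (\<forall>r s z. ev (r + s) z = ev r z + ev s z) \<and> (\<forall>r s z. ev (r * s) z = ev r z * ev s z) \<and>
    (\<forall>r. (\<forall>z. ev r z = 0) \<longleftrightarrow> r = 0) \<and> range ev = Collect (poly_on C)"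

lemma poly_model_base:
  "poly_model (\<lambda>(c::'k::field) (z::'p). c) {}"
proof -
  have "\<exists>c. f = (\<lambda>_. c)" if "poly_on {} f" for f :: "'p \<Rightarrow> 'k"
    using that by (induction rule: poly_on.induct) auto
  thus ?thesis by (auto simp: poly_model_def intro: poly_on.intros)
qed

text \<open>Hypothesis \<open>free\<close> lets the new coordinate \<open>c\<close> run through the
  field while the old ones, hence all values \<open>ev r\<close>, stay fixed. If the function of
  \<open>p\<close> vanishes identically, each specialized univariate polynomial vanishes on an
  infinite field, so its coefficients vanish as functions and are 0 by faithfulness of
  \<open>ev\<close>.\<close>

lemma poly_model_step:
  fixes ev :: "'r::comm_ring_1 \<Rightarrow> 'p \<Rightarrow> 'k::field_char_0"
  assumes ev: "poly_model ev C"
    and free: "\<And>z t. \<exists>z'. c z' = t \<and> (\<forall>d\<in>C. d z' = d z)"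
  shows "poly_model (\<lambda>p z. poly (map_poly (\<lambda>r. ev r z) p) (c z)) (insert c C)"
proof -
  define ev' where "ev' = (\<lambda>p z. poly (map_poly (\<lambda>r. ev r z) p) (c z))"
  have add: "ev (r + s) z = ev r z + ev s z" and mult: "ev (r * s) z = ev r z * ev s z"
    and faithful: "(\<forall>z. ev r z = 0) \<longleftrightarrow> r = 0" and rng: "range ev = Collect (poly_on C)"
    for r s z using ev unfolding poly_model_def by auto
  have ev0 [simp]: "ev 0 z = 0" for z using add[of 0 0 z] by simp
  have ev'_pCons: "ev' (pCons a p) z = ev a z + c z * ev' p z" for a p z
    by (simp add: ev'_def map_poly_pCons)
  have ev'0 [simp]: "ev' 0 z = 0" for z by (simp add: ev'_def)
  have add': "ev' (p + q) z = ev' p z + ev' q z" for p q z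
    by (induction p q rule: poly_induct2) (auto simp: ev'_pCons add algebra_simps)
  have smult': "ev' (Polynomial.smult a q) z = ev a z * ev' q z" for a q z
    by (induction q) (auto simp: ev'_pCons mult algebra_simps)
  have mult': "ev' (p * q) z = ev' p z * ev' q z" for p q z
    by (induction p) (auto simp: ev'_pCons add' smult' algebra_simps)
  have "p = 0" if p: "\<forall>z. ev' p z = 0" for p
  proof -
    have "poly.coeff p n = 0" for n
    proof -
      have "ev (poly.coeff p n) z = 0" for z
      proof -
        have "poly (map_poly (\<lambda>r. ev r z) p) t = 0" for t
        proof -
          obtain z' where z': "c z' = t" "\<forall>d\<in>C. d z' = d z" using free by blast
          have "poly_on C (ev r)" for r using rng by blast
          hence "ev r z' = ev r z" for r
            by (rule poly_on_cong_coords) (use z'(2) in blast)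
          thus ?thesis using p[rule_format, of z'] z'(1) by (simp add: ev'_def)
        qed
        hence "map_poly (\<lambda>r. ev r z) p = 0" using poly_all_0_iff_0 by blast
        hence "poly.coeff (map_poly (\<lambda>r. ev r z) p) n = 0" by simp
        thus ?thesis by (simp add: coeff_map_poly)
      qed
      thus ?thesis using faithful by blast
    qed
    thus ?thesis by (simp add: poly_eqI)
  qed
  moreover have "poly_on (insert c C) (ev' p)" for p
  proof (induction p)
    case (pCons a p)
    have "poly_on C (ev a)" using rng by blast
    hence "poly_on (insert c C) (ev a)" by (rule poly_on_mono) blast
    thus ?case using pCons unfolding ev'_pCons[abs_def]
      by (intro poly_on.add[OF _ poly_on.mult[OF poly_on.coord]]) auto
  qed (auto simp: ev'_def intro: poly_on.intros)
  moreover have "f \<in> range ev'" if "poly_on (insert c C) f" for f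
    using that
  proof (induction rule: poly_on.induct)
    case (const b)
    have "(\<lambda>_. b) \<in> range ev" using rng by (auto intro: poly_on.intros)
    then obtain r where "ev r = (\<lambda>_. b)" by auto
    hence "ev' [:r:] = (\<lambda>_. b)" by (auto simp: ev'_pCons)
    thus ?case by (metis rangeI)
  next
    case (coord d)
    show ?case
    proof (cases "d = c")
      case True
      have "(\<lambda>_. 1) \<in> range ev" using rng by (auto intro: poly_on.intros)
      then obtain r where "ev r = (\<lambda>_. 1)" by auto
      hence "ev' [:0, r:] = c" by (auto simp: ev'_pCons)
      thus ?thesis using True by (metis rangeI)
    next
      case False
      hence "d \<in> range ev" using rng coord by (auto intro: poly_on.intros)
      then obtain r where "ev r = d" by auto
      hence "ev' [:r:] = d" by (auto simp: ev'_pCons)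
      thus ?thesis by (metis rangeI)
    qed
  next
    case (add f g)
    then obtain p q where "f = ev' p" "g = ev' q" by auto
    hence "(\<lambda>z. f z + g z) = ev' (p + q)" by (auto simp: add')
    thus ?case by (metis rangeI)
  next
    case (mult f g)
    then obtain p q where "f = ev' p" "g = ev' q" by auto
    hence "(\<lambda>z. f z * g z) = ev' (p * q)" by (auto simp: mult')
    thus ?case by (metis rangeI)
  qed
  ultimately show ?thesis unfolding ev'_def[symmetric] poly_model_def
    using add' mult' by auto
qed

text \<open>The cofactors \<open>F\<close> have unit gcd. If \<open>Q\<close> is proportional to
  \<open>F\<close>, then \<open>F i\<close> divides every \<open>Q i * F j\<close>, hence
  \<open>Q i\<close> times that unit; the quotient found at one nonzero \<open>F i\<close> serves
  for all indices.\<close>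

lemma Gcd_coprime_tuple:
  fixes P :: "'i \<Rightarrow> 'r::factorial_ring_gcd"
  assumes "\<exists>i. P i \<noteq> 0"
  obtains g F where "\<And>i. P i = g * F i"
    and "\<And>Q. (\<And>i j. Q i * F j = Q j * F i) \<Longrightarrow> \<exists>h. \<forall>i. Q i = h * F i"
proof -
  define g where "g = Gcd (range P)"
  have "g \<noteq> 0" using assms by (auto simp: g_def)
  have "\<exists>F. \<forall>i. P i = g * F i" unfolding g_def
    by (intro choice) (metis Gcd_dvd dvdE rangeI)
  then obtain F where F: "\<And>i. P i = g * F i" by blast
  have "range P = (*) g ` range F" using F by (auto simp: image_iff)
  \<comment> \<open>Cancelling the nonzero \<open>g\<close> from both sides leaves a unit as gcd of
    the cofactors.\<close>
  hence "normalize g = normalize (g * Gcd (range F))"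
    by (metis g_def Gcd_mult normalize_Gcd)
  hence unit: "is_unit (Gcd (range F))"
    using \<open>g \<noteq> 0\<close> by (metis associatedD2 associatedI dvd_refl dvd_times_left_cancel_iff mult.right_neutral
        associated_iff_dvd)
  obtain i where "F i \<noteq> 0" using assms F by (metis mult_zero_right)
  have "\<exists>h. \<forall>i. Q i = h * F i" if Q: "\<And>i j. Q i * F j = Q j * F i" for Q
  proof -
    have "F i dvd Gcd ((*) (Q i) ` range F)"
    proof (rule Gcd_greatest)
      fix b assume "b \<in> (*) (Q i) ` range F"
      then obtain j where "b = Q i * F j" by blast
      thus "F i dvd b" using Q[of i j] by simp
    qed
    hence "F i dvd Q i * Gcd (range F)" by (simp add: Gcd_mult)
    hence "F i dvd Q i" using unit by (simp add: dvd_mult_unit_iff)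
    then obtain h where h: "Q i = F i * h" by (rule dvdE)
    have "Q j = h * F j" for j
    proof -
      have "F i * Q j = Q i * F j" using Q[of i j] by (metis mult.commute)
      also have "\<dots> = F i * (h * F j)" by (simp add: h mult.assoc)
      finally have "F i * Q j = F i * (h * F j)" .
      thus ?thesis using \<open>F i \<noteq> 0\<close> mult_left_cancel[of "F i" "Q j" "h * F j"] by blast
    qed
    thus ?thesis by blast
  qed
  thus ?thesis using F that by blast
qed

lemma poly_on_path:
  fixes f :: "'p \<Rightarrow> 'k::comm_ring_1"
  assumes "poly_on C f" and "\<And>c. c \<in> C \<Longrightarrow> \<exists>p. \<forall>t. c (\<gamma> t) = poly p t"
  shows "\<exists>p. \<forall>t. f (\<gamma> t) = poly p t"
  using assms(1)
proof induction
  case (const c)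
  show ?case by (rule exI[of _ "[:c:]"]) simp
next
  case (add f g)
  then obtain p q where "\<forall>t. f (\<gamma> t) = poly p t" "\<forall>t. g (\<gamma> t) = poly q t" by blast
  thus ?case by (intro exI[of _ "p + q"]) simp
next
  case (mult f g)
  then obtain p q where "\<forall>t. f (\<gamma> t) = poly p t" "\<forall>t. g (\<gamma> t) = poly q t" by blast
  thus ?case by (intro exI[of _ "p * q"]) simp
qed (rule assms(2))

section \<open>Polynomials on affine space times the cone over projective space\<close>

definition bicoords :: "(('k ^ 'n) \<times> ('k ^ 'm) \<Rightarrow> 'k) set"
  where "bicoords = range (\<lambda>i z. fst z $ i) \<union> range (\<lambda>j z. snd z $ j)"

abbreviation bipoly :: "(('k::comm_ring_1 ^ 'n) \<times> ('k ^ 'm) \<Rightarrow> 'k) \<Rightarrow> bool"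
  where "bipoly \<equiv> poly_on bicoords"

lemma bipoly_fst: "bipoly (\<lambda>z. fst z $ i)" and bipoly_snd: "bipoly (\<lambda>z. snd z $ j)"
  by (auto simp: bicoords_def intro!: poly_on.coord)

lemma bipoly_line:
  fixes f :: "('k::comm_ring_1 ^ 'n) \<times> ('k ^ 'm) \<Rightarrow> 'k"
  assumes "bipoly f"
  shows "\<exists>p. \<forall>t. f (a + t *s b, x + t *s y) = poly p t"
proof (rule poly_on_path[OF assms])
  fix c :: "('k ^ 'n) \<times> ('k ^ 'm) \<Rightarrow> 'k" assume "c \<in> bicoords"
  then consider i where "c = (\<lambda>z. fst z $ i)" | j where "c = (\<lambda>z. snd z $ j)"
    by (auto simp: bicoords_def)
  thus "\<exists>p. \<forall>t. c (a + t *s b, x + t *s y) = poly p t"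
  proof cases
    case 1
    thus ?thesis by (intro exI[of _ "[:a $ i, b $ i:]"]) simp
  next
    case 2
    thus ?thesis by (intro exI[of _ "[:x $ j, y $ j:]"]) simp
  qed
qed

text \<open>Irreducibility of the product of two affine spaces: on the line joining \<open>z\<close>
  and \<open>w\<close> both functions become nonzero univariate polynomials, and their product has a
  nonroot in the infinite field.\<close>

lemma bipoly_nonzero_mult:
  fixes f g :: "('k::field_char_0 ^ 'n) \<times> ('k ^ 'm) \<Rightarrow> 'k"
  assumes "bipoly f" "bipoly g" "f z \<noteq> 0" "g w \<noteq> 0"
  shows "\<exists>u. f u \<noteq> 0 \<and> g u \<noteq> 0"
proof -
  define \<gamma> where "\<gamma> t = (fst z + t *s (fst w - fst z), snd z + t *s (snd w - snd z))" for t
  obtain p q where p: "\<And>t. f (\<gamma> t) = poly p t" and q: "\<And>t. g (\<gamma> t) = poly q t"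
    using bipoly_line[OF assms(1)] bipoly_line[OF assms(2)] unfolding \<gamma>_def by metis
  have "\<gamma> 0 = z" "\<gamma> 1 = w" by (simp_all add: \<gamma>_def prod_eq_iff)
  hence "p \<noteq> 0" "q \<noteq> 0" using p[of 0] q[of 1] assms(3,4) by auto
  hence "p * q \<noteq> 0" by simp
  then obtain t where "poly (p * q) t \<noteq> 0" using poly_all_0_iff_0 by blast
  hence "f (\<gamma> t) \<noteq> 0 \<and> g (\<gamma> t) \<noteq> 0" using p q by simp
  thus ?thesis by blast
qed

text \<open>The identity principle that removes denominators and exceptional loci: an equation known
  only where the nonzero polynomial \<open>g\<close> does not vanish holds everywhere.\<close>

lemma bipoly_mult_eq_0:
  fixes f g :: "('k::field_char_0 ^ 'n) \<times> ('k ^ 'm) \<Rightarrow> 'k"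
  assumes "bipoly f" "bipoly g" "\<And>u. f u * g u = 0" "g w \<noteq> 0"
  shows "f z = 0"
  using bipoly_nonzero_mult[OF assms(1,2), of z w] assms(3,4) mult_eq_0_iff by blast

text \<open>The affine coordinates are adjoined after the homogeneous ones, so \<open>C\<close> may
  contain all of the latter here, whereas \<open>free_snd\<close> admits only homogeneous
  coordinates in \<open>C\<close>.\<close>

lemma free_fst:
  assumes "C \<subseteq> (\<lambda>j z. fst z $ j) ` (- {i}) \<union> range (\<lambda>j z. snd z $ j)"
  shows "\<exists>z'::('k::comm_ring_1 ^ 'n) \<times> ('k ^ 'm). fst z' $ i = t \<and> (\<forall>d\<in>C. d z' = d z)"
proof (intro exI conjI ballI)
  let ?z = "((\<chi> j. if j = i then t else fst z $ j), snd z)"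
  show "fst ?z $ i = t" by simp
  show "d ?z = d z" if "d \<in> C" for d using subsetD[OF assms that] by (auto split: if_splits)
qed

lemma free_snd:
  assumes "C \<subseteq> (\<lambda>j z. snd z $ j) ` (- {i})"
  shows "\<exists>z'::('k::comm_ring_1 ^ 'n) \<times> ('k ^ 'm). snd z' $ i = t \<and> (\<forall>d\<in>C. d z' = d z)"
proof (intro exI conjI ballI)
  let ?z = "(fst z, (\<chi> j. if j = i then t else snd z $ j))"
  show "snd ?z $ i = t" by simp
  show "d ?z = d z" if "d \<in> C" for d using subsetD[OF assms that] by (auto split: if_splits)
qed

lemma bicoords_3:
  "(bicoords :: (('k ^ 3) \<times> ('k ^ 3 option) \<Rightarrow> 'k) set) =
    {\<lambda>z. fst z $ 1, \<lambda>z. fst z $ 2, \<lambda>z. fst z $ 3,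
     \<lambda>z. snd z $ None, \<lambda>z. snd z $ Some 1, \<lambda>z. snd z $ Some 2, \<lambda>z. snd z $ Some 3}"
  unfolding bicoords_def UNIV_option_conv UNIV_3 by auto

text \<open>Each of the 3 affine and 4 homogeneous coordinates costs one layer of
  \<open>poly\<close>. The tower has the gcd theory that a ring of functions on a set does not
  offer.\<close>

lemma bicoords_model:
  "\<exists>ev :: qbar poly poly poly poly poly poly poly \<Rightarrow> (qbar ^ 3) \<times> (qbar ^ 3 option) \<Rightarrow> qbar.
     poly_model ev bicoords"
  unfolding bicoords_3
  by (rule exI, (rule poly_model_step[OF _ free_fst] poly_model_step[OF _ free_snd])+,
      rule poly_model_base) auto

lemma poly_modelD:
  assumes "poly_model ev C"
  shows "ev (r + s) z = ev r z + ev s z" "ev (r * s) z = ev r z * ev s z"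
    "(\<forall>z. ev r z = 0) \<longleftrightarrow> r = 0" "range ev = Collect (poly_on C)"
  using assms unfolding poly_model_def by auto

text \<open>Transport of \<open>Gcd_coprime_tuple\<close> along the model: faithfulness turns
  pointwise proportionality into an identity of ring elements.\<close>

lemma bipoly_coprime_tuple:
  fixes P :: "'i \<Rightarrow> (qbar ^ 3) \<times> (qbar ^ 3 option) \<Rightarrow> qbar"
  assumes P: "\<And>i. bipoly (P i)" and nz: "P i0 z0 \<noteq> 0"
  obtains g F where "bipoly g" "\<And>i. bipoly (F i)" "\<And>i z. P i z = g z * F i z"
    and "\<And>Q. (\<And>i. bipoly (Q i)) \<Longrightarrow> (\<And>i j z. Q i z * F j z = Q j z * F i z) \<Longrightarrow>
      \<exists>h. \<forall>i z. Q i z = h z * F i z"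
proof -
  obtain ev :: "qbar poly poly poly poly poly poly poly \<Rightarrow> (qbar ^ 3) \<times> (qbar ^ 3 option) \<Rightarrow> qbar"
    where ev: "poly_model ev bicoords" using bicoords_model by blast
  have mult: "ev (r * s) z = ev r z * ev s z" and add: "ev (r + s) z = ev r z + ev s z"
    and faithful: "(\<forall>z. ev r z = 0) \<longleftrightarrow> r = 0" and rng: "range ev = Collect bipoly"
    for r s z by (rule poly_modelD[OF ev])+
  have ev_inj: "r = s" if "\<And>z. ev r z = ev s z" for r s
  proof -
    have "ev (r - s) z = 0" for z using add[of "r - s" s z] that[of z] by simp
    thus ?thesis using faithful[of "r - s"] by simp
  qed
  have lift: "\<exists>r. \<forall>i. f i = ev (r i)" if "\<And>i. bipoly (f i)" for f :: "'i \<Rightarrow> _"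
  proof (rule choice, rule allI)
    fix i have "f i \<in> range ev" using that rng by blast
    thus "\<exists>r. f i = ev r" by blast
  qed
  obtain p where p: "\<And>i. P i = ev (p i)" using lift[of P] P by blast
  have "p i0 \<noteq> 0" using nz p faithful by metis
  then obtain g F where gF: "\<And>i. p i = g * F i"
    and F: "\<And>Q. (\<And>i j. Q i * F j = Q j * F i) \<Longrightarrow> \<exists>h. \<forall>i. Q i = h * F i"
    using Gcd_coprime_tuple[of p] by blast
  show ?thesis
  proof (rule that[of "ev g" "\<lambda>i. ev (F i)"])
    show "bipoly (ev g)" "bipoly (ev (F i))" for i using rng by blast+
    show "P i z = ev g z * ev (F i) z" for i z by (simp add: p gF mult)
    fix Q :: "'i \<Rightarrow> _" assume Q: "\<And>i. bipoly (Q i)" and eq: "\<And>i j z. Q i z * ev (F j) z = Q j z * ev (F i) z"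
    obtain q where q: "\<And>i. Q i = ev (q i)" using lift[of Q] Q by blast
    have "q i * F j = q j * F i" for i j by (rule ev_inj) (use eq in \<open>simp add: q mult\<close>)
    then obtain h where "\<forall>i. q i = h * F i" using F by blast
    thus "\<exists>h. \<forall>i z. Q i z = h z * ev (F i) z" by (intro exI[of _ "ev h"]) (simp add: q mult)
  qed
qed

section \<open>The Zariski topologies\<close>

text \<open>Closure of \<open>B\<close> under intersection lets an induction over the generation of
  \<open>U\<close> produce a single member of \<open>B\<close> as neighbourhood. In the applications
  \<open>B\<close> consists of principal open sets, where intersecting means multiplying the
  defining functions.\<close>

lemma openin_generated_principal:
  assumes "openin (topology_generated_by S) U" "x \<in> U"
    and S: "\<And>A x. A \<in> S \<Longrightarrow> x \<in> A \<Longrightarrow> \<exists>D\<in>B. x \<in> D \<and> D \<subseteq> A"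
    and Int: "\<And>D E. D \<in> B \<Longrightarrow> E \<in> B \<Longrightarrow> D \<inter> E \<in> B"
  shows "\<exists>D\<in>B. x \<in> D \<and> D \<subseteq> U"
proof -
  have "generate_topology_on S U" using assms(1) by (simp add: openin_topology_generated_by_iff)
  thus ?thesis using assms(2)
  proof (induction arbitrary: x rule: generate_topology_on.induct)
    case (Int a b)
    then obtain D E where "D \<in> B" "x \<in> D" "D \<subseteq> a" "E \<in> B" "x \<in> E" "E \<subseteq> b" by blast
    thus ?case using assms(4)[of D E] by (intro bexI[of _ "D \<inter> E"]) auto
  next
    case (UN K)
    then obtain k where "k \<in> K" "x \<in> k" by blast
    then obtain D where "D \<in> B" "x \<in> D" "D \<subseteq> k" using UN by blast
    thus ?case using \<open>k \<in> K\<close> by blast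
  qed (use S in auto)
qed

section \<open>Lines through the origin and their spanning vectors\<close>

definition line_of :: "'k::field ^ 'm \<Rightarrow> ('k ^ 'm) set"
  where "line_of x = range (\<lambda>c. c *s x)"

lemma mem_line_of: "x \<in> line_of x"
  unfolding line_of_def by (rule range_eqI[of _ _ 1]) simp

lemma line_of_span: "line_of x = vec.span {x}"
  by (auto simp: line_of_def vec.span_singleton)

lemma lines_iff: "L \<in> lines \<longleftrightarrow> (\<exists>x. x \<noteq> 0 \<and> L = line_of (x :: 'k::field ^ 'm::finite))"
proof
  assume L: "L \<in> lines"
  obtain B where B: "B \<subseteq> L" "vec.independent B" "L \<subseteq> vec.span B" "card B = vec.dim L"
    using vec.basis_exists by blast
  hence "card B = 1" using L by (simp add: lines_def)
  then obtain x where x: "B = {x}" by (auto simp: card_1_singleton_iff)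
  have "x \<noteq> 0" using B(2) vec.dependent_zero x by fastforce
  moreover have "L = vec.span B"
    using B L vec.span_subspace by (auto simp: lines_def)
  ultimately show "\<exists>x. x \<noteq> 0 \<and> L = line_of x" using x by (auto simp: line_of_span)
next
  assume "\<exists>x. x \<noteq> 0 \<and> L = line_of x"
  then obtain x where x: "x \<noteq> 0" "L = vec.span {x}" by (auto simp: line_of_span)
  have "vec.dim L = 1" using x by (simp add: vec.dim_span_eq_card_independent vec.independent_insert)
  thus "L \<in> lines" using x by (simp add: lines_def vec.subspace_span)
qed

lemma line_of_in_lines: "x \<noteq> 0 \<Longrightarrow> line_of x \<in> lines"
  by (auto simp: lines_iff)

lemma line_of_scale:
  assumes "c \<noteq> 0"
  shows "line_of (c *s x) = line_of (x :: 'k::field ^ 'm)"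
proof (intro Set.set_eqI iffI)
  fix y assume "y \<in> line_of (c *s x)"
  then obtain d where "y = (d * c) *s x" by (auto simp: line_of_def)
  thus "y \<in> line_of x" unfolding line_of_def by (metis rangeI)
next
  fix y assume "y \<in> line_of x"
  then obtain d where "y = (d / c) *s (c *s x)" using assms by (auto simp: line_of_def)
  thus "y \<in> line_of (c *s x)" unfolding line_of_def by (metis rangeI)
qed

lemma line_of_eqI:
  assumes "y \<in> line_of x" "y \<noteq> 0"
  shows "line_of y = line_of (x :: 'k::field ^ 'm)"
proof -
  obtain c where "y = c *s x" using assms(1) by (auto simp: line_of_def)
  thus ?thesis using assms(2) line_of_scale[of c x] by auto
qed

lemma lines_line_of: "L \<in> lines \<Longrightarrow> x \<in> L \<Longrightarrow> x \<noteq> 0 \<Longrightarrow> L = line_of x"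
  using line_of_eqI by (auto simp: lines_iff)

lemma lines_nonzero: "L \<in> lines \<Longrightarrow> \<exists>x\<in>L. x \<noteq> 0"
  using mem_line_of by (auto simp: lines_iff)

section \<open>Functions polynomial in the affine and homogeneous in the projective
  coordinates\<close>

inductive bihom :: "nat \<Rightarrow> (('k::comm_ring_1 ^ 'n::finite) \<times> ('k ^ 'm::finite) \<Rightarrow> 'k) \<Rightarrow> bool" for d where
  base: "homogeneous d q \<Longrightarrow> bihom d (\<lambda>z. mpoly_eval p (fst z) * mpoly_eval q (snd z))"
| add: "bihom d f \<Longrightarrow> bihom d g \<Longrightarrow> bihom d (\<lambda>z. f z + g z)"

lemma bihom_mult:
  assumes "bihom d f" "bihom e g"
  shows "bihom (d + e) (\<lambda>z. f z * g z)"
  using assms(1)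
proof induction
  case (base q p)
  show ?case using assms(2)
  proof induction
    case (base q' p')
    show ?case
      using bihom.base[OF homogeneous_mult[OF \<open>homogeneous d q\<close> base], of "p * p'"]
      by (simp add: mpoly_eval_mult mult_ac)
  next
    case (add f g)
    thus ?case using bihom.add[OF add.IH] by (simp add: distrib_left)
  qed
next
  case (add f g)
  thus ?case using bihom.add[OF add.IH] by (simp add: distrib_right)
qed

lemma bihom_fst: "bihom 0 (\<lambda>z. mpoly_eval p (fst z))"
  using bihom.base[OF homogeneous_1, of p] by (simp add: mpoly_eval_1)

lemma bihom_snd: "homogeneous d q \<Longrightarrow> bihom d (\<lambda>z. mpoly_eval q (snd z))"
  using bihom.base[of d q 1] by (simp add: mpoly_eval_1)

lemma bihom_const: "bihom 0 (\<lambda>z. c)"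
  using bihom_fst[of "mpoly_const c"] by (simp add: mpoly_eval_const)

lemma bihom_0: "bihom d (\<lambda>z. 0)"
  using bihom.base[OF homogeneous_0, of d 0] by (simp add: mpoly_eval_0)

lemma bihom_sum: "(\<And>i. i \<in> A \<Longrightarrow> bihom d (f i)) \<Longrightarrow> bihom d (\<lambda>z. \<Sum>i\<in>A. f i z)"
  by (induction A rule: infinite_finite_induct) (auto intro: bihom.add bihom_0)

lemma bihom_prod:
  "finite A \<Longrightarrow> (\<And>i. i \<in> A \<Longrightarrow> bihom (d i) (f i)) \<Longrightarrow> bihom (\<Sum>i\<in>A. d i) (\<lambda>z. \<Prod>i\<in>A. f i z)"
  by (induction A rule: finite_induct) (auto intro: bihom_mult bihom_const)

lemma bihom_cmult: "bihom d f \<Longrightarrow> bihom d (\<lambda>z. c * f z)"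
  using bihom_mult[OF bihom_const] by fastforce

lemma bihom_power: "bihom d f \<Longrightarrow> bihom (n * d) (\<lambda>z. f z ^ n)"
  by (induction n) (auto intro: bihom_mult bihom_const)

lemma bihom_bipoly: "bihom d f \<Longrightarrow> bipoly f"
  by (induction rule: bihom.induct)
    (auto intro!: poly_on.add poly_on.mult poly_on_mpoly_eval bipoly_fst bipoly_snd)

lemma bihom_scale: "bihom d f \<Longrightarrow> f (a, c *s x) = c ^ d * f (a, x)"
  by (induction rule: bihom.induct) (auto simp: mpoly_eval_scale algebra_simps)

lemma bihom_compose:
  assumes p: "homogeneous d p" and M: "\<And>i. bihom 1 (\<lambda>z. M z $ i)"
  shows "bihom d (\<lambda>z. mpoly_eval p (M z))"
proof -
  have "bihom d (\<lambda>z. Poly_Mapping.lookup p m * (\<Prod>i\<in>UNIV. M z $ i ^ Poly_Mapping.lookup m i))"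
    if "m \<in> Poly_Mapping.keys p" for m
  proof -
    have "bihom (\<Sum>i\<in>UNIV. Poly_Mapping.lookup m i * 1) (\<lambda>z. \<Prod>i\<in>UNIV. M z $ i ^ Poly_Mapping.lookup m i)"
      by (intro bihom_prod bihom_power M) auto
    moreover have "(\<Sum>i\<in>UNIV. Poly_Mapping.lookup m i * 1) = d"
      using p that by (simp add: homogeneous_def)
    ultimately show ?thesis by (intro bihom_cmult) simp
  qed
  thus ?thesis unfolding mpoly_eval_def by (intro bihom_sum) auto
qed

lemma bihom_slice: "bihom d f \<Longrightarrow> \<exists>q. homogeneous d q \<and> (\<forall>x. f (a, x) = mpoly_eval q x)"
proof (induction rule: bihom.induct)
  case (base q p)
  have "homogeneous (0 + d) (mpoly_const (mpoly_eval p a) * q)"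
    by (intro homogeneous_mult homogeneous_const base)
  thus ?case by (intro exI[of _ "mpoly_const (mpoly_eval p a) * q"])
    (simp add: mpoly_eval_mult mpoly_eval_const)
next
  case (add f g)
  then obtain p q where "homogeneous d p" "\<forall>x. f (a, x) = mpoly_eval p x"
    "homogeneous d q" "\<forall>x. g (a, x) = mpoly_eval q x" by blast
  thus ?case by (intro exI[of _ "p + q"]) (simp add: mpoly_eval_add homogeneous_add)
qed

section \<open>Principal open sets of the three spaces\<close>

abbreviation affine_space :: "('k::field ^ 'n::finite) topology"
  where "affine_space \<equiv> zariski affine_variety"

abbreviation proj_space :: "('k::field ^ 'm::finite) set topology"
  where "proj_space \<equiv> zariski projective_variety"

abbreviation affine_times_proj ::
    "(('k::field ^ 'n::finite) \<times> ('k ^ 'm::finite) set, 'k) function_space"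
  where "affine_times_proj \<equiv> product_variety affine_variety projective_variety"

text \<open>Quantifying over all nonzero vectors of the line gives a meaning to arbitrary
  \<open>f\<close>, so that intersections are products without any condition on degrees. For
  homogeneous \<open>f\<close> one spanning vector decides, by
  \<open>line_of_in_proj_principal\<close>.\<close>

definition proj_principal :: "('k::field ^ 'm::finite \<Rightarrow> 'k) \<Rightarrow> ('k ^ 'm) set set"
  where "proj_principal f = {L \<in> lines. \<forall>x\<in>L - {0}. f x \<noteq> 0}"

definition prod_principal ::
    "(('k::field ^ 'n::finite) \<times> ('k ^ 'm::finite) \<Rightarrow> 'k) \<Rightarrow> (('k ^ 'n) \<times> ('k ^ 'm) set) set"
  where "prod_principal f = {z. snd z \<in> lines \<and> (\<forall>x\<in>snd z - {0}. f (fst z, x) \<noteq> 0)}"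

lemma line_of_in_proj_principal:
  assumes "homogeneous d p" "x \<noteq> 0"
  shows "line_of x \<in> proj_principal (mpoly_eval p) \<longleftrightarrow> mpoly_eval p x \<noteq> 0"
  using assms mem_line_of[of x] line_of_in_lines[OF assms(2)]
  by (auto simp: proj_principal_def line_of_in_lines line_of_def mpoly_eval_scale)

lemma line_of_in_prod_principal:
  assumes "bihom d f" "x \<noteq> 0"
  shows "(a, line_of x) \<in> prod_principal f \<longleftrightarrow> f (a, x) \<noteq> 0"
  using assms mem_line_of[of x] line_of_in_lines[OF assms(2)]
  by (auto simp: prod_principal_def line_of_in_lines line_of_def bihom_scale)

lemma proj_principal_Int: "proj_principal f \<inter> proj_principal g = proj_principal (\<lambda>z. f z * g z)"
  by (auto simp: proj_principal_def)

lemma prod_principal_Int: "prod_principal f \<inter> prod_principal g = prod_principal (\<lambda>z. f z * g z)"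
  by (auto simp: prod_principal_def)

lemma affine_space_eq:
  "affine_space = topology_generated_by (range (\<lambda>p. {x. mpoly_eval p x \<noteq> 0}))"
  by (simp add: affine_variety_def Let_def)

lemma proj_space_eq:
  "proj_space = topology_generated_by {proj_principal (mpoly_eval p) | p. \<exists>d. homogeneous d p}"
  by (simp add: projective_variety_def Let_def proj_principal_def)

lemma topspace_affine [simp]: "topspace affine_space = UNIV"
  by (auto simp: affine_space_eq mpoly_eval_1 intro!: exI[of _ 1])

lemma topspace_proj [simp]: "topspace proj_space = lines"
proof -
  have "proj_principal (mpoly_eval 1) = lines" by (auto simp: proj_principal_def mpoly_eval_1)
  hence "lines \<in> {proj_principal (mpoly_eval p) | p. \<exists>d. homogeneous d p}"
    using homogeneous_1 by (intro CollectI exI[of _ 1]) auto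
  moreover have "proj_principal f \<subseteq> lines" for f :: "'a ^ 'b \<Rightarrow> 'a"
    by (auto simp: proj_principal_def)
  ultimately show ?thesis unfolding proj_space_eq topology_generated_by_topspace by blast
qed

lemma affine_principal_open: "openin affine_space {x. mpoly_eval p x \<noteq> 0}"
  unfolding affine_space_eq by (rule topology_generated_by_Basis) auto

lemma proj_principal_open: "homogeneous d p \<Longrightarrow> openin proj_space (proj_principal (mpoly_eval p))"
  unfolding proj_space_eq by (rule topology_generated_by_Basis) auto

lemma affine_open_principal:
  assumes "openin affine_space U" "x \<in> U"
  shows "\<exists>p. mpoly_eval p x \<noteq> 0 \<and> {y. mpoly_eval p y \<noteq> 0} \<subseteq> U"
proof -
  let ?B = "range (\<lambda>p. {x. mpoly_eval p x \<noteq> 0})"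
  have "\<exists>D\<in>?B. x \<in> D \<and> D \<subseteq> U"
  proof (rule openin_generated_principal[OF assms(1)[unfolded affine_space_eq] assms(2)])
    fix D E :: "('a ^ 'b) set" assume "D \<in> ?B" "E \<in> ?B"
    then obtain p q where "D = {x. mpoly_eval p x \<noteq> 0}" "E = {x. mpoly_eval q x \<noteq> 0}" by blast
    hence "D \<inter> E = {x. mpoly_eval (p * q) x \<noteq> 0}" by (auto simp: mpoly_eval_mult)
    thus "D \<inter> E \<in> ?B" by blast
  next
    fix A y assume "A \<in> ?B" "y \<in> A"
    thus "\<exists>D\<in>?B. y \<in> D \<and> D \<subseteq> A" by (intro bexI[of _ A]) simp_all
  qed
  thus ?thesis by blast
qed

lemma proj_open_principal:
  assumes "openin proj_space U" "L \<in> U"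
  shows "\<exists>p d. homogeneous d p \<and> L \<in> proj_principal (mpoly_eval p) \<and> proj_principal (mpoly_eval p) \<subseteq> U"
proof -
  let ?B = "{proj_principal (mpoly_eval p) | p. \<exists>d. homogeneous d p}"
  have "\<exists>D\<in>?B. L \<in> D \<and> D \<subseteq> U"
  proof (rule openin_generated_principal[OF assms(1)[unfolded proj_space_eq] assms(2)])
    fix D E :: "('a ^ 'b) set set" assume "D \<in> ?B" "E \<in> ?B"
    then obtain p q d e where "D = proj_principal (mpoly_eval p)" "homogeneous d p"
      "E = proj_principal (mpoly_eval q)" "homogeneous e q" by blast
    hence "D \<inter> E = proj_principal (mpoly_eval (p * q))" "homogeneous (d + e) (p * q)"
      by (auto simp: mpoly_eval_mult[abs_def] proj_principal_Int homogeneous_mult)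
    thus "D \<inter> E \<in> ?B" by blast
  next
    fix A y assume "A \<in> ?B" "y \<in> A"
    thus "\<exists>D\<in>?B. y \<in> D \<and> D \<subseteq> A" by (intro bexI[of _ A]) simp_all
  qed
  thus ?thesis by blast
qed

text \<open>The explicit shape of a regular function on the product: one quotient of functions of
  equal degree, valid on a whole principal neighbourhood. The product is defined through sums of
  products of regular functions on the factors; closure of this shape under sums, products and
  quotients makes its regular functions and open sets concrete.\<close>

definition local_fraction ::
    "('k::field ^ 'n::finite) \<times> ('k ^ 'm::finite) set \<Rightarrow> (('k ^ 'n) \<times> ('k ^ 'm) set \<Rightarrow> 'k) \<Rightarrow> bool"
  where "local_fraction z0 f \<longleftrightarrow> (\<exists>e D d P Q. bihom e D \<and> bihom d P \<and> bihom d Q \<and>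
    z0 \<in> prod_principal D \<and>
    (\<forall>z\<in>prod_principal D. \<forall>x\<in>snd z - {0}. Q (fst z, x) \<noteq> 0 \<and> f z = P (fst z, x) / Q (fst z, x)))"

lemma local_fractionI:
  assumes "bihom e D" "bihom d P" "bihom d Q" "z0 \<in> prod_principal D"
    and "\<And>a L x. (a, L) \<in> prod_principal D \<Longrightarrow> x \<in> L \<Longrightarrow> x \<noteq> 0 \<Longrightarrow>
      Q (a, x) \<noteq> 0 \<and> f (a, L) = P (a, x) / Q (a, x)"
  shows "local_fraction z0 f"
proof -
  have "\<forall>z\<in>prod_principal D. \<forall>x\<in>snd z - {0}. Q (fst z, x) \<noteq> 0 \<and> f z = P (fst z, x) / Q (fst z, x)"
  proof (intro ballI)
    fix z x assume "z \<in> prod_principal D" "x \<in> snd z - {0}"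
    thus "Q (fst z, x) \<noteq> 0 \<and> f z = P (fst z, x) / Q (fst z, x)"
      using assms(5)[of "fst z" "snd z" x] by simp
  qed
  thus ?thesis using assms(1-4) unfolding local_fraction_def by blast
qed

lemma local_fractionE:
  assumes "local_fraction z0 f"
  obtains e D d P Q where "bihom e D" "bihom d P" "bihom d Q" "z0 \<in> prod_principal D"
    and "\<And>a L x. (a, L) \<in> prod_principal D \<Longrightarrow> x \<in> L \<Longrightarrow> x \<noteq> 0 \<Longrightarrow>
      Q (a, x) \<noteq> 0 \<and> f (a, L) = P (a, x) / Q (a, x)"
  using assms unfolding local_fraction_def by (metis DiffI fst_conv singletonD snd_conv)

lemma local_fraction_combine:
  assumes f: "local_fraction z0 f" and g: "local_fraction z0 g"
  shows "local_fraction z0 (\<lambda>z. f z + g z)" "local_fraction z0 (\<lambda>z. f z * g z)"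
proof -
  obtain e D d P Q where f: "bihom e D" "bihom d P" "bihom d Q" "z0 \<in> prod_principal D"
    "\<And>a L x. (a, L) \<in> prod_principal D \<Longrightarrow> x \<in> L \<Longrightarrow> x \<noteq> 0 \<Longrightarrow>
      Q (a, x) \<noteq> 0 \<and> f (a, L) = P (a, x) / Q (a, x)"
    by (rule local_fractionE[OF f]) blast
  obtain e' D' d' P' Q' where g: "bihom e' D'" "bihom d' P'" "bihom d' Q'" "z0 \<in> prod_principal D'"
    "\<And>a L x. (a, L) \<in> prod_principal D' \<Longrightarrow> x \<in> L \<Longrightarrow> x \<noteq> 0 \<Longrightarrow>
      Q' (a, x) \<noteq> 0 \<and> g (a, L) = P' (a, x) / Q' (a, x)"
    by (rule local_fractionE[OF g]) blast
  have D: "bihom (e + e') (\<lambda>z. D z * D' z)" "z0 \<in> prod_principal (\<lambda>z. D z * D' z)"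
    using f(1,4) g(1,4) by (simp_all add: bihom_mult flip: prod_principal_Int)
  have Q: "bihom (d + d') (\<lambda>z. Q z * Q' z)" and P: "bihom (d + d') (\<lambda>z. P z * P' z)"
    using f(2,3) g(2,3) by (simp_all add: bihom_mult)
  have "bihom (d + d') (\<lambda>z. P' z * Q z)" using bihom_mult[OF g(2) f(3)] by (simp add: add.commute)
  hence R: "bihom (d + d') (\<lambda>z. P z * Q' z + P' z * Q z)"
    by (rule bihom.add[OF bihom_mult[OF f(2) g(3)]])
  show "local_fraction z0 (\<lambda>z. f z * g z)"
  proof (rule local_fractionI[OF D(1) P Q D(2)])
    fix a L x assume "(a, L) \<in> prod_principal (\<lambda>z. D z * D' z)" "x \<in> L" "x \<noteq> 0"
    thus "Q (a, x) * Q' (a, x) \<noteq> 0 \<and>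
        f (a, L) * g (a, L) = P (a, x) * P' (a, x) / (Q (a, x) * Q' (a, x))"
      using f(5)[of a L x] g(5)[of a L x] by (simp flip: prod_principal_Int)
  qed
  show "local_fraction z0 (\<lambda>z. f z + g z)"
  proof (rule local_fractionI[OF D(1) R Q D(2)])
    fix a L x assume "(a, L) \<in> prod_principal (\<lambda>z. D z * D' z)" "x \<in> L" "x \<noteq> 0"
    thus "Q (a, x) * Q' (a, x) \<noteq> 0 \<and>
        f (a, L) + g (a, L) = (P (a, x) * Q' (a, x) + P' (a, x) * Q (a, x)) / (Q (a, x) * Q' (a, x))"
      using f(5)[of a L x] g(5)[of a L x] by (simp add: add_frac_eq flip: prod_principal_Int)
  qed
qed

lemma local_fraction_divide:
  assumes f: "local_fraction z0 f" and g: "local_fraction z0 g" and "g z0 \<noteq> 0"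
  shows "local_fraction z0 (\<lambda>z. f z / g z)"
proof -
  obtain e D d P Q where f: "bihom e D" "bihom d P" "bihom d Q" "z0 \<in> prod_principal D"
    "\<And>a L x. (a, L) \<in> prod_principal D \<Longrightarrow> x \<in> L \<Longrightarrow> x \<noteq> 0 \<Longrightarrow>
      Q (a, x) \<noteq> 0 \<and> f (a, L) = P (a, x) / Q (a, x)"
    by (rule local_fractionE[OF f]) blast
  obtain e' D' d' P' Q' where g: "bihom e' D'" "bihom d' P'" "bihom d' Q'" "z0 \<in> prod_principal D'"
    "\<And>a L x. (a, L) \<in> prod_principal D' \<Longrightarrow> x \<in> L \<Longrightarrow> x \<noteq> 0 \<Longrightarrow>
      Q' (a, x) \<noteq> 0 \<and> g (a, L) = P' (a, x) / Q' (a, x)"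
    by (rule local_fractionE[OF g]) blast
  have z0: "z0 = (fst z0, snd z0)" by simp
  \<comment> \<open>As \<open>g z0\<close> is nonzero, so is its numerator at \<open>z0\<close>. The
    neighbourhood is shrunk to where \<open>P'\<close> does not vanish, and \<open>P'\<close>
    becomes part of the new denominator.\<close>
  have "P' (fst z0, x) \<noteq> 0" if "x \<in> snd z0" "x \<noteq> 0" for x
    using g(5)[of "fst z0" "snd z0" x] g(4) that assms(3) by auto
  moreover have "snd z0 \<in> lines" using f(4) by (simp add: prod_principal_def)
  ultimately have "z0 \<in> prod_principal P'" by (simp add: prod_principal_def)
  hence D: "bihom (e + e' + d') (\<lambda>z. D z * D' z * P' z)" "z0 \<in> prod_principal (\<lambda>z. D z * D' z * P' z)"
    using f(1,4) g(1,2,4) by (simp_all add: bihom_mult flip: prod_principal_Int)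
  have Q: "bihom (d + d') (\<lambda>z. Q z * P' z)" and P: "bihom (d + d') (\<lambda>z. P z * Q' z)"
    using f(2,3) g(2,3) by (simp_all add: bihom_mult)
  show ?thesis
  proof (rule local_fractionI[OF D(1) P Q D(2)])
    fix a L x assume *: "(a, L) \<in> prod_principal (\<lambda>z. D z * D' z * P' z)" "x \<in> L" "x \<noteq> 0"
    hence "P' (a, x) \<noteq> 0" by (auto simp: prod_principal_def)
    thus "Q (a, x) * P' (a, x) \<noteq> 0 \<and>
        f (a, L) / g (a, L) = P (a, x) * Q' (a, x) / (Q (a, x) * P' (a, x))"
      using * f(5)[of a L x] g(5)[of a L x] by (simp flip: prod_principal_Int)
  qed
qed

lemma local_fraction_cong:
  assumes f: "local_fraction z0 f" and D: "bihom d D" "z0 \<in> prod_principal D"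
    and eq: "\<And>z. z \<in> prod_principal D \<Longrightarrow> g z = f z"
  shows "local_fraction z0 g"
proof -
  obtain e E d P Q where f: "bihom e E" "bihom d P" "bihom d Q" "z0 \<in> prod_principal E"
    "\<And>a L x. (a, L) \<in> prod_principal E \<Longrightarrow> x \<in> L \<Longrightarrow> x \<noteq> 0 \<Longrightarrow>
      Q (a, x) \<noteq> 0 \<and> f (a, L) = P (a, x) / Q (a, x)"
    by (rule local_fractionE[OF f]) blast
  have ED: "bihom (e + d) (\<lambda>z. E z * D z)" if "bihom d D" for d using f(1) that by (rule bihom_mult)
  show ?thesis
    by (rule local_fractionI[OF ED[OF D(1)] f(2,3)])
      (use f(4,5) D(2) eq in \<open>auto simp flip: prod_principal_Int\<close>)
qed

lemma local_fraction_const: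
  assumes "snd z0 \<in> lines"
  shows "local_fraction z0 (\<lambda>z. c)"
  by (rule local_fractionI[OF bihom_const[of 1] bihom_const[of c] bihom_const[of 1]])
    (use assms in \<open>auto simp: prod_principal_def\<close>)

lemma local_fraction_sum:
  assumes "snd z0 \<in> lines" "\<And>i. i \<in> A \<Longrightarrow> local_fraction z0 (f i)"
  shows "local_fraction z0 (\<lambda>z. \<Sum>i\<in>A. f i z)"
  using assms(2)
  by (induction A rule: infinite_finite_induct)
    (auto intro!: local_fraction_const assms(1) local_fraction_combine(1))

lemma regular_on_affine_iff:
  "regular_on affine_variety U f \<longleftrightarrow> (\<forall>x\<in>U. \<exists>W p q. openin affine_space W \<and> x \<in> W \<and> W \<subseteq> U \<and>
     (\<forall>y\<in>W. mpoly_eval q y \<noteq> 0 \<and> f y = mpoly_eval p y / mpoly_eval q y))"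
  by (simp add: affine_variety_def Let_def)

lemma regular_on_proj_iff:
  "regular_on projective_variety U f \<longleftrightarrow> (\<forall>L\<in>U. \<exists>W p q d. openin proj_space W \<and> L \<in> W \<and> W \<subseteq> U \<and>
     homogeneous d p \<and> homogeneous d q \<and>
     (\<forall>M\<in>W. \<forall>x\<in>M - {0}. mpoly_eval q x \<noteq> 0 \<and> f M = mpoly_eval p x / mpoly_eval q x))"
  by (simp add: projective_variety_def Let_def)

lemma product_space_eq:
  "zariski (product_variety X Y) = topology_generated_by {{z \<in> U \<times> V. h z \<noteq> 0} | U V h.
     openin (zariski X) U \<and> openin (zariski Y) V \<and> h \<in> product_functions X Y U V}"
  by (simp add: product_variety_def Let_def)

lemma regular_on_product_iff:
  "regular_on (product_variety X Y) W f \<longleftrightarrow> (\<forall>z\<in>W. \<exists>W' U V h k.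
     openin (zariski (product_variety X Y)) W' \<and> z \<in> W' \<and> W' \<subseteq> W \<and>
     openin (zariski X) U \<and> openin (zariski Y) V \<and> W' \<subseteq> U \<times> V \<and>
     h \<in> product_functions X Y U V \<and> k \<in> product_functions X Y U V \<and>
     (\<forall>w\<in>W'. k w \<noteq> 0 \<and> f w = h w / k w))"
  by (simp add: product_variety_def Let_def)

lemma affine_regular_local_fraction:
  assumes "regular_on affine_variety U f" "a \<in> U" "L \<in> lines"
  shows "local_fraction (a, L) (\<lambda>z. f (fst z))"
proof -
  obtain W p q where W: "openin affine_space W" "a \<in> W"
    "\<And>y. y \<in> W \<Longrightarrow> mpoly_eval q y \<noteq> 0 \<and> f y = mpoly_eval p y / mpoly_eval q y"
    using assms(1,2) unfolding regular_on_affine_iff by metis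
  obtain r where r: "mpoly_eval r a \<noteq> 0" "{y. mpoly_eval r y \<noteq> 0} \<subseteq> W"
    using affine_open_principal[OF W(1,2)] by blast
  show ?thesis
  proof (rule local_fractionI[OF bihom_fst[of r] bihom_fst[of p] bihom_fst[of q]])
    show "(a, L) \<in> prod_principal (\<lambda>z. mpoly_eval r (fst z))"
      using r(1) assms(3) by (simp add: prod_principal_def)
    fix b M x assume *: "(b, M) \<in> prod_principal (\<lambda>z. mpoly_eval r (fst z) :: 'a)" "x \<in> M" "x \<noteq> 0"
    hence "b \<in> W" using r(2) by (auto simp: prod_principal_def)
    thus "mpoly_eval q (fst (b, x)) \<noteq> 0 \<and>
        f (fst (b, M)) = mpoly_eval p (fst (b, x)) / mpoly_eval q (fst (b, x))"
      using W(3) by simp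
  qed
qed

lemma proj_regular_local_fraction:
  assumes "regular_on projective_variety V f" "L \<in> V"
  shows "local_fraction (a, L) (\<lambda>z. f (snd z))"
proof -
  obtain W p q d where W: "openin proj_space W" "L \<in> W" "homogeneous d p" "homogeneous d q"
    "\<And>M x. M \<in> W \<Longrightarrow> x \<in> M - {0} \<Longrightarrow> mpoly_eval q x \<noteq> 0 \<and> f M = mpoly_eval p x / mpoly_eval q x"
    using assms unfolding regular_on_proj_iff by metis
  obtain r e where r: "homogeneous e r" "L \<in> proj_principal (mpoly_eval r)"
    "proj_principal (mpoly_eval r) \<subseteq> W"
    using proj_open_principal[OF W(1,2)] by blast
  show ?thesis
  proof (rule local_fractionI[OF bihom_snd[OF r(1)] bihom_snd[OF W(3)] bihom_snd[OF W(4)]])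
    show "(a, L) \<in> prod_principal (\<lambda>z. mpoly_eval r (snd z))"
      using r(2) by (simp add: prod_principal_def proj_principal_def)
    fix b :: "'a ^ 'c" and M x
    assume *: "(b, M) \<in> prod_principal (\<lambda>z. mpoly_eval r (snd z) :: 'a)" "x \<in> M" "x \<noteq> 0"
    hence "M \<in> W" using r(3) by (auto simp: prod_principal_def proj_principal_def)
    thus "mpoly_eval q (snd (b, x)) \<noteq> 0 \<and>
        f (snd (b, M)) = mpoly_eval p (snd (b, x)) / mpoly_eval q (snd (b, x))"
      using W(5) * by simp
  qed
qed

lemma product_function_local_fraction:
  assumes h: "h \<in> product_functions affine_variety projective_variety U V"
    and "a \<in> U" "L \<in> V" "L \<in> lines"
  shows "local_fraction (a, L) h"
proof -
  obtain n f g where h: "h = (\<lambda>(x, y). \<Sum>i<(n::nat). f i x * g i y)"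
    and reg: "\<And>i. i < n \<Longrightarrow> regular_on affine_variety U (f i) \<and> regular_on projective_variety V (g i)"
    using h unfolding product_functions_def by blast
  have "local_fraction (a, L) (\<lambda>z. \<Sum>i<n. f i (fst z) * g i (snd z))"
    by (intro local_fraction_sum local_fraction_combine(2)
          affine_regular_local_fraction[OF conjunct1[OF reg]]
          proj_regular_local_fraction[OF conjunct2[OF reg]])
      (use assms(2-4) in auto)
  thus ?thesis unfolding h case_prod_unfold .
qed

text \<open>A subbasic open set is the locus where a sum of products of regular functions does not
  vanish. Near a given point that sum is a fraction, which vanishes exactly with its numerator, so
  the locus contains a principal neighbourhood.\<close>

lemma prod_open_principal:
  assumes "openin (zariski affine_times_proj) W" "z \<in> W"
  shows "\<exists>d D. bihom d D \<and> z \<in> prod_principal D \<and> prod_principal D \<subseteq> W"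
proof -
  let ?B = "{prod_principal D | D. \<exists>d. bihom d D}"
  have "\<exists>D\<in>?B. z \<in> D \<and> D \<subseteq> W"
  proof (rule openin_generated_principal[OF assms(1)[unfolded product_space_eq] assms(2)])
    fix D E :: "(('a ^ 'b) \<times> ('a ^ 'c) set) set" assume "D \<in> ?B" "E \<in> ?B"
    then obtain p q d e where "D = prod_principal p" "bihom d p" "E = prod_principal q" "bihom e q"
      by blast
    hence "D \<inter> E = prod_principal (\<lambda>z. p z * q z)" "bihom (d + e) (\<lambda>z. p z * q z)"
      by (simp_all add: prod_principal_Int bihom_mult)
    thus "D \<inter> E \<in> ?B" by blast
  next
    fix A and y :: "('a ^ 'b) \<times> ('a ^ 'c) set"
    assume A: "A \<in> {{z \<in> U \<times> V. h z \<noteq> 0} | U V h. openin affine_space U \<and> openin proj_space V \<and>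
        h \<in> product_functions affine_variety projective_variety U V}" and "y \<in> A"
    then obtain U V h where UV: "A = {z \<in> U \<times> V. h z \<noteq> 0}" "openin affine_space U" "openin proj_space V"
      and h: "h \<in> product_functions affine_variety projective_variety U V" by blast
    have y: "fst y \<in> U" "snd y \<in> V" "h y \<noteq> 0" using \<open>y \<in> A\<close> UV(1) by auto
    have "snd y \<in> lines" using openin_subset[OF UV(3)] y(2) by auto
    have "local_fraction (fst y, snd y) h"
      by (rule product_function_local_fraction) fact+
    then obtain e D d P Q where f: "bihom e D" "bihom d P" "bihom d Q" "y \<in> prod_principal D"
      "\<And>a L x. (a, L) \<in> prod_principal D \<Longrightarrow> x \<in> L \<Longrightarrow> x \<noteq> 0 \<Longrightarrow>
        Q (a, x) \<noteq> 0 \<and> h (a, L) = P (a, x) / Q (a, x)"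
      unfolding prod.collapse by (rule local_fractionE) blast
    obtain p where p: "mpoly_eval p (fst y) \<noteq> 0" "{x. mpoly_eval p x \<noteq> 0} \<subseteq> U"
      using affine_open_principal[OF UV(2) y(1)] by blast
    obtain q c where q: "homogeneous c q" "snd y \<in> proj_principal (mpoly_eval q)"
      "proj_principal (mpoly_eval q) \<subseteq> V"
      using proj_open_principal[OF UV(3) y(2)] by blast
    \<comment> \<open>The factors express in turn that the first component lies in \<open>U\<close>,
      that the second lies in \<open>V\<close>, that the fraction represents \<open>h\<close>, and
      that \<open>h\<close> is nonzero.\<close>
    define E where "E = (\<lambda>z. mpoly_eval p (fst z) * mpoly_eval q (snd z) * (D z * P z))"
    have "bihom (0 + c + (e + d)) E" unfolding E_def
      by (intro bihom_mult f bihom_fst bihom_snd q)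
    have E: "prod_principal E = prod_principal (\<lambda>z. mpoly_eval p (fst z)) \<inter>
        prod_principal (\<lambda>z. mpoly_eval q (snd z)) \<inter> (prod_principal D \<inter> prod_principal P)"
      by (simp add: E_def prod_principal_Int)
    have "P (fst y, x) \<noteq> 0" if "x \<in> snd y" "x \<noteq> 0" for x
      using f(5)[of "fst y" "snd y" x] f(4) that y(3) by auto
    hence "y \<in> prod_principal E" unfolding E using f(4) p(1) q(2) \<open>snd y \<in> lines\<close>
      by (auto simp: prod_principal_def proj_principal_def)
    moreover have "prod_principal E \<subseteq> A"
    proof
      fix w assume "w \<in> prod_principal E"
      hence w: "w \<in> prod_principal (\<lambda>z. mpoly_eval p (fst z))" "w \<in> prod_principal (\<lambda>z. mpoly_eval q (snd z))"
        "w \<in> prod_principal D" "w \<in> prod_principal P" unfolding E by auto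
      hence "snd w \<in> lines" by (simp add: prod_principal_def)
      then obtain x where x: "x \<in> snd w" "x \<noteq> 0" using lines_nonzero by blast
      have "fst w \<in> U" using w(1) x p(2) by (auto simp: prod_principal_def)
      moreover have "snd w \<in> V" using w(2) q(3) by (auto simp: prod_principal_def proj_principal_def)
      moreover have "P (fst w, x) \<noteq> 0" using w(4) x by (simp add: prod_principal_def)
      hence "h w \<noteq> 0" using f(5)[of "fst w" "snd w" x] w(3) x by simp
      ultimately show "w \<in> A" by (simp add: UV(1) mem_Times_iff)
    qed
    ultimately show "\<exists>D\<in>?B. y \<in> D \<and> D \<subseteq> A" using \<open>bihom (0 + c + (e + d)) E\<close> by blast
  qed
  thus ?thesis by blast
qed

lemma product_regular_local_fraction:
  assumes "regular_on affine_times_proj W f" "z \<in> W"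
  shows "local_fraction z f"
proof -
  obtain W' U V h k where W': "openin (zariski affine_times_proj) W'" "z \<in> W'"
    "openin affine_space U" "openin proj_space V" "W' \<subseteq> U \<times> V"
    and hk: "h \<in> product_functions affine_variety projective_variety U V"
      "k \<in> product_functions affine_variety projective_variety U V"
    and f: "\<And>w. w \<in> W' \<Longrightarrow> k w \<noteq> 0 \<and> f w = h w / k w"
    using assms unfolding regular_on_product_iff by metis
  have z: "fst z \<in> U" "snd z \<in> V" using W' by auto
  have "snd z \<in> lines" using openin_subset[OF W'(4)] z(2) by auto
  have "local_fraction (fst z, snd z) h" "local_fraction (fst z, snd z) k"
    by (rule product_function_local_fraction; fact)+
  hence "local_fraction z (\<lambda>w. h w / k w)" using f[OF W'(2)]
    by (intro local_fraction_divide) simp_all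
  moreover obtain d D where "bihom d D" "z \<in> prod_principal D" "prod_principal D \<subseteq> W'"
    using prod_open_principal[OF W'(1,2)] by blast
  ultimately show ?thesis using f
    by (intro local_fraction_cong[of z "\<lambda>w. h w / k w" d D f]) blast+
qed

lemma product_functions_add:
  assumes "h \<in> product_functions X Y U V" "k \<in> product_functions X Y U V"
  shows "(\<lambda>z. h z + k z) \<in> product_functions X Y U V"
proof -
  obtain n f g where h: "h = (\<lambda>(x, y). \<Sum>i<(n::nat). f i x * g i y)"
    and fg: "\<And>i. i < n \<Longrightarrow> regular_on X U (f i) \<and> regular_on Y V (g i)"
    using assms(1) unfolding product_functions_def by blast
  obtain n' f' g' where k: "k = (\<lambda>(x, y). \<Sum>i<(n'::nat). f' i x * g' i y)"
    and fg': "\<And>i. i < n' \<Longrightarrow> regular_on X U (f' i) \<and> regular_on Y V (g' i)"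
    using assms(2) unfolding product_functions_def by blast
  define F where "F i = (if i < n then f i else f' (i - n))" for i
  define G where "G i = (if i < n then g i else g' (i - n))" for i
  have "(\<Sum>i<n + n'. F i x * G i y) = (\<Sum>i<n. f i x * g i y) + (\<Sum>i<n'. f' i x * g' i y)" for x y
  proof -
    have "(\<Sum>i=n..<n + n'. F i x * G i y) = (\<Sum>i=0..<n'. f' i x * g' i y)"
      using sum.shift_bounds_nat_ivl[of "\<lambda>i. F i x * G i y" 0 n n']
      by (simp add: F_def G_def add.commute)
    moreover have "(\<Sum>i=0..<n. F i x * G i y) = (\<Sum>i=0..<n. f i x * g i y)"
      by (simp add: F_def G_def)
    ultimately show ?thesis
      using sum.atLeastLessThan_concat[of 0 n "n + n'" "\<lambda>i. F i x * G i y"]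
      by (simp add: lessThan_atLeast0)
  qed
  hence "(\<lambda>z. h z + k z) = (\<lambda>(x, y). \<Sum>i<n + n'. F i x * G i y)"
    by (simp add: h k case_prod_unfold)
  moreover have "\<forall>i<n + n'. regular_on X U (F i) \<and> regular_on Y V (G i)"
    using fg fg' by (simp add: F_def G_def)
  ultimately show ?thesis unfolding product_functions_def by blast
qed

section \<open>Standard charts, and openness of principal sets in the product\<close>

definition chart :: "'m \<Rightarrow> ('k::field ^ 'm::finite) set set"
  where "chart j = proj_principal (\<lambda>x. x $ j)"

lemma chart_eq: "chart j = proj_principal (mpoly_eval (mpoly_var j))"
  by (simp add: chart_def mpoly_eval_var[abs_def])

lemma chart_open: "openin proj_space (chart j)"
  unfolding chart_eq by (rule proj_principal_open[OF homogeneous_var])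

lemma chart_cover: "L \<in> lines \<Longrightarrow> \<exists>j. L \<in> chart j"
proof -
  assume "L \<in> lines"
  then obtain x where x: "x \<noteq> 0" "L = line_of x" by (auto simp: lines_iff)
  then obtain j where "x $ j \<noteq> 0" by (auto simp: vec_eq_iff)
  thus ?thesis using x line_of_in_proj_principal[OF homogeneous_var[of j] x(1)]
    by (auto simp: chart_eq mpoly_eval_var)
qed

text \<open>The vector of \<open>L\<close> whose \<open>j\<close>-th coordinate is 1; arbitrary outside the chart.\<close>

definition chart_vec :: "'m \<Rightarrow> ('k::field ^ 'm::finite) set \<Rightarrow> 'k ^ 'm"
  where "chart_vec j L = (SOME x. x \<in> L \<and> x $ j = 1)"

lemma chart_vec:
  assumes "L \<in> chart j" "x \<in> L" "x \<noteq> 0"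
  shows "chart_vec j L = (1 / x $ j) *s x" "x $ j \<noteq> 0"
proof -
  show nz: "x $ j \<noteq> 0" using assms by (auto simp: chart_def proj_principal_def)
  have L: "L = line_of x" using assms lines_line_of by (auto simp: chart_def proj_principal_def)
  have "y = (1 / x $ j) *s x" if "y \<in> L \<and> y $ j = 1" for y
    using that nz by (auto simp: L line_of_def field_simps)
  moreover have "(1 / x $ j) *s x \<in> L \<and> ((1 / x $ j) *s x) $ j = 1"
    unfolding L line_of_def using nz by auto
  ultimately show "chart_vec j L = (1 / x $ j) *s x" unfolding chart_vec_def
    by (intro some_equality) auto
qed

text \<open>Dehomogenization: the value at the normalized vector is \<open>q\<close> at any spanning
  vector \<open>x\<close> divided by \<open>x $ j ^ d\<close>, a fraction of two forms of degree
  \<open>d\<close>.\<close>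

lemma regular_on_chart:
  fixes q :: "('m::finite, 'k::field) mpoly"
  assumes "homogeneous d q"
  shows "regular_on projective_variety (chart j) (\<lambda>L. mpoly_eval q (chart_vec j L))"
  unfolding regular_on_proj_iff
proof (intro ballI exI conjI)
  fix L assume "L \<in> chart j"
  show "openin proj_space (chart j)" by (rule chart_open)
  show "L \<in> chart j" by fact
  show "homogeneous d q" by fact
  show "homogeneous d (mpoly_var j ^ d)" using homogeneous_power[OF homogeneous_var, of d] by simp
  fix M :: "('k ^ 'm) set" and x assume "M \<in> chart j" "x \<in> M - {0}"
  hence c: "chart_vec j M = (1 / x $ j) *s x" "x $ j \<noteq> 0" using chart_vec by blast+
  have pow: "mpoly_eval (mpoly_var j ^ n) x = (x $ j) ^ n" for n
    by (induction n) (auto simp: mpoly_eval_1 mpoly_eval_mult mpoly_eval_var)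
  show "mpoly_eval (mpoly_var j ^ d) x \<noteq> 0" using c(2) by (simp add: pow)
  show "mpoly_eval q (chart_vec j M) = mpoly_eval q x / mpoly_eval (mpoly_var j ^ d) x"
    unfolding c(1) mpoly_eval_scale[OF assms] pow by (simp add: power_divide)
qed simp

lemma mpoly_regular: "regular_on affine_variety UNIV (mpoly_eval p)"
  unfolding regular_on_affine_iff
  by (intro ballI exI[of _ UNIV] exI[of _ p] exI[of _ 1])
    (use openin_topspace[of affine_space] in \<open>auto simp: mpoly_eval_1\<close>)

text \<open>Each generator of \<open>bihom\<close> splits into a polynomial on the affine factor and
  a dehomogenized form on the chart; these are the products that \<open>product_functions\<close>
  sums up.\<close>

lemma bihom_product_function:
  assumes "bihom d f"
  shows "(\<lambda>z. f (fst z, chart_vec j (snd z))) \<in> product_functions affine_variety projective_variety UNIV (chart j)"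
  using assms
proof induction
  case (base q p)
  show ?case unfolding product_functions_def
    by (intro CollectI exI[of _ "1::nat"] exI[of _ "\<lambda>_. mpoly_eval p"]
        exI[of _ "\<lambda>_ L. mpoly_eval q (chart_vec j L)"])
      (auto simp: case_prod_unfold mpoly_regular regular_on_chart[OF base])
next
  case (add f g)
  thus ?case using product_functions_add[OF add.IH] by simp
qed

text \<open>Converse of \<open>prod_open_principal\<close>. The value of \<open>f\<close> depends on
  the spanning vector, so openness is checked chart by chart, where the normalized vector turns
  \<open>f\<close> into a function on the product.\<close>

lemma prod_principal_open:
  assumes "bihom d f"
  shows "openin (zariski affine_times_proj) (prod_principal f)"
proof (subst openin_subopen, intro ballI)
  fix z assume z: "z \<in> prod_principal f"
  hence "snd z \<in> lines" by (simp add: prod_principal_def)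
  then obtain j where j: "snd z \<in> chart j" using chart_cover by blast
  let ?W = "{z \<in> UNIV \<times> chart j. f (fst z, chart_vec j (snd z)) \<noteq> 0}"
  have eq: "w \<in> prod_principal f \<longleftrightarrow> f (fst w, chart_vec j (snd w)) \<noteq> 0" if w: "snd w \<in> chart j" for w
  proof -
    have l: "snd w \<in> lines" using w by (simp add: chart_def proj_principal_def)
    then obtain x where x: "x \<in> snd w" "x \<noteq> 0" using lines_nonzero by blast
    have "snd w = line_of x" using lines_line_of l x by blast
    hence "w \<in> prod_principal f \<longleftrightarrow> f (fst w, x) \<noteq> 0"
      using line_of_in_prod_principal[OF assms x(2), of "fst w"] by (metis prod.collapse)
    thus ?thesis using chart_vec[OF w x] by (simp add: bihom_scale[OF assms])
  qed
  have "openin (zariski affine_times_proj) ?W"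
    unfolding product_space_eq
  proof (rule topology_generated_by_Basis, intro CollectI exI conjI)
    show "openin affine_space UNIV" using openin_topspace[of affine_space] by simp
    show "openin proj_space (chart j)" by (rule chart_open)
    show "(\<lambda>z. f (fst z, chart_vec j (snd z))) \<in>
        product_functions affine_variety projective_variety UNIV (chart j)"
      by (rule bihom_product_function[OF assms])
  qed (rule refl)
  thus "\<exists>T. openin (zariski affine_times_proj) T \<and> z \<in> T \<and> T \<subseteq> prod_principal f"
    using z j eq by (intro exI[of _ ?W]) (auto simp: mem_Times_iff)
qed

lemma topspace_product [simp]: "topspace (zariski affine_times_proj) = UNIV \<times> lines"
proof
  show "topspace (zariski affine_times_proj) \<subseteq> UNIV \<times> lines"
    using prod_open_principal[OF openin_topspace] by (force simp: prod_principal_def)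
  have "UNIV \<times> lines = prod_principal (\<lambda>_. 1)" by (auto simp: prod_principal_def)
  also have "\<dots> \<subseteq> topspace (zariski affine_times_proj)"
    by (rule openin_subset[OF prod_principal_open[OF bihom_const]])
  finally show "UNIV \<times> lines \<subseteq> topspace (zariski affine_times_proj)" .
qed

section \<open>Morphisms from the product to projective space\<close>

lemma chart_vec_mem:
  assumes "L \<in> chart j"
  shows "chart_vec j L \<in> L" "chart_vec j L \<noteq> 0"
proof -
  have "L \<in> lines" using assms by (simp add: chart_def proj_principal_def)
  then obtain x where x: "x \<in> L" "x \<noteq> 0" using lines_nonzero by blast
  have "L = line_of x" using lines_line_of \<open>L \<in> lines\<close> x by blast
  thus "chart_vec j L \<in> L" "chart_vec j L \<noteq> 0"
    using chart_vec[OF assms x] x(2) by (auto simp: line_of_def)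
qed

lemma lines_scale: "L \<in> lines \<Longrightarrow> x \<in> L \<Longrightarrow> c *s x \<in> L"
  by (simp add: lines_def vec.subspace_scale)

lemma lines_proportional:
  assumes "L \<in> lines" "x \<in> L" "y \<in> L"
  shows "x $ i * y $ j = x $ j * y $ i"
proof -
  obtain v where "L = line_of v" using assms(1) by (auto simp: lines_iff)
  then obtain c d where "x = c *s v" "y = d *s v" using assms(2,3) by (auto simp: line_of_def)
  thus ?thesis by simp
qed

text \<open>In a chart around the image of \<open>z0\<close> the normalized coordinates of the image
  are regular on the source, hence fractions near \<open>z0\<close>. Clearing all denominators gives
  a polynomial tuple that spans the image line.\<close>

lemma morphism_local_rep:
  fixes \<Phi> :: "('k::field ^ 'n::finite) \<times> ('k ^ 'm::finite) set \<Rightarrow> ('k ^ 'l::finite) set"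
  assumes \<Phi>: "morphism affine_times_proj projective_variety \<Phi>" and z0: "snd z0 \<in> lines"
  obtains e D d P where "bihom e D" "z0 \<in> prod_principal D" "\<And>i. bihom d (P i)"
    and "\<And>a L x. (a, L) \<in> prod_principal D \<Longrightarrow> x \<in> L \<Longrightarrow> x \<noteq> 0 \<Longrightarrow>
      (\<chi> i. P i (a, x)) \<noteq> 0 \<and> (\<chi> i. P i (a, x)) \<in> \<Phi> (a, L)"
proof -
  have cont: "continuous_map (zariski affine_times_proj) proj_space \<Phi>"
    and reg: "\<And>V g. openin proj_space V \<Longrightarrow> regular_on projective_variety V g \<Longrightarrow>
      regular_on affine_times_proj {x \<in> points affine_times_proj. \<Phi> x \<in> V} (g \<circ> \<Phi>)"
    using \<Phi> unfolding morphism_def by blast+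
  have lines: "\<Phi> z \<in> lines" if "snd z \<in> lines" for z
    using continuous_map_image_subset_topspace[OF cont] that by (auto simp: mem_Times_iff)
  then obtain j where j: "\<Phi> z0 \<in> chart j" using chart_cover z0 by blast
  define W0 where "W0 = {z \<in> UNIV \<times> lines. \<Phi> z \<in> chart j}"
  have "z0 \<in> W0" using z0 j by (auto simp: W0_def mem_Times_iff)
  have "openin (zariski affine_times_proj) W0"
    using openin_continuous_map_preimage[OF cont chart_open[of j]] by (simp add: W0_def)
  then obtain e0 D0 where D0: "bihom e0 D0" "z0 \<in> prod_principal D0" "prod_principal D0 \<subseteq> W0"
    using prod_open_principal \<open>z0 \<in> W0\<close> by blast
  have "local_fraction z0 (\<lambda>z. chart_vec j (\<Phi> z) $ i)" for i
  proof -
    have "regular_on projective_variety (chart j) (\<lambda>L. chart_vec j L $ i)"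
      using regular_on_chart[OF homogeneous_var[of i], of j] by (simp add: mpoly_eval_var)
    hence "regular_on affine_times_proj W0 ((\<lambda>L. chart_vec j L $ i) \<circ> \<Phi>)"
      using reg[OF chart_open] by (simp add: W0_def)
    thus ?thesis using product_regular_local_fraction[OF _ \<open>z0 \<in> W0\<close>] by (simp add: o_def)
  qed
  hence "\<forall>i. \<exists>e D d P Q. bihom e D \<and> bihom d P \<and> bihom d Q \<and> z0 \<in> prod_principal D \<and>
    (\<forall>z\<in>prod_principal D. \<forall>x\<in>snd z - {0}. Q (fst z, x) \<noteq> 0 \<and>
      chart_vec j (\<Phi> z) $ i = P (fst z, x) / Q (fst z, x))"
    unfolding local_fraction_def by blast
  then obtain e D d N Q where
    loc: "\<And>i. bihom (e i) (D i)" "\<And>i. bihom (d i) (N i)" "\<And>i. bihom (d i) (Q i)"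
      "\<And>i. z0 \<in> prod_principal (D i)"
    and val: "\<And>i z x. z \<in> prod_principal (D i) \<Longrightarrow> x \<in> snd z - {0} \<Longrightarrow> Q i (fst z, x) \<noteq> 0 \<and>
      chart_vec j (\<Phi> z) $ i = N i (fst z, x) / Q i (fst z, x)"
    by metis
  define E where "E z = D0 z * (\<Prod>i\<in>UNIV. D i z)" for z
  \<comment> \<open>In the product of all denominators the factor \<open>Q i\<close> is replaced by
    the numerator \<open>N i\<close> of the same degree, so all entries have the common degree that
    is the sum of the \<open>d i\<close>.\<close>
  define P where "P i z = N i z * (\<Prod>l\<in>UNIV - {i}. Q l z)" for i z
  show ?thesis
  proof (rule that)
    show "bihom (e0 + (\<Sum>i\<in>UNIV. e i)) E" unfolding E_def[abs_def]
      by (intro bihom_mult bihom_prod D0 loc) simp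
    show "z0 \<in> prod_principal E" using D0(2) loc(4) by (simp add: E_def prod_principal_def)
    show "bihom (\<Sum>i\<in>UNIV. d i) (P i)" for i
    proof -
      have "bihom (d i + (\<Sum>i\<in>UNIV - {i}. d i)) (P i)" unfolding P_def[abs_def]
        by (intro bihom_mult bihom_prod loc) simp
      thus ?thesis by (simp add: sum.remove[of UNIV i])
    qed
    fix a L x assume aL: "(a, L) \<in> prod_principal E" and x: "x \<in> L" "x \<noteq> 0"
    have D0': "(a, L) \<in> prod_principal D0" and D: "(a, L) \<in> prod_principal (D i)" for i
      using aL by (simp_all add: E_def prod_principal_def)
    have "\<Phi> (a, L) \<in> chart j" using D0' D0(3) by (auto simp: W0_def)
    note cv = chart_vec_mem[OF this]
    have q: "Q i (a, x) \<noteq> 0" "N i (a, x) = chart_vec j (\<Phi> (a, L)) $ i * Q i (a, x)" for i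
      using val[OF D, of x i] x by simp_all
    define c where "c = (\<Prod>i\<in>UNIV. Q i (a, x))"
    have "c \<noteq> 0" using q(1) by (simp add: c_def)
    have "c = Q i (a, x) * (\<Prod>l\<in>UNIV - {i}. Q l (a, x))" for i
      unfolding c_def by (rule prod.remove) simp_all
    hence "(\<chi> i. P i (a, x)) = c *s chart_vec j (\<Phi> (a, L))"
      by (simp add: vec_eq_iff P_def q(2) mult_ac)
    moreover have "\<Phi> (a, L) \<in> lines" using lines[of "(a, L)"] aL by (simp add: prod_principal_def)
    ultimately show "(\<chi> i. P i (a, x)) \<noteq> 0 \<and> (\<chi> i. P i (a, x)) \<in> \<Phi> (a, L)"
      using cv \<open>c \<noteq> 0\<close> lines_scale by simp
  qed
qed

text \<open>Dividing a local representation by its greatest common divisor makes it a global one.\<close>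

lemma morphism_global_rep:
  fixes \<Phi> :: "(qbar ^ 3) \<times> (qbar ^ 3 option) set \<Rightarrow> (qbar ^ 'l::finite) set"
  assumes \<Phi>: "morphism affine_times_proj projective_variety \<Phi>"
  obtains F where "\<And>i. bipoly (F i)"
    and "\<And>a x. x \<noteq> 0 \<Longrightarrow> (\<chi> i. F i (a, x)) \<noteq> 0"
    and "\<And>a x. x \<noteq> 0 \<Longrightarrow> (\<chi> i. F i (a, x)) \<in> \<Phi> (a, line_of x)"
proof -
  have cont: "continuous_map (zariski affine_times_proj) proj_space \<Phi>"
    using \<Phi> unfolding morphism_def by blast
  have lines: "\<Phi> z \<in> lines" if "snd z \<in> lines" for z
    using continuous_map_image_subset_topspace[OF cont] that by (auto simp: mem_Times_iff)
  define x1 :: "qbar ^ 3 option" where "x1 = axis None 1"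
  have "x1 \<noteq> 0" by (simp add: x1_def axis_eq_0_iff)
  have "snd (0 :: qbar ^ 3, line_of x1) \<in> lines" using line_of_in_lines[OF \<open>x1 \<noteq> 0\<close>] by simp
  then obtain e D d P where D: "bihom e D" "(0, line_of x1) \<in> prod_principal D" and P: "\<And>i. bihom d (P i)"
    and PD: "\<And>a L x. (a, L) \<in> prod_principal D \<Longrightarrow> x \<in> L \<Longrightarrow> x \<noteq> 0 \<Longrightarrow>
      (\<chi> i. P i (a, x)) \<noteq> 0 \<and> (\<chi> i. P i (a, x)) \<in> \<Phi> (a, L)"
    by (rule morphism_local_rep[OF \<Phi>]) blast
  have "(\<chi> i. P i (0, x1)) \<noteq> 0" using PD[OF D(2) mem_line_of] \<open>x1 \<noteq> 0\<close> by blast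
  then obtain i1 where "P i1 (0, x1) \<noteq> 0" by (auto simp: vec_eq_iff)
  then obtain g F where g: "bipoly g" and F: "\<And>i. bipoly (F i)" and gF: "\<And>i z. P i z = g z * F i z"
    and cop: "\<And>Q. (\<And>i. bipoly (Q i)) \<Longrightarrow> (\<And>i j z. Q i z * F j z = Q j z * F i z) \<Longrightarrow>
      \<exists>h. \<forall>i z. Q i z = h z * F i z"
    using bipoly_coprime_tuple[of P] bihom_bipoly[OF P] by metis
  have D1: "D (0, x1) \<noteq> 0" using line_of_in_prod_principal[OF D(1) \<open>x1 \<noteq> 0\<close>] D(2) by simp
  have "(\<chi> i. F i (a, x)) \<noteq> 0 \<and> (\<chi> i. F i (a, x)) \<in> \<Phi> (a, line_of x)" if x: "x \<noteq> 0" for a x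
  proof -
    have "snd (a, line_of x) \<in> lines" using line_of_in_lines[OF x] by simp
    then obtain e' D' d' P' where D': "bihom e' D'" "(a, line_of x) \<in> prod_principal D'"
      and P': "\<And>i. bihom d' (P' i)"
      and PD': "\<And>a L x. (a, L) \<in> prod_principal D' \<Longrightarrow> x \<in> L \<Longrightarrow> x \<noteq> 0 \<Longrightarrow>
        (\<chi> i. P' i (a, x)) \<noteq> 0 \<and> (\<chi> i. P' i (a, x)) \<in> \<Phi> (a, L)"
      by (rule morphism_local_rep[OF \<Phi>]) blast
    have D2: "D' (a, x) \<noteq> 0" using line_of_in_prod_principal[OF D'(1) x] D'(2) by simp
    obtain u where u: "D u \<noteq> 0" "D' u \<noteq> 0"
      using bipoly_nonzero_mult[OF bihom_bipoly[OF D(1)] bihom_bipoly[OF D'(1)] D1 D2] by blast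
    have DD': "bipoly (\<lambda>z. D z * D' z)" using D(1) D'(1) by (intro poly_on.mult bihom_bipoly)
    \<comment> \<open>The coordinate \<open>None\<close> is included to keep the vector part of the
      point nonzero, so that it spans a line.\<close>
    obtain v where v: "D v * D' v \<noteq> 0" "snd v $ None \<noteq> 0"
      using bipoly_nonzero_mult[OF DD' bipoly_snd[of None], of u "(0, x1)"] u by (auto simp: x1_def axis_def)
    \<comment> \<open>Both local tuples span the same image line wherever \<open>D\<close>,
      \<open>D'\<close> and the coordinate \<open>None\<close> are nonzero. They are proportional
      there and, by the identity principle, everywhere.\<close>
    have "P' i z * F j z = P' j z * F i z" for i j z
    proof -
      have "P' i z * F j z - P' j z * F i z = 0"
      proof (rule bipoly_mult_eq_0)
        show "bipoly (\<lambda>z. P' i z * F j z - P' j z * F i z)"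
          by (intro poly_on_diff poly_on.mult F bihom_bipoly[OF P'])
        show "bipoly (\<lambda>z. D z * D' z * snd z $ None)" by (intro poly_on.mult[OF DD'] bipoly_snd)
        show "D v * D' v * snd v $ None \<noteq> 0" using v by simp
        fix w
        show "(P' i w * F j w - P' j w * F i w) * (D w * D' w * snd w $ None) = 0"
        proof (cases "D w * D' w * snd w $ None = 0")
          case False
          obtain b y where w: "w = (b, y)" by fastforce
          have y: "y \<noteq> 0" using False w by auto
          have "(b, line_of y) \<in> prod_principal D" "(b, line_of y) \<in> prod_principal D'"
            using False w line_of_in_prod_principal[OF D(1) y] line_of_in_prod_principal[OF D'(1) y]
            by auto
          hence *: "(\<chi> i. P i (b, y)) \<in> \<Phi> (b, line_of y)" "(\<chi> i. P' i (b, y)) \<in> \<Phi> (b, line_of y)"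
            "(\<chi> i. P i (b, y)) \<noteq> 0"
            using PD PD' mem_line_of y by blast+
          have "g w \<noteq> 0" using *(3) by (auto simp: vec_eq_iff gF w)
          have "P' i w * P j w = P' j w * P i w"
            using lines_proportional[OF lines *(2,1), of i j] line_of_in_lines[OF y] by (simp add: w)
          hence "g w * (P' i w * F j w) = g w * (P' j w * F i w)" by (simp add: gF mult_ac)
          thus ?thesis using \<open>g w \<noteq> 0\<close> by simp
        qed simp
      qed
      thus ?thesis by simp
    qed
    \<comment> \<open>Coprimality makes the second tuple a multiple of \<open>F\<close>. As that
      tuple is nonzero at \<open>(a, x)\<close>, so is \<open>F\<close>, and both span the same
      line.\<close>
    then obtain h where h: "\<And>i z. P' i z = h z * F i z" using cop[of P'] bihom_bipoly[OF P'] by blast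
    have *: "(\<chi> i. P' i (a, x)) \<noteq> 0" "(\<chi> i. P' i (a, x)) \<in> \<Phi> (a, line_of x)"
      using PD'[OF D'(2) mem_line_of x] by blast+
    have eq: "(\<chi> i. P' i (a, x)) = h (a, x) *s (\<chi> i. F i (a, x))" by (simp add: vec_eq_iff h)
    hence nz: "h (a, x) \<noteq> 0" "(\<chi> i. F i (a, x)) \<noteq> 0" using *(1) by auto
    have "(\<chi> i. F i (a, x)) = (1 / h (a, x)) *s (\<chi> i. P' i (a, x))" using nz(1) by (simp add: eq)
    moreover have "\<Phi> (a, line_of x) \<in> lines" using lines line_of_in_lines[OF x] by simp
    ultimately show ?thesis using nz(2) *(2) lines_scale by metis
  qed
  thus ?thesis using that F by blast
qed

section \<open>The degree of the representing tuple in the projective coordinates\<close>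

lemma bipoly_scale_poly:
  fixes f :: "('k::comm_ring_1 ^ 'n) \<times> ('k ^ 'm) \<Rightarrow> 'k"
  assumes "bipoly f"
  shows "\<exists>p. (\<forall>a x s. f (a, s *s x) = poly (p (a, x)) s) \<and> (\<forall>k. bipoly (\<lambda>z. poly.coeff (p z) k))"
  using assms
proof induction
  case (const c)
  show ?case by (rule exI[of _ "\<lambda>_. [:c:]"]) (auto intro: poly_on.const)
next
  case (coord c)
  then consider i where "c = (\<lambda>z. fst z $ i)" | j where "c = (\<lambda>z. snd z $ j)"
    by (auto simp: bicoords_def)
  thus ?case
  proof cases
    case 1
    have "bipoly (\<lambda>z :: ('k ^ 'n) \<times> ('k ^ 'm). poly.coeff [:fst z $ i:] k)" for k
      by (cases k) (auto intro: bipoly_fst poly_on.const)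
    thus ?thesis by (intro exI[of _ "\<lambda>z. [:fst z $ i:]"]) (simp add: 1)
  next
    case 2
    have "bipoly (\<lambda>z :: ('k ^ 'n) \<times> ('k ^ 'm). poly.coeff [:0, snd z $ j:] k)" for k
    proof -
      consider "k = 0" | "k = 1" | n where "k = Suc (Suc n)" by (metis One_nat_def not0_implies_Suc)
      thus ?thesis by cases (auto intro: bipoly_snd poly_on.const)
    qed
    thus ?thesis by (intro exI[of _ "\<lambda>z. [:0, snd z $ j:]"]) (simp add: 2)
  qed
next
  case (add f g)
  then obtain p q where
    "\<forall>a x s. f (a, s *s x) = poly (p (a, x)) s" "\<forall>k. bipoly (\<lambda>z. poly.coeff (p z) k)"
    "\<forall>a x s. g (a, s *s x) = poly (q (a, x)) s" "\<forall>k. bipoly (\<lambda>z. poly.coeff (q z) k)" by blast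
  thus ?case by (intro exI[of _ "\<lambda>z. p z + q z"]) (auto intro: poly_on.add)
next
  case (mult f g)
  then obtain p q where
    "\<forall>a x s. f (a, s *s x) = poly (p (a, x)) s" "\<forall>k. bipoly (\<lambda>z. poly.coeff (p z) k)"
    "\<forall>a x s. g (a, s *s x) = poly (q (a, x)) s" "\<forall>k. bipoly (\<lambda>z. poly.coeff (q z) k)" by blast
  thus ?case by (intro exI[of _ "\<lambda>z. p z * q z"])
    (auto simp: coeff_mult intro!: poly_on_sum poly_on.mult)
qed

lemma poly_no_roots_const:
  fixes p :: "'k::alg_closed_field poly"
  assumes "\<And>s. poly p s \<noteq> 0"
  shows "poly p s = poly p t"
proof -
  have "Polynomial.degree p = 0" using alg_closed_imp_poly_has_root[of p] assms by blast
  thus ?thesis by (metis degree_0_id poly_const_conv)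
qed

text \<open>All roots sit at 0, so after splitting off the power of the variable a polynomial
  without roots remains, which is constant over an algebraically closed field.\<close>

lemma poly_no_nonzero_roots:
  fixes p :: "'k::alg_closed_field poly"
  assumes nz: "\<And>s. s \<noteq> 0 \<Longrightarrow> poly p s \<noteq> 0"
  shows "\<exists>c e. c \<noteq> 0 \<and> p = Polynomial.monom c e"
proof -
  have "p \<noteq> 0" using nz[of 1] by auto
  define e where "e = Polynomial.order 0 p"
  obtain q where q: "p = [:- 0, 1:] ^ e * q" "\<not> [:- 0, 1:] dvd q"
    using order_decomp[OF \<open>p \<noteq> 0\<close>, of 0] unfolding e_def by blast
  have "poly q s \<noteq> 0" for s
    using nz[of s] q by (cases "s = 0") (auto simp: poly_eq_0_iff_dvd)
  hence "Polynomial.degree q = 0" using alg_closed_imp_poly_has_root[of q] by blast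
  then obtain c where c: "q = [:c:]" by (metis degree_0_id)
  have "p = Polynomial.monom c e" by (simp add: q(1) c monom_altdef)
  moreover have "c \<noteq> 0" using \<open>p \<noteq> 0\<close> calculation by auto
  ultimately show ?thesis by blast
qed

text \<open>Taylor expansion to first order in the vector variable, with coefficients polynomial in
  the affine variable and all higher terms collected in \<open>q\<close>. Once the degree is known
  to be 1, the values \<open>m j a\<close> are matrix entries of the action.\<close>

lemma bipoly_linear_part:
  fixes f :: "('k::comm_ring_1 ^ 'n) \<times> ('k ^ 'm::finite) \<Rightarrow> 'k"
  assumes "bipoly f"
  shows "\<exists>c m. poly_on (range (\<lambda>i a. a $ i)) c \<and> (\<forall>j. poly_on (range (\<lambda>i a. a $ i)) (m j)) \<and>
    (\<forall>a x. \<exists>q. \<forall>s. f (a, s *s x) = c a + s * (\<Sum>j\<in>UNIV. m j a * x $ j) + s\<^sup>2 * poly q s)"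
  using assms
proof induction
  case (const b)
  show ?case
    by (rule exI[of _ "\<lambda>_. b"], rule exI[of _ "\<lambda>_ _. 0"]) (auto intro!: poly_on.const exI[of _ 0])
next
  case (coord d)
  then consider i where "d = (\<lambda>z. fst z $ i)" | j where "d = (\<lambda>z. snd z $ j)"
    by (auto simp: bicoords_def)
  thus ?case
  proof cases
    case 1
    show ?thesis unfolding 1
      by (rule exI[of _ "\<lambda>a. a $ i"], rule exI[of _ "\<lambda>_ _. 0"])
        (auto intro!: poly_on.const poly_on.coord exI[of _ 0])
  next
    case 2
    have "(\<Sum>l\<in>UNIV. (if l = j then 1 else 0) * x $ l) = x $ j" for x :: "'k ^ 'm"
      by (simp add: if_distrib[of "\<lambda>b. b * _"] cong: if_cong)
    thus ?thesis unfolding 2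
      by (intro exI[of _ "\<lambda>_. 0"] exI[of _ "\<lambda>l _. if l = j then 1 else 0"])
        (auto intro!: poly_on.const exI[of _ 0])
  qed
next
  case (add f g)
  from add.IH(1) obtain c m where c: "poly_on (range (\<lambda>i a. a $ i)) c"
    and m: "\<forall>j. poly_on (range (\<lambda>i a. a $ i)) (m j)"
    and f: "\<forall>a x. \<exists>q. \<forall>s. f (a, s *s x) = c a + s * (\<Sum>j\<in>UNIV. m j a * x $ j) + s\<^sup>2 * poly q s"
    by (elim exE conjE)
  from add.IH(2) obtain c' m' where c': "poly_on (range (\<lambda>i a. a $ i)) c'"
    and m': "\<forall>j. poly_on (range (\<lambda>i a. a $ i)) (m' j)"
    and g: "\<forall>a x. \<exists>q. \<forall>s. g (a, s *s x) = c' a + s * (\<Sum>j\<in>UNIV. m' j a * x $ j) + s\<^sup>2 * poly q s"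
    by (elim exE conjE)
  show ?case
  proof (rule exI[of _ "\<lambda>a. c a + c' a"], rule exI[of _ "\<lambda>j a. m j a + m' j a"], intro conjI allI)
    fix a x
    obtain p q where p: "\<And>s. f (a, s *s x) = c a + s * (\<Sum>j\<in>UNIV. m j a * x $ j) + s\<^sup>2 * poly p s"
      and q: "\<And>s. g (a, s *s x) = c' a + s * (\<Sum>j\<in>UNIV. m' j a * x $ j) + s\<^sup>2 * poly q s"
      using f[rule_format, of a x] g[rule_format, of a x] by blast
    show "\<exists>q. \<forall>s. f (a, s *s x) + g (a, s *s x) =
        c a + c' a + s * (\<Sum>j\<in>UNIV. (m j a + m' j a) * x $ j) + s\<^sup>2 * poly q s"
      by (rule exI[of _ "p + q"]) (simp add: p q algebra_simps sum.distrib)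
  qed (intro poly_on.add c c' m[rule_format] m'[rule_format])+
next
  case (mult f g)
  from mult.IH(1) obtain c m where c: "poly_on (range (\<lambda>i a. a $ i)) c"
    and m: "\<forall>j. poly_on (range (\<lambda>i a. a $ i)) (m j)"
    and f: "\<forall>a x. \<exists>q. \<forall>s. f (a, s *s x) = c a + s * (\<Sum>j\<in>UNIV. m j a * x $ j) + s\<^sup>2 * poly q s"
    by (elim exE conjE)
  from mult.IH(2) obtain c' m' where c': "poly_on (range (\<lambda>i a. a $ i)) c'"
    and m': "\<forall>j. poly_on (range (\<lambda>i a. a $ i)) (m' j)"
    and g: "\<forall>a x. \<exists>q. \<forall>s. g (a, s *s x) = c' a + s * (\<Sum>j\<in>UNIV. m' j a * x $ j) + s\<^sup>2 * poly q s"
    by (elim exE conjE)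
  show ?case
  proof (rule exI[of _ "\<lambda>a. c a * c' a"], rule exI[of _ "\<lambda>j a. c a * m' j a + c' a * m j a"], intro conjI allI)
    fix a x
    define S where "S = (\<Sum>j\<in>UNIV. m j a * x $ j)"
    define S' where "S' = (\<Sum>j\<in>UNIV. m' j a * x $ j)"
    obtain p q where p: "\<And>s. f (a, s *s x) = c a + s * S + s\<^sup>2 * poly p s"
      and q: "\<And>s. g (a, s *s x) = c' a + s * S' + s\<^sup>2 * poly q s"
      using f[rule_format, of a x] g[rule_format, of a x] unfolding S_def S'_def by blast
    have "(\<Sum>j\<in>UNIV. (c a * m' j a + c' a * m j a) * x $ j) = c a * S' + c' a * S"
      by (simp add: S_def S'_def sum_distrib_left distrib_right sum.distrib mult.assoc)
    thus "\<exists>q. \<forall>s. f (a, s *s x) * g (a, s *s x) =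
        c a * c' a + s * (\<Sum>j\<in>UNIV. (c a * m' j a + c' a * m j a) * x $ j) + s\<^sup>2 * poly q s"
      by (intro exI[of _ "[:S * S':] + [:c a, S:] * q + [:c' a, S':] * p + [:0, 0, 1:] * p * q"])
        (simp add: p q algebra_simps power2_eq_square)
  qed (intro poly_on.add poly_on.mult c c' m[rule_format] m'[rule_format])+
qed

lemma poly_eq_infinite:
  fixes p q :: "'k::field_char_0 poly"
  assumes "\<And>s. s \<noteq> 0 \<Longrightarrow> poly p s = poly q s"
  shows "p = q"
proof -
  have "poly ([:0, 1:] * (p - q)) s = 0" for s using assms[of s] by (cases "s = 0") auto
  hence "[:0, 1:] * (p - q) = 0" using poly_all_0_iff_0 by blast
  thus ?thesis by simp
qed

text \<open>Scaling a vector does not move its line, so for nonzero \<open>s\<close> the tuples at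
  \<open>s *s x\<close> and at \<open>x\<close> are proportional. An entry that is nonzero at
  \<open>x\<close> thus has no root in \<open>s\<close> except possibly 0 and is a monomial in
  \<open>s\<close>; proportionality gives all entries the same exponent, and irreducibility makes
  the exponent independent of the point.\<close>

lemma morphism_homogeneous_rep:
  fixes \<Phi> :: "(qbar ^ 3) \<times> (qbar ^ 3 option) set \<Rightarrow> (qbar ^ 'l::finite) set"
  assumes \<Phi>: "morphism affine_times_proj projective_variety \<Phi>"
  obtains F d where "\<And>i. bipoly (F i)"
    and "\<And>a x. x \<noteq> 0 \<Longrightarrow> (\<chi> i. F i (a, x)) \<noteq> 0"
    and "\<And>a x. x \<noteq> 0 \<Longrightarrow> (\<chi> i. F i (a, x)) \<in> \<Phi> (a, line_of x)"
    and "\<And>i a x s. F i (a, s *s x) = s ^ d * F i (a, x)"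
proof -
  have cont: "continuous_map (zariski affine_times_proj) proj_space \<Phi>"
    using \<Phi> unfolding morphism_def by blast
  have lines: "\<Phi> z \<in> lines" if "snd z \<in> lines" for z
    using continuous_map_image_subset_topspace[OF cont] that by (auto simp: mem_Times_iff)
  obtain F where F: "\<And>i. bipoly (F i)" and nz: "\<And>a x. x \<noteq> 0 \<Longrightarrow> (\<chi> i. F i (a, x)) \<noteq> 0"
    and mem: "\<And>a x. x \<noteq> 0 \<Longrightarrow> (\<chi> i. F i (a, x)) \<in> \<Phi> (a, line_of x)"
    by (rule morphism_global_rep[OF \<Phi>]) blast
  have "\<forall>i. \<exists>p. (\<forall>a x s. F i (a, s *s x) = poly (p (a, x)) s) \<and> (\<forall>k. bipoly (\<lambda>z. poly.coeff (p z) k))"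
    by (rule allI, rule bipoly_scale_poly[OF F])
  from choice[OF this] obtain p where
    "\<forall>i. (\<forall>a x s. F i (a, s *s x) = poly (p i (a, x)) s) \<and> (\<forall>k. bipoly (\<lambda>z. poly.coeff (p i z) k))" ..
  hence p: "\<And>i a x s. F i (a, s *s x) = poly (p i (a, x)) s"
    and bp: "\<And>i k. bipoly (\<lambda>z. poly.coeff (p i z) k)"
    by simp_all
  have ratio: "F i (a, s *s x) * F j (a, x) = F j (a, s *s x) * F i (a, x)"
    if "x \<noteq> 0" "s \<noteq> 0" for i j a x s
  proof -
    have "(\<chi> i. F i (a, s *s x)) \<in> \<Phi> (a, line_of x)"
      using mem[of "s *s x" a] line_of_scale[OF that(2), of x] that by simp
    moreover have "\<Phi> (a, line_of x) \<in> lines" using lines line_of_in_lines[OF that(1)] by simp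
    ultimately have "(\<chi> i. F i (a, s *s x)) $ i * (\<chi> i. F i (a, x)) $ j =
        (\<chi> i. F i (a, s *s x)) $ j * (\<chi> i. F i (a, x)) $ i"
      using lines_proportional mem[OF that(1)] by blast
    thus ?thesis by simp
  qed
  have mono: "\<exists>e. \<forall>j. p j (a, x) = Polynomial.monom (F j (a, x)) e" if x: "x \<noteq> 0" for a x
  proof -
    obtain i where i: "F i (a, x) \<noteq> 0" using nz[OF x] by (auto simp: vec_eq_iff)
    have "poly (p i (a, x)) s \<noteq> 0" if "s \<noteq> 0" for s
    proof
      assume "poly (p i (a, x)) s = 0"
      hence "F i (a, s *s x) = 0" by (simp add: p)
      hence "F j (a, s *s x) = 0" for j using ratio[OF x that, of j a i] i by simp
      thus False using nz[of "s *s x" a] x that by (simp add: vec_eq_iff)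
    qed
    then obtain c e where c: "p i (a, x) = Polynomial.monom c e"
      using poly_no_nonzero_roots by blast
    have ci: "F i (a, x) = c" using p[of i a 1 x] by (simp add: c poly_monom)
    have "p j (a, x) = Polynomial.monom (F j (a, x)) e" for j
    proof (rule poly_eq_infinite)
      fix s :: qbar assume s: "s \<noteq> 0"
      have "F j (a, s *s x) * c = s ^ e * c * F j (a, x)"
        using ratio[OF x s, of j a i] by (simp add: p[of i] c poly_monom ci mult_ac)
      thus "poly (p j (a, x)) s = poly (Polynomial.monom (F j (a, x)) e) s"
        using i ci by (simp add: p poly_monom)
    qed
    thus ?thesis by blast
  qed
  define x1 :: "qbar ^ 3 option" where "x1 = axis None 1"
  have "x1 \<noteq> 0" by (simp add: x1_def axis_eq_0_iff)
  obtain d where d: "\<And>j. p j (0, x1) = Polynomial.monom (F j (0, x1)) d" using mono[OF \<open>x1 \<noteq> 0\<close>] by blast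
  obtain i where i: "F i (0, x1) \<noteq> 0" using nz[OF \<open>x1 \<noteq> 0\<close>] by (auto simp: vec_eq_iff)
  have "poly.coeff (p i (0, x1)) d \<noteq> 0" using i by (simp add: d)
  moreover have "snd (0 :: qbar ^ 3, x1) $ None \<noteq> 0" by (simp add: x1_def)
  ultimately obtain v where v: "poly.coeff (p i v) d \<noteq> 0" "snd v $ None \<noteq> 0"
    using bipoly_nonzero_mult[OF bp bipoly_snd] by blast
  \<comment> \<open>At a point with nonzero vector all entries are monomials of one exponent, so
    coefficients of degrees \<open>k\<close> and \<open>d\<close> cannot both be nonzero. The
    coefficient of degree \<open>d\<close> is a nonzero polynomial, hence the other one vanishes
    identically.\<close>
  have coeff0: "poly.coeff (p j z) k = 0" if "k \<noteq> d" for j k z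
  proof (rule bipoly_mult_eq_0[OF bp])
    show "poly.coeff (p i v) d * snd v $ None \<noteq> 0" using v by simp
    show "bipoly (\<lambda>z. poly.coeff (p i z) d * snd z $ None)" by (intro poly_on.mult bp bipoly_snd)
    fix u
    show "poly.coeff (p j u) k * (poly.coeff (p i u) d * snd u $ None) = 0"
    proof (cases "snd u = 0")
      case False
      then obtain e where "\<And>j. p j u = Polynomial.monom (F j u) e" using mono[of "snd u" "fst u"] by auto
      thus ?thesis using that by auto
    qed simp
  qed
  have "F j (a, s *s x) = s ^ d * F j (a, x)" for j a x s
  proof -
    have "p j (a, x) = Polynomial.monom (poly.coeff (p j (a, x)) d) d"
      by (rule poly_eqI) (use coeff0 in auto)
    hence "F j (a, t *s x) = poly.coeff (p j (a, x)) d * t ^ d" for t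
      by (metis p poly_monom)
    from this[of s] this[of 1] show ?thesis by simp
  qed
  with F nz mem show ?thesis by (rule that)
qed

text \<open>The degree is read off at the neutral element, where the tuple is \<open>c x\<close>
  times \<open>x\<close> with \<open>c\<close> free of zeros. On an affine line where some
  coordinate of \<open>x\<close> is 1, \<open>c\<close> is a polynomial without zeros and so
  constant. Comparing two such lines gives degree 1, and then the first order part of the tuple is
  all of it.\<close>

lemma action_linear_rep:
  fixes \<Phi> :: "(qbar ^ 3) \<times> (qbar ^ 3 option) set \<Rightarrow> (qbar ^ 3 option) set"
  assumes \<Phi>: "morphism affine_times_proj projective_variety \<Phi>"
    and \<Phi>0: "\<And>L. L \<in> lines \<Longrightarrow> \<Phi> (0, L) = L"
  obtains M where "\<And>i j. poly_on (range (\<lambda>i a. a $ i)) (\<lambda>a. M a $ i $ j)"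
    and "\<And>a x. x \<noteq> 0 \<Longrightarrow> M a *v x \<noteq> 0"
    and "\<And>a x. x \<noteq> 0 \<Longrightarrow> M a *v x \<in> \<Phi> (a, line_of x)"
proof -
  obtain F d where F: "\<And>i. bipoly (F i)"
    and nz: "\<And>a x. x \<noteq> 0 \<Longrightarrow> (\<chi> i. F i (a, x)) \<noteq> 0"
    and mem: "\<And>a x. x \<noteq> 0 \<Longrightarrow> (\<chi> i. F i (a, x)) \<in> \<Phi> (a, line_of x)"
    and scale: "\<And>i a x s. F i (a, s *s x) = s ^ d * F i (a, x)"
    by (rule morphism_homogeneous_rep[OF \<Phi>]) blast
  \<comment> \<open>One coordinate plane is enough: the lines formed by \<open>v 1 t\<close> and by
    \<open>v t 1\<close> meet in \<open>v 1 1\<close>, and \<open>v 1 2\<close> is twice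
    \<open>v (1/2) 1\<close>.\<close>
  define v :: "qbar \<Rightarrow> qbar \<Rightarrow> qbar ^ 3 option"
    where "v r s = (\<chi> i. if i = None then r else if i = Some 1 then s else 0)" for r s
  have v [simp]: "v r s $ None = r" "v r s $ Some 1 = s" for r s by (simp_all add: v_def)
  have v_scale: "c *s v r s = v (c * r) (c * s)" for c r s by (simp add: v_def vec_eq_iff)
  have v_add: "v r s + v r' s' = v (r + r') (s + s')" for r s r' s' by (simp add: v_def vec_eq_iff)
  have v0: "v r s \<noteq> 0" if "r \<noteq> 0 \<or> s \<noteq> 0" for r s using that v[of r s] by (metis zero_index)
  have "\<exists>c. c \<noteq> 0 \<and> (\<forall>i. F i (0, x) = c * x $ i)" if "x \<noteq> 0" for x
  proof -
    have "(\<chi> i. F i (0, x)) \<in> line_of x" using mem[OF that, of 0] \<Phi>0[OF line_of_in_lines[OF that]] by simp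
    then obtain c where "(\<chi> i. F i (0, x)) = c *s x" by (auto simp: line_of_def)
    moreover have "c \<noteq> 0" using nz[OF that, of 0] calculation by auto
    ultimately show ?thesis by (auto simp: vec_eq_iff)
  qed
  then obtain c where c: "\<And>x. x \<noteq> 0 \<Longrightarrow> c x \<noteq> 0" "\<And>x i. x \<noteq> 0 \<Longrightarrow> F i (0, x) = c x * x $ i"
    by (metis (no_types, lifting))
  have c1: "c (v 1 s) = c (v 1 t)" for s t
  proof -
    obtain p where p: "\<And>t. F None (0 + t *s 0, v 1 0 + t *s v 0 1) = poly p t"
      using bipoly_line[OF F[of None]] by blast
    have "c (v 1 t) = poly p t" for t
      using p[of t] c(2)[of "v 1 t" None] v0[of 1 t] by (simp add: v_scale v_add)
    thus ?thesis using poly_no_roots_const[of p s t] c(1) v0 by (metis zero_neq_one)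
  qed
  have c2: "c (v s 1) = c (v t 1)" for s t
  proof -
    obtain p where p: "\<And>t. F (Some 1) (0 + t *s 0, v 0 1 + t *s v 1 0) = poly p t"
      using bipoly_line[OF F[of "Some 1"]] by blast
    have "c (v t 1) = poly p t" for t
      using p[of t] c(2)[of "v t 1" "Some 1"] v0[of t 1] by (simp add: v_scale v_add)
    thus ?thesis using poly_no_roots_const[of p s t] c(1) v0 by (metis zero_neq_one)
  qed
  \<comment> \<open>With \<open>c\<close> constant along both lines, the left side is
    \<open>2 * c (v 1 1)\<close> and the right side is \<open>2 ^ d * c (v 1 1)\<close>.\<close>
  have "F (Some 1) (0, v 1 2) = 2 ^ d * F (Some 1) (0, v (1/2) 1)"
    using scale[of "Some 1" 0 2 "v (1/2) 1"] by (simp add: v_scale)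
  hence "2 * c (v 1 1) = 2 ^ d * c (v 1 1)"
    using c(2)[of "v 1 2" "Some 1"] c(2)[of "v (1/2) 1" "Some 1"] v0 c1[of 2 1] c2[of "1/2" 1] by simp
  hence "(2 :: qbar) ^ d = 2" using c(1)[of "v 1 1"] v0 by simp
  hence "of_nat (2 ^ d) = (of_nat 2 :: qbar)" by simp
  hence "(2 :: nat) ^ d = 2 ^ 1" unfolding of_nat_eq_iff by simp
  hence "d = 1" using power_inject_exp[of "2 :: nat" d 1] by simp
  have "\<forall>i. \<exists>c m. poly_on (range (\<lambda>i a. a $ i)) c \<and> (\<forall>j. poly_on (range (\<lambda>i a. a $ i)) (m j)) \<and>
    (\<forall>a x. \<exists>q. \<forall>s. F i (a, s *s x) = c a + s * (\<Sum>j\<in>UNIV. m j a * x $ j) + s\<^sup>2 * poly q s)"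
    by (rule allI, rule bipoly_linear_part[OF F])
  from choice[OF this] obtain b where
    "\<forall>i. \<exists>m. poly_on (range (\<lambda>i a. a $ i)) (b i) \<and> (\<forall>j. poly_on (range (\<lambda>i a. a $ i)) (m j)) \<and>
    (\<forall>a x. \<exists>q. \<forall>s. F i (a, s *s x) = b i a + s * (\<Sum>j\<in>UNIV. m j a * x $ j) + s\<^sup>2 * poly q s)" ..
  from choice[OF this] obtain m where
    "\<forall>i. poly_on (range (\<lambda>i a. a $ i)) (b i) \<and> (\<forall>j. poly_on (range (\<lambda>i a. a $ i)) (m i j)) \<and>
    (\<forall>a x. \<exists>q. \<forall>s. F i (a, s *s x) = b i a + s * (\<Sum>j\<in>UNIV. m i j a * x $ j) + s\<^sup>2 * poly q s)" ..
  hence m: "\<And>i j. poly_on (range (\<lambda>i a. a $ i)) (m i j)"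
    and lin: "\<And>i a x. \<exists>q. \<forall>s. F i (a, s *s x) = b i a + s * (\<Sum>j\<in>UNIV. m i j a * x $ j) + s\<^sup>2 * poly q s"
    by simp_all
  define M where "M a = (\<chi> i j. m i j a)" for a
  have FM: "(\<chi> i. F i (a, x)) = M a *v x" for a x
  proof -
    have "F i (a, x) = (\<Sum>j\<in>UNIV. m i j a * x $ j)" for i
    proof -
      obtain q where q: "\<And>s. F i (a, s *s x) = b i a + s * (\<Sum>j\<in>UNIV. m i j a * x $ j) + s\<^sup>2 * poly q s"
        using lin[of i a x] by blast
      have "[:0, F i (a, x):] = [:b i a, \<Sum>j\<in>UNIV. m i j a * x $ j:] + [:0, 0, 1:] * q"
        by (rule poly_eq_infinite) (use q scale[of i a _ x] \<open>d = 1\<close> in \<open>simp add: power2_eq_square algebra_simps\<close>)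
      hence "poly.coeff [:0, F i (a, x):] 1 = poly.coeff ([:b i a, \<Sum>j\<in>UNIV. m i j a * x $ j:] + [:0, 0, 1:] * q) 1"
        by simp
      thus ?thesis by (simp add: coeff_pCons)
    qed
    thus ?thesis by (simp add: vec_eq_iff M_def matrix_vector_mult_def)
  qed
  show ?thesis
  proof (rule that)
    show "poly_on (range (\<lambda>i a. a $ i)) (\<lambda>a. M a $ i $ j)" for i j using m[of i j] by (simp add: M_def)
    show "M a *v x \<noteq> 0" if "x \<noteq> 0" for a x using nz[OF that] by (simp add: FM)
    show "M a *v x \<in> \<Phi> (a, line_of x)" if "x \<noteq> 0" for a x using mem[OF that, of a] by (simp add: FM)
  qed
qed

section \<open>Linearization of the action\<close>

lemma matrix_vector_mult_axis: "(A *v axis j 1) $ i = A $ i $ j"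
  for A :: "'k::comm_ring_1 ^ 'n::finite ^ 'm::finite"
  by (simp add: matrix_vector_mult_def axis_def if_distrib[of "\<lambda>b. _ * b"] cong: if_cong)

text \<open>Every vector is an eigenvector. The basis vectors make the matrix diagonal, and the
  vector with all entries 1 compares the diagonal entries.\<close>

lemma scalar_matrix:
  fixes A :: "'k::field ^ 'm::finite ^ 'm"
  assumes "\<And>x. \<exists>c. A *v x = c *s x"
  shows "\<exists>c. \<forall>x. A *v x = c *s x"
proof -
  obtain c where c: "\<And>x. A *v x = c x *s x" using assms by metis
  have A: "A $ i $ j = (if i = j then c (axis j 1) else 0)" for i j
    using c[of "axis j 1"] by (simp flip: matrix_vector_mult_axis) (simp add: axis_def)
  have "c (axis i 1) = c (\<chi> i. 1)" for i
  proof -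
    have "(A *v (\<chi> i. 1)) $ i = c (\<chi> i. 1)" by (subst c) simp
    thus ?thesis by (simp add: matrix_vector_mult_def A)
  qed
  hence "A *v x = c (\<chi> i. 1) *s x" for x
    by (simp add: vec_eq_iff matrix_vector_mult_def A if_distrib[of "\<lambda>b. b * _"] cong: if_cong)
  thus ?thesis by blast
qed

text \<open>\<open>B\<close> is invertible, so \<open>A\<close> times the inverse of
  \<open>B\<close> has every vector as an eigenvector and is a scalar.\<close>

lemma proportional_matrices:
  fixes A B :: "'k::field ^ 'm::finite ^ 'm"
  assumes nz: "\<And>x. x \<noteq> 0 \<Longrightarrow> B *v x \<noteq> 0" and "\<And>x. \<exists>c. A *v x = c *s (B *v x)"
  shows "\<exists>c. \<forall>x. A *v x = c *s (B *v x)"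
proof -
  have "inj ((*v) B)"
  proof (rule injI)
    fix x y assume "B *v x = B *v y"
    hence "B *v (x - y) = 0" by (simp add: matrix_vector_mult_diff_distrib)
    thus "x = y" using nz[of "x - y"] by auto
  qed
  then obtain C where CB: "C ** B = mat 1" using matrix_left_invertible_injective by blast
  hence BC: "B ** C = mat 1" by (simp add: matrix_left_right_inverse)
  have "\<exists>c. (A ** C) *v y = c *s y" for y
    using assms(2)[of "C *v y"] BC by (metis matrix_vector_mul_assoc matrix_vector_mul_lid)
  then obtain c where c: "\<And>y. (A ** C) *v y = c *s y" using scalar_matrix by blast
  have "A *v x = c *s (B *v x)" for x
    using c[of "B *v x"] CB by (metis matrix_mul_assoc matrix_mul_rid matrix_vector_mul_assoc)
  thus ?thesis by blast
qed

lemma apoly_line: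
  fixes f :: "'k::comm_ring_1 ^ 'n \<Rightarrow> 'k"
  assumes "poly_on (range (\<lambda>i a. a $ i)) f"
  shows "\<exists>p. \<forall>t. f (a + t *s b) = poly p t"
proof (rule poly_on_path[OF assms])
  fix c :: "'k ^ 'n \<Rightarrow> 'k" assume "c \<in> range (\<lambda>i a. a $ i)"
  then obtain i where "c = (\<lambda>a. a $ i)" by blast
  thus "\<exists>p. \<forall>t. c (a + t *s b) = poly p t"
    by (intro exI[of _ "[:a $ i, b $ i:]"]) simp
qed

lemma det_poly_on:
  fixes M :: "'p \<Rightarrow> 'k::comm_ring_1 ^ 'm::finite ^ 'm"
  assumes "\<And>i j. poly_on C (\<lambda>a. M a $ i $ j)"
  shows "poly_on C (\<lambda>a. det (M a))"
  unfolding det_def by (intro poly_on_sum poly_on.mult poly_on.const poly_on_prod assms)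

lemma det_scalar_mult: "det (\<chi> i j. c * A $ i $ j) = c ^ CARD('m) * det A"
  for A :: "'k::comm_ring_1 ^ 'm::finite ^ 'm"
proof -
  have "(\<chi> i j. c * A $ i $ j) = (\<chi> i. c *s A $ i)" by (simp add: vec_eq_iff)
  thus ?thesis using det_rows_mul[of "\<lambda>_. c" "\<lambda>i. A $ i"] by simp
qed

lemma finite_roots_of_unity_field: "n > 0 \<Longrightarrow> finite {c :: 'k::{idom}. c ^ n = 1}"
proof -
  assume "n > 0"
  define p :: "'k poly" where "p = Polynomial.monom 1 n - 1"
  have "poly.coeff p n = 1" using \<open>n > 0\<close> by (simp add: p_def)
  hence "p \<noteq> 0" by auto
  hence "finite {c. poly p c = 0}" by (rule poly_roots_finite)
  thus ?thesis by (simp add: p_def poly_monom)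
qed

text \<open>Dividing by the scalar at 0 turns \<open>M\<close> into \<open>N\<close> with
  \<open>N 0\<close> the identity. The determinant of \<open>N\<close> is polynomial without zeros
  along each line through 0, hence constantly 1, which confines the factor in the group law to roots
  of unity.\<close>

lemma structure_linearization:
  assumes "is_structure Ga3 P3 \<phi>"
  obtains M where "\<And>i j. poly_on (range (\<lambda>i a. a $ i)) (\<lambda>a. M a $ i $ j)"
    and "M 0 = mat 1" "\<And>a b. M (a + b) = M a ** M b"
    and "\<And>a x. x \<noteq> 0 \<Longrightarrow> M a *v x \<noteq> 0"
    and "\<And>a x. x \<noteq> 0 \<Longrightarrow> \<phi> a (line_of x) = line_of (M a *v x)"
proof -
  have act: "group_action Ga3 lines \<phi>"
    and mor: "morphism affine_times_proj projective_variety (\<lambda>(g, x). \<phi> g x)"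
    using assms by (simp_all add: is_structure_def additive_group_def)
  interpret group_action Ga3 lines \<phi> by (rule act)
  have Ga3 [simp]: "carrier Ga3 = UNIV" "\<one>\<^bsub>Ga3\<^esub> = 0" "\<And>a b. a \<otimes>\<^bsub>Ga3\<^esub> b = a + b"
    by (simp_all add: additive_group_def)
  have \<phi>0: "\<phi> 0 L = L" if "L \<in> lines" for L
    using id_eq_one that by (metis Ga3(2) restrict_apply')
  have \<phi>_add: "\<phi> (a + b) L = \<phi> a (\<phi> b L)" if "L \<in> lines" for a b L
    using composition_rule[OF that, of a b] by simp
  have \<phi>_lines: "\<phi> a L \<in> lines" if "L \<in> lines" for a L using element_image[of a L] that by simp
  obtain M where poly: "\<And>i j. poly_on (range (\<lambda>i a. a $ i)) (\<lambda>a. M a $ i $ j)"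
    and nz: "\<And>a x. x \<noteq> 0 \<Longrightarrow> M a *v x \<noteq> 0"
    and mem: "\<And>a x. x \<noteq> 0 \<Longrightarrow> M a *v x \<in> (\<lambda>(g, x). \<phi> g x) (a, line_of x)"
    by (rule action_linear_rep[OF mor]) (use \<phi>0 in auto)
  have \<phi>M: "\<phi> a (line_of x) = line_of (M a *v x)" if "x \<noteq> 0" for a x
    using lines_line_of[OF \<phi>_lines[OF line_of_in_lines[OF that]], of "M a *v x" a] mem[OF that, of a] nz[OF that]
    by simp
  have "\<exists>k. M 0 *v x = k *s x" for x
  proof (cases "x = 0")
    case False
    hence "M 0 *v x \<in> line_of x" using mem[OF False, of 0] \<phi>0[OF line_of_in_lines[OF False]] by simp
    thus ?thesis by (auto simp: line_of_def)
  qed simp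
  then obtain k0 where k0: "\<And>x. M 0 *v x = k0 *s x" using scalar_matrix[of "M 0"] by blast
  have "k0 \<noteq> 0" using nz[of "axis None 1" 0] k0 by (auto simp: axis_eq_0_iff)
  define N where "N a = (\<chi> i j. (1 / k0) * M a $ i $ j)" for a
  have Nv: "N a *v x = (1 / k0) *s (M a *v x)" for a x
    by (simp add: N_def vec_eq_iff matrix_vector_mult_def sum_divide_distrib)
  have N0: "N 0 = mat 1" using \<open>k0 \<noteq> 0\<close> by (simp add: matrix_eq Nv k0)
  have N_nz: "N a *v x \<noteq> 0" if "x \<noteq> 0" for a x using nz[OF that, of a] \<open>k0 \<noteq> 0\<close> by (simp add: Nv)
  have \<phi>N: "\<phi> a (line_of x) = line_of (N a *v x)" if "x \<noteq> 0" for a x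
    using \<phi>M[OF that] \<open>k0 \<noteq> 0\<close> by (simp add: Nv line_of_scale)
  have N_poly: "poly_on (range (\<lambda>i a. a $ i)) (\<lambda>a. N a $ i $ j)" for i j
    unfolding N_def by (simp only: vec_lambda_beta) (intro poly_on.mult poly_on.const poly)
  have N_entry: "\<exists>i j. N a $ i $ j \<noteq> 0" for a
  proof (rule ccontr)
    assume "\<nexists>i j. N a $ i $ j \<noteq> 0"
    hence "N a = 0" by (simp add: vec_eq_iff)
    thus False using N_nz[of "axis None 1" a] by (simp add: axis_eq_0_iff)
  qed
  have "\<exists>k. \<forall>x. (N a ** N b) *v x = k *s (N (a + b) *v x)" for a b
  proof (rule proportional_matrices[OF N_nz])
    fix x
    show "\<exists>k. (N a ** N b) *v x = k *s (N (a + b) *v x)"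
    proof (cases "x = 0")
      case False
      have "line_of (N a *v (N b *v x)) = line_of (N (a + b) *v x)"
        using \<phi>_add[OF line_of_in_lines[OF False], of a b] by (simp add: \<phi>N False N_nz)
      hence "N a *v (N b *v x) \<in> line_of (N (a + b) *v x)" using mem_line_of by metis
      thus ?thesis by (auto simp: line_of_def matrix_vector_mul_assoc)
    qed simp
  qed
  then obtain k where k: "\<And>a b x. (N a ** N b) *v x = k a b *s (N (a + b) *v x)" by metis
  have k': "N a ** N b = (\<chi> i j. k a b * N (a + b) $ i $ j)" for a b
  proof -
    have "(\<chi> i j. k a b * N (a + b) $ i $ j) *v x = k a b *s (N (a + b) *v x)" for x
      by (simp add: vec_eq_iff matrix_vector_mult_def sum_distrib_left mult.assoc)
    thus ?thesis by (simp add: matrix_eq k)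
  qed
  have det1: "det (N a) = 1" for a
  proof -
    obtain p where p: "\<And>t. det (N (0 + t *s a)) = poly p t"
      using apoly_line[OF det_poly_on[of _ N, OF N_poly]] by blast
    have "det (N b) \<noteq> 0" for b
    proof -
      have "inj ((*v) (N b))"
      proof (rule injI)
        fix x y assume "N b *v x = N b *v y"
        hence "N b *v (x - y) = 0" by (simp add: matrix_vector_mult_diff_distrib)
        thus "x = y" using N_nz[of "x - y" b] by auto
      qed
      hence "invertible (N b)"
        using matrix_left_invertible_injective[of "N b"] invertible_left_inverse by blast
      thus ?thesis by (simp add: invertible_det_nz)
    qed
    hence "poly p 1 = poly p 0" using p by (intro poly_no_roots_const) metis
    thus ?thesis using p[of 1] p[of 0] by (simp add: N0)
  qed
  \<comment> \<open>The exponent is the size of the matrices, by which a scalar factor enters the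
    determinant.\<close>
  have "k a b ^ 4 = 1" for a b
  proof -
    have "det (N a ** N b) = k a b ^ CARD(3 option) * det (N (a + b))"
      unfolding k' by (rule det_scalar_mult)
    thus ?thesis by (simp add: det_mul det1)
  qed
  hence k_root: "k a b \<in> {c. c ^ 4 = 1}" for a b by simp
  have "k a b = 1" for a b
  proof -
    \<comment> \<open>Along multiples of \<open>b\<close> the factor takes finitely many values, so
      one value \<open>c\<close> occurs infinitely often. The entrywise group law with factor
      \<open>c\<close> is polynomial in \<open>t\<close> and extends to all \<open>t\<close>; then
      \<open>t = 0\<close> shows that \<open>c\<close> is 1, and \<open>t = 1\<close> gives the
      claim.\<close>
    have "finite (range (\<lambda>t. k a (t *s b)))"
      by (rule finite_subset[OF _ finite_roots_of_unity_field[of 4]]) (use k_root in auto)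
    then obtain t0 where "infinite {t \<in> UNIV. k a (t *s b) = k a (t0 *s b)}"
      using pigeonhole_infinite[of UNIV "\<lambda>t. k a (t *s b)"] infinite_UNIV_char_0 by auto
    define c where "c = k a (t0 *s b)"
    have inf: "infinite {t. k a (t *s b) = c}" using \<open>infinite _\<close> by (simp add: c_def)
    have all: "(N a ** N (t *s b)) $ i $ j = c * N (a + t *s b) $ i $ j" for t i j
    proof -
      have "poly_on (range (\<lambda>i a. a $ i)) (\<lambda>d. (N a ** N d) $ i $ j)"
        unfolding matrix_matrix_mult_def by (simp, intro poly_on_sum poly_on.mult poly_on.const N_poly)
      then obtain p where p: "\<And>t. (N a ** N (0 + t *s b)) $ i $ j = poly p t"
        using apoly_line by blast
      obtain q where q: "\<And>t. N (a + t *s b) $ i $ j = poly q t" using apoly_line[OF N_poly] by blast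
      have "{t. k a (t *s b) = c} \<subseteq> {t. poly (p - Polynomial.smult c q) t = 0}"
        using p q by (auto simp: k' algebra_simps)
      hence "p - Polynomial.smult c q = 0" using inf poly_roots_finite finite_subset by blast
      hence "p = Polynomial.smult c q" by simp
      thus ?thesis using p[of t] q[of t] by simp
    qed
    obtain i j where "N a $ i $ j \<noteq> 0" using N_entry by blast
    hence "c = 1" using all[of 0 i j] by (simp add: N0)
    obtain i j where "N (a + b) $ i $ j \<noteq> 0" using N_entry by blast
    thus ?thesis using all[of 1 i j] \<open>c = 1\<close> by (simp add: k')
  qed
  hence "N (a + b) = N a ** N b" for a b by (simp add: k' vec_eq_iff)
  with N_poly N0 show ?thesis using N_nz \<phi>N by (rule that)
qed

section \<open>Polynomial representations of the additive group\<close>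

lemma coeff_1_mult:
  "poly.coeff (p * q) 1 = poly.coeff p 0 * poly.coeff q 1 + poly.coeff p 1 * poly.coeff q 0"
  by (simp add: coeff_mult)

lemma poly_eq_all:
  fixes p q :: "'k::field_char_0 poly"
  assumes "\<And>t. poly p t = poly q t"
  shows "p = q"
  using assms poly_eq_poly_eq_iff by blast

lemma matrix_entry_mult: "(A ** B) $ i $ j = (\<Sum>l\<in>UNIV. A $ i $ l * B $ l $ j)"
  by (simp add: matrix_matrix_mult_def)

locale polynomial_representation =
  fixes M :: "'k::field_char_0 ^ 'n::finite \<Rightarrow> 'k ^ 'm::finite ^ 'm"
  assumes poly_entries: "poly_on (range (\<lambda>i a. a $ i)) (\<lambda>a. M a $ i $ j)"
    and M_zero: "M 0 = mat 1"
    and M_add: "M (a + b) = M a ** M b"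
begin

definition line_poly :: "'k ^ 'n \<Rightarrow> 'm \<Rightarrow> 'm \<Rightarrow> 'k poly"
  where "line_poly v i j = (SOME p. \<forall>t. M (t *s v) $ i $ j = poly p t)"

lemma line_poly: "M (t *s v) $ i $ j = poly (line_poly v i j) t"
proof -
  have "\<exists>p. \<forall>t. M (t *s v) $ i $ j = poly p t"
    using apoly_line[OF poly_entries[of i j], of 0 v] by simp
  from someI_ex[OF this] show ?thesis unfolding line_poly_def by blast
qed

text \<open>The Taylor coefficient of order \<open>k\<close> of \<open>M (t *s v)\<close> in
  \<open>t\<close>; by \<open>D_power\<close> it is the \<open>k\<close>-th power of
  \<open>D v\<close> divided by \<open>fact k\<close>.\<close>

definition line_coeff :: "'k ^ 'n \<Rightarrow> nat \<Rightarrow> 'k ^ 'm ^ 'm"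
  where "line_coeff v k = (\<chi> i j. poly.coeff (line_poly v i j) k)"

text \<open>The differential of the representation at 0 in the direction \<open>v\<close>.\<close>

definition D :: "'k ^ 'n \<Rightarrow> 'k ^ 'm ^ 'm"
  where "D v = line_coeff v 1"

lemma line_coeff_0: "line_coeff v 0 = mat 1"
proof -
  have "poly.coeff (line_poly v i j) 0 = M 0 $ i $ j" for i j
    using line_poly[of 0 v i j] by (simp add: poly_0_coeff_0)
  thus ?thesis by (simp add: line_coeff_def vec_eq_iff M_zero)
qed

lemma coeff_line_poly_0: "poly.coeff (line_poly v i j) 0 = (if i = j then 1 else 0)"
  using arg_cong[OF line_coeff_0[of v], of "\<lambda>A. A $ i $ j"] by (simp add: line_coeff_def mat_def)

lemma D_entry: "D v $ i $ j = poly.coeff (line_poly v i j) 1"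
  by (simp add: D_def line_coeff_def)

lemma D_add: "D (u + v) = D u + D v"
proof -
  have "line_poly (u + v) i j = (\<Sum>l\<in>UNIV. line_poly u i l * line_poly v l j)" for i j
  proof (rule poly_eq_all)
    fix t
    have "M (t *s (u + v)) $ i $ j = (\<Sum>l\<in>UNIV. M (t *s u) $ i $ l * M (t *s v) $ l $ j)"
      by (simp add: vector_add_ldistrib M_add matrix_entry_mult)
    thus "poly (line_poly (u + v) i j) t = poly (\<Sum>l\<in>UNIV. line_poly u i l * line_poly v l j) t"
      by (simp add: poly_sum flip: line_poly)
  qed
  hence "D (u + v) $ i $ j = D v $ i $ j + D u $ i $ j" for i j
    unfolding D_entry
    by (simp only: coeff_sum coeff_1_mult coeff_line_poly_0 sum.distrib)
      (simp add: if_distrib[of "\<lambda>b. b * _"] if_distrib[of "\<lambda>b. _ * b"] cong: if_cong)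
  thus ?thesis by (simp add: vec_eq_iff)
qed

lemma D_scale: "D (c *s v) = (\<chi> i j. c * D v $ i $ j)"
proof -
  have "line_poly (c *s v) i j = pcompose (line_poly v i j) [:0, c:]" for i j
  proof (rule poly_eq_all)
    fix t
    have "M (t *s (c *s v)) $ i $ j = M ((t * c) *s v) $ i $ j" by simp
    thus "poly (line_poly (c *s v) i j) t = poly (pcompose (line_poly v i j) [:0, c:]) t"
      unfolding line_poly by (simp add: poly_pcompose)
  qed
  thus ?thesis by (simp add: vec_eq_iff D_entry coeff_pcompose_linear)
qed

text \<open>Comparison of the terms linear in \<open>t\<close>. Applied to \<open>M a\<close> and
  then to \<open>D u\<close> in place of \<open>X\<close>, it makes all the \<open>D v\<close>
  commute with the representation and with each other.\<close>

lemma D_commute: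
  assumes "\<And>t. X ** M (t *s v) = M (t *s v) ** X"
  shows "X ** D v = D v ** X"
proof -
  have "(\<Sum>l\<in>UNIV. Polynomial.smult (X $ i $ l) (line_poly v l j)) =
      (\<Sum>l\<in>UNIV. Polynomial.smult (X $ l $ j) (line_poly v i l))" for i j
  proof (rule poly_eq_all)
    fix t
    show "poly (\<Sum>l\<in>UNIV. Polynomial.smult (X $ i $ l) (line_poly v l j)) t =
      poly (\<Sum>l\<in>UNIV. Polynomial.smult (X $ l $ j) (line_poly v i l)) t"
      using arg_cong[OF assms[of t], of "\<lambda>A. A $ i $ j"]
      by (simp add: matrix_entry_mult line_poly poly_sum mult.commute)
  qed
  from arg_cong[OF this, of "\<lambda>p. poly.coeff p 1"]
  have "(X ** D v) $ i $ j = (D v ** X) $ i $ j" for i j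
    by (simp add: matrix_entry_mult coeff_sum D_entry mult.commute)
  thus ?thesis by (simp add: vec_eq_iff)
qed

lemma M_commute: "M a ** M b = M b ** M a"
  by (simp flip: M_add add: add.commute)

lemma D_M_commute: "M a ** D v = D v ** M a"
  by (rule D_commute) (rule M_commute)

lemma D_D_commute: "D u ** D v = D v ** D u"
  by (rule D_commute) (rule D_M_commute[symmetric])

text \<open>Coefficientwise form of the linear differential equation with matrix \<open>D v\<close>
  that \<open>M (t *s v)\<close> satisfies; the equation is the part linear in \<open>s\<close> of
  the group law for \<open>(s + t) *s v\<close>.\<close>

lemma line_coeff_Suc:
  "line_coeff v (Suc k) $ i $ j = (D v ** line_coeff v k) $ i $ j / of_nat (Suc k)"
proof -
  have pd: "pderiv (line_poly v i j) = (\<Sum>l\<in>UNIV. Polynomial.smult (D v $ i $ l) (line_poly v l j))" for i j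
  proof (rule poly_eq_all)
    fix t
    have "pcompose (line_poly v i j) [:t, 1:] =
        (\<Sum>l\<in>UNIV. Polynomial.smult (poly (line_poly v l j) t) (line_poly v i l))"
    proof (rule poly_eq_all)
      fix s
      have "M ((s + t) *s v) $ i $ j = (\<Sum>l\<in>UNIV. M (s *s v) $ i $ l * M (t *s v) $ l $ j)"
        by (simp add: vector_sadd_rdistrib M_add matrix_entry_mult)
      thus "poly (pcompose (line_poly v i j) [:t, 1:]) s =
          poly (\<Sum>l\<in>UNIV. Polynomial.smult (poly (line_poly v l j) t) (line_poly v i l)) s"
        by (simp add: poly_pcompose poly_sum mult.commute add.commute flip: line_poly)
    qed
    hence "poly.coeff (pcompose (line_poly v i j) [:t, 1:]) 1 =
        (\<Sum>l\<in>UNIV. D v $ i $ l * poly (line_poly v l j) t)"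
      by (simp add: coeff_sum D_entry mult.commute)
    moreover have "poly.coeff q 1 = poly (pderiv q) 0" for q :: "'k poly"
      by (simp add: poly_0_coeff_0 coeff_pderiv)
    ultimately show "poly (pderiv (line_poly v i j)) t =
        poly (\<Sum>l\<in>UNIV. Polynomial.smult (D v $ i $ l) (line_poly v l j)) t"
      by (simp add: pderiv_pcompose poly_pcompose pderiv_pCons poly_sum)
  qed
  have "of_nat (Suc k) * poly.coeff (line_poly v i j) (Suc k) =
      (\<Sum>l\<in>UNIV. D v $ i $ l * poly.coeff (line_poly v l j) k)"
    using arg_cong[OF pd[of i j], of "\<lambda>p. poly.coeff p k"] by (simp add: coeff_pderiv coeff_sum)
  thus ?thesis
    by (simp add: line_coeff_def matrix_entry_mult field_simps del: of_nat_Suc)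
qed

lemma line_coeff_Suc_mult:
  "of_nat (Suc k) *s (line_coeff v (Suc k) *v x) = D v *v (line_coeff v k *v x)"
proof -
  have "of_nat (Suc k) * line_coeff v (Suc k) $ i $ j = (D v ** line_coeff v k) $ i $ j" for i j
    by (simp add: line_coeff_Suc del: of_nat_Suc)
  hence "of_nat (Suc k) *s (line_coeff v (Suc k) *v x) = (D v ** line_coeff v k) *v x"
    by (simp add: vec_eq_iff matrix_vector_mult_def sum_distrib_left mult.assoc[symmetric] del: of_nat_Suc)
  thus ?thesis by (simp add: matrix_vector_mul_assoc)
qed

lemma D_power: "((*v) (D v) ^^ k) x = fact k *s (line_coeff v k *v x)"
proof (induction k)
  case (Suc k)
  have "((*v) (D v) ^^ Suc k) x = fact k *s (D v *v (line_coeff v k *v x))"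
    by (simp add: Suc vector_scalar_commute)
  also have "\<dots> = fact (Suc k) *s (line_coeff v (Suc k) *v x)"
    by (simp flip: line_coeff_Suc_mult add: mult.commute del: of_nat_Suc)
  finally show ?case .
qed (simp add: line_coeff_0)

text \<open>Up to factorials the powers of \<open>D v\<close> are Taylor coefficients, and these
  vanish beyond the degree of the polynomial entries.\<close>

lemma D_nilpotent: "\<exists>k. \<forall>x. ((*v) (D v) ^^ k) x = 0"
proof -
  \<comment> \<open>The sum of all degrees bounds each of them, and \<open>Suc\<close> makes the
    bound strict.\<close>
  define k where "k = Suc (\<Sum>i\<in>UNIV. \<Sum>j\<in>UNIV. Polynomial.degree (line_poly v i j))"
  have "Polynomial.degree (line_poly v i j) < k" for i j
  proof -
    have "Polynomial.degree (line_poly v i j) \<le> (\<Sum>j\<in>UNIV. Polynomial.degree (line_poly v i j))"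
      by (rule member_le_sum) auto
    also have "\<dots> \<le> (\<Sum>i\<in>UNIV. \<Sum>j\<in>UNIV. Polynomial.degree (line_poly v i j))"
      by (rule member_le_sum) auto
    finally show ?thesis by (simp add: k_def)
  qed
  hence "line_coeff v k = 0" by (simp add: line_coeff_def vec_eq_iff coeff_eq_0)
  thus ?thesis by (intro exI[of _ k]) (simp add: D_power)
qed

lemma M_exp:
  assumes "\<And>x. ((*v) (D v) ^^ n) x = 0"
  shows "M v *v x = (\<Sum>k<n. (1 / fact k) *s ((*v) (D v) ^^ k) x)"
proof -
  have "line_coeff v n = 0"
    using assms by (simp add: D_power matrix_eq)
  have "line_coeff v (n + k) = 0" for k
    by (induction k) (simp_all add: \<open>line_coeff v n = 0\<close> vec_eq_iff line_coeff_Suc matrix_entry_mult)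
  hence coeff: "poly.coeff (line_poly v i j) k = 0" if "k \<ge> n" for i j k
    using that le_Suc_ex[OF that] by (auto simp: line_coeff_def vec_eq_iff)
  have "M v $ i $ j = (\<Sum>k<n. line_coeff v k $ i $ j)" for i j
  proof -
    have "M v $ i $ j = poly (line_poly v i j) 1" using line_poly[of 1 v i j] by simp
    also have "\<dots> = (\<Sum>k\<le>Polynomial.degree (line_poly v i j). poly.coeff (line_poly v i j) k)"
      by (simp add: poly_altdef)
    also have "\<dots> = (\<Sum>k<n + Suc (Polynomial.degree (line_poly v i j)). poly.coeff (line_poly v i j) k)"
      by (rule sum.mono_neutral_left) (auto simp: coeff_eq_0)
    also have "\<dots> = (\<Sum>k<n. poly.coeff (line_poly v i j) k)"
      by (rule sum.mono_neutral_right) (auto simp: coeff)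
    finally show ?thesis by (simp add: line_coeff_def)
  qed
  hence "M v *v x = (\<Sum>k<n. line_coeff v k *v x)"
    by (simp add: vec_eq_iff matrix_vector_mult_def sum_distrib_right sum.swap[of _ UNIV])
  thus ?thesis by (simp add: D_power)
qed

lemma D_zero_imp: "D v = 0 \<Longrightarrow> M v *v x = x"
  using M_exp[of 1 v] by simp

end

text \<open>On a vector \<open>y\<close> killed by \<open>R\<close> the product of \<open>P\<close>
  and \<open>Q\<close> acts as the scalar \<open>c\<close>. As \<open>P\<close> and \<open>Q\<close>
  commute, \<open>P^k Q^k y = c^k y\<close>, which is 0 for large \<open>k\<close>. This excludes a
  scalar part in the product of two matrices \<open>D u\<close> and \<open>D v\<close>.\<close>

lemma nilpotent_common_kernel:
  fixes P Q R :: "'k::field ^ 'm::finite ^ 'm"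
  assumes comm: "P ** Q = Q ** P" and P: "\<forall>x. ((*v) P ^^ m) x = 0"
    and R: "\<forall>x. ((*v) R ^^ n) x = 0" and eq: "\<And>x. P *v (Q *v x) = c *s x + R *v x"
  shows "c = 0"
proof (rule ccontr)
  assume "c \<noteq> 0"
  have "\<exists>y. y \<noteq> 0 \<and> R *v y = 0"
  proof (rule ccontr)
    assume *: "\<nexists>y. y \<noteq> 0 \<and> R *v y = 0"
    have "((*v) R ^^ k) (axis undefined 1) \<noteq> 0" for k
    proof (induction k)
      case 0
      show ?case by (simp add: axis_eq_0_iff)
    next
      case (Suc k)
      thus ?case using * by auto
    qed
    thus False using R by blast
  qed
  then obtain y where y: "y \<noteq> 0" "R *v y = 0" by blast
  have PQ: "P *v (Q *v x) = Q *v (P *v x)" for x using comm by (metis matrix_vector_mul_assoc)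
  have PQk: "P *v (((*v) Q ^^ k) x) = ((*v) Q ^^ k) (P *v x)" for k x
    by (induction k) (simp_all add: PQ)
  have scale: "((*v) A ^^ k) (d *s x) = d *s ((*v) A ^^ k) x" for A :: "'k ^ 'm ^ 'm" and k d x
    by (induction k) (simp_all add: vector_scalar_commute)
  have "((*v) P ^^ k) (((*v) Q ^^ k) y) = c ^ k *s y" for k
  proof (induction k)
    case (Suc k)
    have "((*v) P ^^ Suc k) (((*v) Q ^^ Suc k) y) = ((*v) P ^^ k) (P *v (((*v) Q ^^ k) (Q *v y)))"
      by (simp add: funpow_swap1)
    also have "\<dots> = ((*v) P ^^ k) (((*v) Q ^^ k) (c *s y))" by (simp add: PQk eq y)
    also have "\<dots> = c ^ Suc k *s y" by (simp add: scale Suc)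
    finally show ?case .
  qed simp
  from this[of m] show False using P y \<open>c \<noteq> 0\<close> by simp
qed

section \<open>Nilpotent commutative algebras of dimension three\<close>

lemma vec_linearI:
  assumes "\<And>x y. f (x + y) = f x + f y" "\<And>c x. f (c *s x) = c *s f x"
  shows "Vector_Spaces.linear (*s) (*s) (f :: 'k::field ^ 'n \<Rightarrow> 'k ^ 'm)"
  using assms by (simp add: Vector_Spaces.linear_iff vec.vector_space_axioms)

text \<open>If \<open>f\<close> mapped \<open>W\<close> onto itself, all its powers would; but some
  power kills a finite spanning set of \<open>W\<close>. For the zero space the truncated
  subtraction makes the bound 0.\<close>

lemma dim_image_nilpotent:
  fixes f :: "'k::field ^ 'm::finite \<Rightarrow> 'k ^ 'm"
  assumes W: "vec.subspace W" and f: "Vector_Spaces.linear (*s) (*s) f" and inv: "f ` W \<subseteq> W"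
    and nil: "\<And>x. \<exists>k. (f ^^ k) x = 0"
  shows "vec.dim (f ` W) \<le> vec.dim W - 1"
proof (cases "W = {0}")
  case True
  thus ?thesis using Vector_Spaces.linear.axioms f by (simp add: vec.linear_0[OF f])
next
  case False
  have sub: "vec.subspace (f ` W)" using vec.linear_subspace_image[OF f W] .
  have "f ` W \<noteq> W"
  proof
    assume eq: "f ` W = W"
    have im: "(f ^^ k) ` W = W" for k
    proof (induction k)
      case (Suc k)
      have "(f ^^ Suc k) ` W = f ` ((f ^^ k) ` W)" by (simp add: image_image)
      thus ?case by (simp only: Suc eq)
    qed simp
    obtain B where B: "B \<subseteq> W" "finite B" "W \<subseteq> vec.span B"
      using vec.basis_exists[of W] vec.finiteI_independent by metis
    obtain k where k: "\<And>x. (f ^^ k x) x = 0" using nil by metis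
    have zero: "(f ^^ (n + m)) x = 0" if "(f ^^ n) x = 0" for n m x
      using that by (induction m) (auto simp: vec.linear_0[OF f])
    \<comment> \<open>The exponents depend on the vector; their sum over the finite spanning set
      works for all its members at once.\<close>
    define K where "K = (\<Sum>x\<in>B. k x)"
    have lin: "Vector_Spaces.linear (*s) (*s) (f ^^ n)" for n
    proof (induction n)
      case 0
      show ?case by (rule vec_linearI) simp_all
    next
      case (Suc n)
      show ?case by (rule vec_linearI)
        (simp_all add: vec.linear_add[OF Suc] vec.linear_scale[OF Suc] vec.linear_add[OF f] vec.linear_scale[OF f])
    qed
    have "(f ^^ K) x = 0" if "x \<in> B" for x
    proof -
      have "k x \<le> K" unfolding K_def using B(2) that by (intro member_le_sum) auto
      thus ?thesis using zero[OF k, of x "K - k x"] by simp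
    qed
    hence "(f ^^ K) x = 0" if "x \<in> vec.span B" for x
      using vec.linear_eq_0_on_span[OF lin] that by blast
    hence "(f ^^ K) ` W \<subseteq> {0}" using B(3) by blast
    thus False using im False vec.subspace_0[OF W] by blast
  qed
  hence "vec.dim (f ` W) \<noteq> vec.dim W"
    using vec.subspace_dim_equal[OF sub W inv] by auto
  moreover have "vec.dim (f ` W) \<le> vec.dim W" using vec.dim_subset[OF inv] .
  ultimately show ?thesis by linarith
qed

lemma combination_surj:
  fixes b1 b2 b3 :: "'k::field ^ 3"
  assumes "\<And>r s t. r *s b1 + s *s b2 + t *s b3 = 0 \<Longrightarrow> r = 0 \<and> s = 0 \<and> t = 0"
  shows "\<exists>r s t. x = r *s b1 + s *s b2 + t *s b3"
proof -
  define f where "f c = c $ 1 *s b1 + c $ 2 *s b2 + c $ 3 *s b3" for c :: "'k ^ 3"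
  have lin: "Vector_Spaces.linear (*s) (*s) f"
    by (rule vec_linearI) (simp_all add: f_def vec_eq_iff algebra_simps)
  have "inj f"
  proof (rule injI)
    fix c d assume "f c = f d"
    hence "f (c - d) = 0" by (simp add: vec.linear_diff[OF lin])
    hence "(c - d) $ 1 = 0 \<and> (c - d) $ 2 = 0 \<and> (c - d) $ 3 = 0" unfolding f_def by (rule assms)
    thus "c = d" by (simp add: vec_eq_iff forall_3)
  qed
  hence "surj f" using vec.linear_inj_imp_surj[OF lin] by blast
  then obtain c where "x = f c" by (metis surjD)
  thus ?thesis unfolding f_def by blast
qed

lemma exists_independent_third:
  fixes b1 b2 :: "'k::field ^ 3"
  assumes "\<And>r s. r *s b1 + s *s b2 = 0 \<Longrightarrow> r = 0 \<and> s = 0"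
  shows "\<exists>b3. \<forall>r s t. r *s b1 + s *s b2 + t *s b3 = 0 \<longrightarrow> r = 0 \<and> s = 0 \<and> t = 0"
proof -
  have "vec.dim (vec.span {b1, b2}) \<le> card {b1, b2}"
    unfolding vec.dim_span by (rule vec.dim_le_card') simp
  also have "\<dots> \<le> 2" by (simp add: card_insert_if)
  finally have "vec.span {b1, b2} \<noteq> UNIV" using vec_dim_card[where 'n = 3 and 'a = 'k] by force
  then obtain b3 where b3: "b3 \<notin> vec.span {b1, b2}" by blast
  have "r = 0 \<and> s = 0 \<and> t = 0" if eq: "r *s b1 + s *s b2 + t *s b3 = 0" for r s t
  proof -
    have "t = 0"
    proof (rule ccontr)
      assume "t \<noteq> 0"
      have "t *s b3 = - (r *s b1 + s *s b2)" using eq by (simp add: add_eq_0_iff2)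
      also have "\<dots> \<in> vec.span {b1, b2}"
        by (intro vec.span_neg vec.span_add vec.span_scale vec.span_base) simp_all
      finally have "(1 / t) *s (t *s b3) \<in> vec.span {b1, b2}" by (rule vec.span_scale)
      thus False using b3 \<open>t \<noteq> 0\<close> by simp
    qed
    thus ?thesis using eq assms[of r s] by simp
  qed
  thus ?thesis by blast
qed

text \<open>The structure carried by the maximal ideal of the local algebra: commutative and
  associative, without unit, with nilpotent multiplication operators.\<close>

locale nil_algebra =
  fixes mul :: "'k::{alg_closed_field, field_char_0} ^ 3 \<Rightarrow> 'k ^ 3 \<Rightarrow> 'k ^ 3" (infixl \<open>\<odot>\<close> 70)
  assumes add_left: "(x + y) \<odot> z = x \<odot> z + y \<odot> z"
    and scale_left: "(c *s x) \<odot> z = c *s (x \<odot> z)"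
    and commute: "x \<odot> y = y \<odot> x"
    and assoc: "(x \<odot> y) \<odot> z = x \<odot> (y \<odot> z)"
    and nil: "\<exists>k. (mul u ^^ k) x = 0"
begin

lemma add_right: "x \<odot> (y + z) = x \<odot> y + x \<odot> z"
  by (metis add_left commute)

lemma scale_right: "x \<odot> (c *s z) = c *s (x \<odot> z)"
  by (metis scale_left commute)

lemma left_commute: "x \<odot> (y \<odot> z) = y \<odot> (x \<odot> z)"
  by (metis assoc commute)

lemma linear_mul: "Vector_Spaces.linear (*s) (*s) (mul x)"
  by (rule vec_linearI) (simp_all add: add_right scale_right)

lemma zero_right [simp]: "x \<odot> 0 = 0"
  using vec.linear_0[OF linear_mul] .

lemma zero_left [simp]: "0 \<odot> x = 0"
  by (simp add: commute[of 0])

lemma minus_right: "x \<odot> (- y) = - (x \<odot> y)"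
  using vec.linear_neg[OF linear_mul] .

lemma minus_left: "(- x) \<odot> y = - (x \<odot> y)"
  by (simp add: commute[of _ y] minus_right)

lemma diff_right: "x \<odot> (y - z) = x \<odot> y - x \<odot> z"
  using vec.linear_diff[OF linear_mul] .

lemma diff_left: "(y - z) \<odot> x = y \<odot> x - z \<odot> x"
  by (simp add: commute[of _ x] diff_right)

lemmas expand = add_left add_right scale_left scale_right minus_left minus_right diff_left diff_right

text \<open>Multiplication by an element strictly lowers the dimension of a nonzero subspace stable
  under it, so from dimension 3 the multiplications by \<open>z\<close>, \<open>y\<close> and
  \<open>x\<close> lead to at most 2, at most 1 and finally 0.\<close>

lemma mul4: "x \<odot> (y \<odot> (z \<odot> u)) = 0"
proof -
  define W where "W = mul z ` UNIV"
  have "vec.dim W \<le> vec.dim (UNIV :: ('k ^ 3) set) - 1"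
    unfolding W_def by (rule dim_image_nilpotent) (auto simp: linear_mul nil)
  hence W: "vec.dim W \<le> 2" unfolding vec_dim_card by simp
  have subW: "vec.subspace W" unfolding W_def
    by (rule vec.linear_subspace_image[OF linear_mul]) simp
  have invW: "mul v ` W \<subseteq> W" for v
  proof
    fix a assume "a \<in> mul v ` W"
    then obtain u where "a = z \<odot> (v \<odot> u)" unfolding W_def left_commute[of z v] by blast
    thus "a \<in> W" unfolding W_def by blast
  qed
  define V where "V = mul y ` W"
  have "vec.dim V \<le> vec.dim W - 1"
    unfolding V_def by (rule dim_image_nilpotent[OF subW linear_mul invW nil])
  hence V: "vec.dim V \<le> 1" using W by linarith
  have subV: "vec.subspace V" unfolding V_def
    by (rule vec.linear_subspace_image[OF linear_mul subW])
  have invV: "mul v ` V \<subseteq> V" for v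
  proof
    fix a assume "a \<in> mul v ` V"
    then obtain w where "w \<in> W" "a = v \<odot> (y \<odot> w)" unfolding V_def by blast
    moreover from \<open>w \<in> W\<close> have "v \<odot> w \<in> W" using invW[of v] by blast
    ultimately show "a \<in> V" unfolding V_def left_commute[of v y] by blast
  qed
  have "vec.dim (mul x ` V) \<le> vec.dim V - 1"
    by (rule dim_image_nilpotent[OF subV linear_mul invV nil])
  hence "vec.dim (mul x ` V) = 0" using V by linarith
  hence "mul x ` V \<subseteq> {0}" by (simp only: vec.dim_eq_0)
  moreover have "y \<odot> (z \<odot> u) \<in> V" unfolding V_def W_def by (intro imageI UNIV_I)
  ultimately show ?thesis by blast
qed

text \<open>If some cube is nonzero, the powers of that element form the basis. Otherwise
  polarization kills all triple products, and the product is a symmetric form with values in at most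
  one line: of rank 0, 1 or 2, giving \<open>(p, q)\<close> equal to \<open>(0, 0)\<close>,
  \<open>(1, 0)\<close> and \<open>(0, 1)\<close>. The form of rank 2 is written in a hyperbolic
  basis, which takes a square root.\<close>

lemma classification:
  obtains p q b1 b2 b3 where "p = 0 \<or> p = 1" "q = 0 \<or> q = 1"
    "b1 \<odot> b1 = p *s b2" "b1 \<odot> b2 = q *s b3" "b1 \<odot> b3 = 0"
    "b2 \<odot> b2 = 0" "b2 \<odot> b3 = 0" "b3 \<odot> b3 = 0"
    "\<And>r s t. r *s b1 + s *s b2 + t *s b3 = 0 \<Longrightarrow> r = 0 \<and> s = 0 \<and> t = 0"
proof (cases "\<exists>x. x \<odot> (x \<odot> x) \<noteq> 0")
  case True
  then obtain x where x: "x \<odot> (x \<odot> x) \<noteq> 0" by blast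
  show ?thesis
  proof (rule that[of 1 1 x "x \<odot> x" "x \<odot> (x \<odot> x)"])
    fix r s t assume eq: "r *s x + s *s (x \<odot> x) + t *s (x \<odot> (x \<odot> x)) = 0"
    have "x \<odot> (x \<odot> (r *s x + s *s (x \<odot> x) + t *s (x \<odot> (x \<odot> x)))) = 0" by (simp only: eq) simp
    hence r: "r = 0" using x by (simp add: expand mul4)
    hence "x \<odot> (s *s (x \<odot> x) + t *s (x \<odot> (x \<odot> x))) = 0" using eq by simp
    hence s: "s = 0" using x by (simp add: expand mul4)
    show "r = 0 \<and> s = 0 \<and> t = 0" using eq r s x by simp
  qed (simp_all add: assoc mul4)
next
  case False
  hence cube: "x \<odot> (x \<odot> x) = 0" for x by blast
  \<comment> \<open>The vanishing cubes of \<open>x + y\<close> and \<open>x - y\<close> contain the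
    two mixed terms with different signs; separating them amounts to dividing by 6.\<close>
  have sq: "x \<odot> (x \<odot> y) = 0" for x y
  proof -
    have e: "x \<odot> (y \<odot> x) = x \<odot> (x \<odot> y)" "y \<odot> (x \<odot> x) = x \<odot> (x \<odot> y)"
      "y \<odot> (x \<odot> y) = x \<odot> (y \<odot> y)" "y \<odot> (y \<odot> x) = x \<odot> (y \<odot> y)"
      by (metis commute assoc)+
    have "(x + y) \<odot> ((x + y) \<odot> (x + y)) = 3 *s (x \<odot> (x \<odot> y)) + 3 *s (x \<odot> (y \<odot> y))"
      by (simp add: expand e cube[of x] cube[of y] vec_eq_iff)
    moreover have "(x - y) \<odot> ((x - y) \<odot> (x - y)) = 3 *s (x \<odot> (y \<odot> y)) - 3 *s (x \<odot> (x \<odot> y))"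
      by (simp add: expand e cube[of x] cube[of y] vec_eq_iff)
    ultimately have "3 *s (x \<odot> (x \<odot> y)) + 3 *s (x \<odot> (y \<odot> y)) = 0"
      "3 *s (x \<odot> (y \<odot> y)) - 3 *s (x \<odot> (x \<odot> y)) = 0"
      by (simp_all only: cube)
    hence "6 *s (x \<odot> (x \<odot> y)) = 0" by (simp add: vec_eq_iff)
    thus ?thesis by simp
  qed
  have triple: "x \<odot> (y \<odot> z) = 0" for x y z
  proof -
    have "(x + y) \<odot> ((x + y) \<odot> z) = 0" by (rule sq)
    moreover have "(x + y) \<odot> ((x + y) \<odot> z) = 2 *s (x \<odot> (y \<odot> z))"
      by (simp add: expand sq left_commute[of y x] vec_eq_iff)
    ultimately show ?thesis by simp
  qed
  have triple': "(x \<odot> y) \<odot> z = 0" for x y z by (simp add: assoc triple)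
  show ?thesis
  proof (cases "\<exists>x. x \<odot> x \<noteq> 0")
    case False
    hence z: "x \<odot> x = 0" for x by blast
    have zero: "x \<odot> y = 0" for x y
    proof -
      have "(x + y) \<odot> (x + y) = x \<odot> x + x \<odot> y + (x \<odot> y + y \<odot> y)"
        by (simp only: expand commute[of y x])
      hence "2 *s (x \<odot> y) = 0" unfolding z by (simp add: vec_eq_iff)
      thus ?thesis by simp
    qed
    show ?thesis
    proof (rule that[of 0 0 "axis 1 1" "axis 2 1" "axis 3 1"])
      fix r s t :: 'k
      assume "r *s axis 1 1 + s *s axis 2 1 + t *s axis 3 1 = (0 :: 'k ^ 3)"
      thus "r = 0 \<and> s = 0 \<and> t = 0" by (simp add: vec_eq_iff forall_3 axis_def)
    qed (simp_all add: zero)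
  next
    case True
    then obtain x where x: "x \<odot> x \<noteq> 0" by blast
    have "r = 0 \<and> s = 0" if eq: "r *s x + s *s (x \<odot> x) = 0" for r s
    proof -
      have "x \<odot> (r *s x + s *s (x \<odot> x)) = 0" by (simp only: eq) simp
      hence "r = 0" using x by (simp add: expand triple)
      thus ?thesis using eq x by simp
    qed
    then obtain z where ind: "\<And>r s t. r *s x + s *s (x \<odot> x) + t *s z = 0 \<Longrightarrow> r = 0 \<and> s = 0 \<and> t = 0"
      using exists_independent_third by metis
    obtain r s t where xz: "x \<odot> z = r *s x + s *s (x \<odot> x) + t *s z" using combination_surj[OF ind] by blast
    \<comment> \<open>Multiplying the expansion of \<open>x \<odot> z\<close> by \<open>x\<close>
      once more gives a triple product, hence 0. Its coordinates force \<open>t = 0\<close> and then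
      \<open>r = 0\<close>, so \<open>x \<odot> z\<close> is a multiple of
      \<open>x \<odot> x\<close>.\<close>
    have "(t * r) *s x + (r + t * s) *s (x \<odot> x) + (t * t) *s z =
        r *s (x \<odot> x) + t *s (r *s x + s *s (x \<odot> x) + t *s z)"
      by (simp add: vec_eq_iff algebra_simps)
    also have "\<dots> = x \<odot> (r *s x + s *s (x \<odot> x) + t *s z)" by (simp add: expand triple xz)
    also have "\<dots> = 0" unfolding xz[symmetric] by (rule triple)
    finally have "t * t = 0" "r + t * s = 0" using ind by blast+
    hence rt: "t = 0" "r = 0" by auto
    hence xz: "x \<odot> z = s *s (x \<odot> x)" using xz by simp
    obtain r' s' t' where zz: "z \<odot> z = r' *s x + s' *s (x \<odot> x) + t' *s z" using combination_surj[OF ind] by blast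
    have "(t' * r') *s x + (r' * s + t' * s') *s (x \<odot> x) + (t' * t') *s z =
        r' *s (x \<odot> z) + t' *s (r' *s x + s' *s (x \<odot> x) + t' *s z)"
      by (simp add: xz vec_eq_iff algebra_simps)
    also have "\<dots> = z \<odot> (r' *s x + s' *s (x \<odot> x) + t' *s z)" by (simp add: expand triple zz commute[of z x])
    also have "\<dots> = 0" unfolding zz[symmetric] by (rule triple)
    finally have "t' * t' = 0" using ind by blast
    hence t': "t' = 0" by simp
    have "r' *s (x \<odot> x) = x \<odot> (r' *s x + s' *s (x \<odot> x) + t' *s z)" by (simp add: expand triple t')
    also have "\<dots> = 0" unfolding zz[symmetric] by (rule triple)
    finally have r': "r' = 0" using x by simp
    have zz: "z \<odot> z = s' *s (x \<odot> x)" using zz r' t' by simp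
    \<comment> \<open>Orthogonalization: \<open>y\<close> is \<open>z\<close> corrected to have
      product 0 with \<open>x\<close>, and \<open>d\<close> is the value of the form at
      \<open>y\<close> in units of \<open>x \<odot> x\<close>.\<close>
    define y where "y = z - s *s x"
    define d where "d = s' - s * s"
    have xy: "x \<odot> y = 0" by (simp add: y_def expand xz)
    have yy: "y \<odot> y = d *s (x \<odot> x)"
      by (simp add: y_def d_def expand xz zz commute[of z x] vec_eq_iff algebra_simps)
    have ind': "a = 0 \<and> b = 0 \<and> c = 0" if "a *s x + b *s (x \<odot> x) + c *s y = 0" for a b c
    proof -
      have "(a - c * s) *s x + b *s (x \<odot> x) + c *s z = a *s x + b *s (x \<odot> x) + c *s y"
        by (simp add: y_def vec_eq_iff algebra_simps)
      hence "(a - c * s) *s x + b *s (x \<odot> x) + c *s z = 0" using that by simp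
      from ind[OF this] show ?thesis by auto
    qed
    show ?thesis
    proof (cases "d = 0")
      case True
      show ?thesis
      proof (rule that[of 1 0 x "x \<odot> x" y])
        fix r s t assume "r *s x + s *s (x \<odot> x) + t *s y = 0"
        thus "r = 0 \<and> s = 0 \<and> t = 0" by (rule ind')
      qed (simp_all add: triple triple' xy yy True)
    next
      case False
      \<comment> \<open>The scaling gives \<open>u\<close> the opposite square of \<open>x\<close>,
        so \<open>x + u\<close> and \<open>x - u\<close> both square to 0 and have product
        \<open>2 *s (x \<odot> x)\<close>, the third basis vector.\<close>
      obtain \<rho> where \<rho>: "\<rho> ^ 2 = - 1 / d" using nth_root_exists[of 2 "- 1 / d"] by auto
      hence "\<rho> \<noteq> 0" using False by auto
      define u where "u = \<rho> *s y"
      have "u \<odot> u = (\<rho>\<^sup>2 * d) *s (x \<odot> x)" by (simp add: u_def expand yy power2_eq_square mult.assoc)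
      hence uu: "u \<odot> u = - (x \<odot> x)" using \<rho> False by (simp add: vec_eq_iff)
      have xu: "x \<odot> u = 0" "u \<odot> x = 0" by (simp_all add: u_def expand xy commute[of _ x])
      have ind'': "r = 0 \<and> s = 0 \<and> t = 0"
        if eq: "r *s (x + u) + s *s (x - u) + t *s (2 *s (x \<odot> x)) = 0" for r s t
      proof -
        have "(r + s) *s x + (2 * t) *s (x \<odot> x) + ((r - s) * \<rho>) *s y =
            r *s (x + u) + s *s (x - u) + t *s (2 *s (x \<odot> x))"
          by (simp add: u_def vec_eq_iff algebra_simps)
        from ind'[OF this[unfolded eq]] have "r + s = 0" "t = 0" "r = s" using \<open>\<rho> \<noteq> 0\<close> by auto
        thus ?thesis by auto
      qed
      show ?thesis
      proof (rule that[of 0 1 "x + u" "x - u" "2 *s (x \<odot> x)"])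
        fix r s t assume "r *s (x + u) + s *s (x - u) + t *s (2 *s (x \<odot> x)) = 0"
        thus "r = 0 \<and> s = 0 \<and> t = 0" by (rule ind'')
      qed (simp_all add: expand uu xu triple triple' vec_eq_iff)
    qed
  qed
qed

end

text \<open>A generic line, spanned by \<open>w\<close>, enters twice: density of its orbit makes
  evaluation at \<open>w\<close> injective on the commutant of the representation, and triviality of
  its stabilizer makes \<open>D\<close> injective.\<close>

lemma structure_algebra:
  assumes str: "is_structure Ga3 P3 \<phi>"
  obtains D w mul where
    "\<And>u v x. D (u + v) *v x = D u *v x + D v *v x" "\<And>c v x. D (c *s v) *v x = c *s (D v *v x)"
    and "\<And>u v x. D u *v (D v *v x) = D (mul u v) *v x"
    and "\<And>u v x. D u *v (D v *v x) = D v *v (D u *v x)"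
    and "\<And>v. \<exists>k. \<forall>x. ((*v) (D v) ^^ k) x = 0"
    and "\<And>c v. c *s w + D v *v w = 0 \<Longrightarrow> c = 0 \<and> v = 0"
    and "\<And>v x. (\<And>y. ((*v) (D v) ^^ 4) y = 0) \<Longrightarrow> x \<noteq> 0 \<Longrightarrow>
      \<phi> v (line_of x) = line_of (\<Sum>k<4. (1 / fact k) *s ((*v) (D v) ^^ k) x)"
proof -
  obtain M where M: "\<And>i j. poly_on (range (\<lambda>i a. a $ i)) (\<lambda>a. M a $ i $ j)" "M 0 = mat 1"
      "\<And>a b. M (a + b) = M a ** M b"
    and nz: "\<And>a x. x \<noteq> 0 \<Longrightarrow> M a *v x \<noteq> 0"
    and \<phi>M: "\<And>a x. x \<noteq> 0 \<Longrightarrow> \<phi> a (line_of x) = line_of (M a *v x)"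
    by (rule structure_linearization[OF str]) blast
  interpret polynomial_representation M by unfold_locales (rule M)+
  obtain U where U: "openin proj_space U" "proj_space closure_of U = lines"
    "\<And>L. L \<in> U \<Longrightarrow> stabilizer Ga3 \<phi> L = {0} \<and> proj_space closure_of (orbit Ga3 \<phi> L) = lines"
    using str by (auto simp: is_structure_def additive_group_def)
  have "line_of (axis None 1 :: qbar ^ 3 option) \<in> lines" by (rule line_of_in_lines) (simp add: axis_eq_0_iff)
  hence "U \<noteq> {}" using U(2) by auto
  then obtain L where L: "L \<in> U" by blast
  hence "L \<in> lines" using openin_subset[OF U(1)] by auto
  then obtain w where w: "w \<noteq> 0" "L = line_of w" by (auto simp: lines_iff)
  have stab: "v = 0" if "\<phi> v L = L" for v
  proof -
    have "v \<in> stabilizer Ga3 \<phi> L" using that by (simp add: stabilizer_def additive_group_def)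
    thus ?thesis using U(3)[OF L] by simp
  qed
  \<comment> \<open>\<open>X\<close> kills the whole orbit of \<open>w\<close>. A nonzero entry in
    row \<open>i\<close> would give a nonempty open set of lines, those where coordinate
    \<open>i\<close> of \<open>X *v x\<close> is nonzero, and the dense orbit would have to meet
    it.\<close>
  have cyclic: "X = 0" if comm: "\<And>a. X ** M a = M a ** X" and Xw: "X *v w = 0" for X :: "qbar ^ 3 option ^ 3 option"
  proof (rule ccontr)
    assume "X \<noteq> 0"
    then obtain i j where ij: "X $ i $ j \<noteq> 0" by (auto simp: vec_eq_iff)
    define V where "V = proj_principal (mpoly_eval (linear_form (X $ i)))"
    have X: "mpoly_eval (linear_form (X $ i)) x = (X *v x) $ i" for x
      by (simp add: mpoly_eval_linear_form matrix_vector_mult_def)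
    have "openin proj_space V" unfolding V_def by (rule proj_principal_open[OF homogeneous_linear_form])
    moreover have aj: "(axis j 1 :: qbar ^ 3 option) \<noteq> 0" by (simp add: axis_eq_0_iff)
    have "line_of (axis j 1) \<in> V" unfolding V_def line_of_in_proj_principal[OF homogeneous_linear_form aj]
      using ij by (simp add: X matrix_vector_mult_axis)
    moreover have "line_of (axis j 1) \<in> proj_space closure_of (orbit Ga3 \<phi> L)"
      using U(3)[OF L] line_of_in_lines[OF aj] by simp
    ultimately obtain K where K: "K \<in> orbit Ga3 \<phi> L" "K \<in> V" unfolding in_closure_of by blast
    then obtain a where "K = line_of (M a *v w)" using \<phi>M[OF w(1)] by (auto simp: orbit_def w(2))
    hence "(X *v (M a *v w)) $ i \<noteq> 0"
      using K(2) nz[OF w(1), of a] by (simp add: V_def line_of_in_proj_principal[OF homogeneous_linear_form] X)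
    moreover have "X *v (M a *v w) = M a *v (X *v w)" using comm by (metis matrix_vector_mul_assoc)
    ultimately show False by (simp add: Xw)
  qed
  have D_v_add: "D (u + v) *v x = D u *v x + D v *v x" for u v x
    by (simp add: D_add matrix_vector_mult_add_rdistrib)
  have D_v_scale: "D (c *s v) *v x = c *s (D v *v x)" for c v x
    by (simp add: D_scale vec_eq_iff matrix_vector_mult_def sum_distrib_left mult.assoc)
  have D_v_comm: "D u *v (D v *v x) = D v *v (D u *v x)" for u v x
    using D_D_commute by (metis matrix_vector_mul_assoc)
  have D0: "D v = 0 \<Longrightarrow> v = 0" for v
    using D_zero_imp[of v w] \<phi>M[OF w(1), of v] stab[of v] w(2) by simp
  \<comment> \<open>The matrix \<open>c\<close> plus \<open>D v\<close> commutes with the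
    representation and kills \<open>w\<close>, so it is 0; then \<open>D v\<close> is both scalar
    and nilpotent.\<close>
  have inj: "c = 0 \<and> v = 0" if "c *s w + D v *v w = 0" for c v
  proof -
    define X where "X = mat c + D v"
    have Xx: "X *v x = c *s x + D v *v x" for x
      by (simp add: X_def matrix_vector_mult_add_rdistrib) (simp add: vec_eq_iff mat_def matrix_vector_mult_def if_distrib[of "\<lambda>b. b * _"] cong: if_cong)
    have "X = 0"
    proof (rule cyclic)
      show "X *v w = 0" using that by (simp add: Xx)
      show "X ** M a = M a ** X" for a
      proof -
        have "D v *v (M a *v x) = M a *v (D v *v x)" for x
          using D_M_commute by (metis matrix_vector_mul_assoc)
        thus ?thesis
          by (simp add: matrix_eq Xx matrix_vector_right_distrib vector_scalar_commute flip: matrix_vector_mul_assoc)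
      qed
    qed
    have Dv: "D v *v x = (- c) *s x" for x
    proof -
      have "c *s x + D v *v x = 0" using Xx[of x] by (simp add: \<open>X = 0\<close>)
      thus ?thesis by (simp add: add_eq_0_iff)
    qed
    have pow: "((*v) (D v) ^^ k) x = (- c) ^ k *s x" for k x
      by (induction k) (simp_all add: Dv)
    obtain k where "((*v) (D v) ^^ k) w = 0" using D_nilpotent[of v] by blast
    hence "c = 0" using w(1) by (simp add: pow)
    hence "D v = 0" by (simp add: matrix_eq Dv)
    thus ?thesis using D0 \<open>c = 0\<close> by simp
  qed
  \<comment> \<open>Source and target have dimension 4, so injectivity of this evaluation at
    \<open>w\<close> makes it surjective.\<close>
  define T where "T r = r $ None *s w + D (\<chi> i. r $ Some i) *v w" for r :: "qbar ^ 3 option"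
  have linT: "Vector_Spaces.linear (*s) (*s) T"
  proof (rule vec_linearI)
    fix r s :: "qbar ^ 3 option" and c
    have e: "(\<chi> i. (r + s) $ Some i) = (\<chi> i. r $ Some i) + (\<chi> i. s $ Some i)" by (simp add: vec_eq_iff)
    show "T (r + s) = T r + T s"
      by (simp only: T_def e D_v_add) (simp add: vec_eq_iff algebra_simps)
    have e: "(\<chi> i. (c *s r) $ Some i) = c *s (\<chi> i. r $ Some i)" by (simp add: vec_eq_iff)
    show "T (c *s r) = c *s T r"
      by (simp only: T_def e D_v_scale) (simp add: vec_eq_iff algebra_simps)
  qed
  have "inj T"
  proof (rule injI)
    fix r s assume "T r = T s"
    hence "T (r - s) = 0" by (simp add: vec.linear_diff[OF linT])
    hence *: "(r - s) $ None = 0" "(\<chi> i. (r - s) $ Some i) = 0" using inj unfolding T_def by blast+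
    have "r $ i = s $ i" for i using * by (cases i) (simp_all add: vec_eq_iff)
    thus "r = s" by (simp add: vec_eq_iff)
  qed
  hence surjT: "surj T" using vec.linear_inj_imp_surj[OF linT] by blast
  \<comment> \<open>Surjectivity of \<open>T\<close> writes the product at \<open>w\<close> as a
    scalar plus some \<open>D m\<close>. The difference commutes with the representation and kills
    \<open>w\<close>, so the identity holds everywhere, and nilpotency removes the scalar.\<close>
  have "\<exists>m. \<forall>x. D u *v (D v *v x) = D m *v x" for u v
  proof -
    obtain r where r: "D u *v (D v *v w) = T r" using surjT by (metis surjD)
    define m where "m = (\<chi> i. r $ Some i)"
    define X where "X = D u ** D v - (mat (r $ None) + D m)"
    have mx: "mat c *v x = c *s x" for c :: qbar and x :: "qbar ^ 3 option"
      by (simp add: vec_eq_iff mat_def matrix_vector_mult_def if_distrib[of "\<lambda>b. b * _"] cong: if_cong)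
    have Xx: "X *v x = D u *v (D v *v x) - (r $ None *s x + D m *v x)" for x
      by (simp add: X_def matrix_vector_mult_add_rdistrib matrix_vector_mult_diff_rdistrib mx
          flip: matrix_vector_mul_assoc)
    have "X = 0"
    proof (rule cyclic)
      show "X *v w = 0" using r by (simp add: Xx T_def m_def)
      show "X ** M a = M a ** X" for a
      proof -
        have DM: "D v *v (M a *v x) = M a *v (D v *v x)" for v x
          using D_M_commute by (metis matrix_vector_mul_assoc)
        thus ?thesis
          by (simp add: matrix_eq Xx matrix_vector_right_distrib matrix_vector_mult_diff_distrib vector_scalar_commute
              flip: matrix_vector_mul_assoc)
      qed
    qed
    hence eq: "D u *v (D v *v x) = r $ None *s x + D m *v x" for x using Xx[of x] by simp
    obtain k where k: "\<forall>x. ((*v) (D u) ^^ k) x = 0" using D_nilpotent by blast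
    obtain l where l: "\<forall>x. ((*v) (D m) ^^ l) x = 0" using D_nilpotent by blast
    have "r $ None = 0" by (rule nilpotent_common_kernel[OF D_D_commute k l eq])
    thus ?thesis using eq by auto
  qed
  then obtain mul where mul: "\<And>u v x. D u *v (D v *v x) = D (mul u v) *v x" by metis
  have exp: "\<phi> v (line_of x) = line_of (\<Sum>k<4. (1 / fact k) *s ((*v) (D v) ^^ k) x)"
    if "\<And>y. ((*v) (D v) ^^ 4) y = 0" "x \<noteq> 0" for v x
    using \<phi>M[OF that(2)] M_exp[OF that(1)] by simp
  show ?thesis
    by (rule that[of D mul w]) (fact D_v_add D_v_scale mul D_v_comm D_nilpotent inj exp)+
qed

section \<open>Morphisms induced by linear maps\<close>

lemma linear_component:
  fixes T :: "'k::field ^ 'm::finite \<Rightarrow> 'k ^ 'l::finite"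
  assumes "Vector_Spaces.linear (*s) (*s) T"
  shows "\<exists>c. \<forall>x. T x $ i = mpoly_eval (linear_form c) x"
proof (intro exI allI)
  fix x
  have "T x = T (\<Sum>j\<in>UNIV. x $ j *s axis j 1)" by (subst basis_expansion) (rule refl)
  also have "\<dots> = (\<Sum>j\<in>UNIV. x $ j *s T (axis j 1))"
    unfolding vec.linear_sum[OF assms] vec.linear_scale[OF assms] by (rule refl)
  finally have "T x $ i = (\<Sum>j\<in>UNIV. x $ j *s T (axis j 1)) $ i" by (rule arg_cong)
  thus "T x $ i = mpoly_eval (linear_form (\<chi> j. T (axis j 1) $ i)) x"
    by (simp only: sum_component vector_smult_component mpoly_eval_linear_form vec_lambda_beta mult.commute)
qed

lemma linear_image_line_of:
  assumes "Vector_Spaces.linear (*s) (*s) T"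
  shows "T ` line_of x = line_of (T x)"
  by (simp add: line_of_def image_image vec.linear_scale[OF assms])

text \<open>Linear substitution is the case of \<open>bihom_compose\<close> with a dummy affine
  factor of dimension 1, which \<open>bihom_slice\<close> freezes at 0 afterwards.\<close>

lemma homogeneous_compose_linear:
  fixes T :: "'k::field ^ 'm::finite \<Rightarrow> 'k ^ 'l::finite"
  assumes "Vector_Spaces.linear (*s) (*s) T" "homogeneous d p"
  shows "\<exists>q. homogeneous d q \<and> (\<forall>x. mpoly_eval q x = mpoly_eval p (T x))"
proof -
  have "bihom 1 (\<lambda>z :: ('k ^ 1) \<times> ('k ^ 'm). T (snd z) $ i)" for i
  proof -
    obtain c where "\<And>x. T x $ i = mpoly_eval (linear_form c) x"
      using linear_component[OF assms(1)] by blast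
    thus ?thesis by (simp only: bihom_snd[OF homogeneous_linear_form])
  qed
  from bihom_slice[OF bihom_compose[OF assms(2) this], of 0] show ?thesis by auto
qed

lemma continuous_map_proj:
  assumes lines: "\<And>z. z \<in> topspace X \<Longrightarrow> f z \<in> lines"
    and pre: "\<And>d p. homogeneous d p \<Longrightarrow>
      openin X {z \<in> topspace X. f z \<in> proj_principal (mpoly_eval p)}"
  shows "continuous_map X proj_space (f :: 'p \<Rightarrow> ('k::field ^ 'l::finite) set)"
proof -
  let ?S = "{proj_principal (mpoly_eval p) | p. \<exists>d. homogeneous d p} :: ('k ^ 'l) set set set"
  have "\<Union> ?S = topspace (proj_space :: ('k ^ 'l) set topology)"
    unfolding proj_space_eq topology_generated_by_topspace by (rule refl)
  hence "f ` topspace X \<subseteq> \<Union> ?S" using lines by auto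
  moreover have "openin X (f -` U \<inter> topspace X)" if U: "U \<in> ?S" for U
  proof -
    obtain p d where p: "U = proj_principal (mpoly_eval p)" "homogeneous d p" using U by blast
    have "f -` U \<inter> topspace X = {z \<in> topspace X. f z \<in> U}" by blast
    thus ?thesis using pre[OF p(2)] p(1) by simp
  qed
  ultimately show ?thesis unfolding proj_space_eq by (intro continuous_on_generated_topo)
qed

lemma continuous_map_affine:
  assumes pre: "\<And>p. openin X {z \<in> topspace X. mpoly_eval p (f z) \<noteq> 0}"
  shows "continuous_map X affine_space (f :: 'p \<Rightarrow> 'k::field ^ 'n::finite)"
proof -
  let ?S = "range (\<lambda>p. {x. mpoly_eval p x \<noteq> 0}) :: ('k ^ 'n) set set"
  have "\<Union> ?S = topspace (affine_space :: ('k ^ 'n) topology)"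
    unfolding affine_space_eq topology_generated_by_topspace by (rule refl)
  hence "f ` topspace X \<subseteq> \<Union> ?S" by simp
  moreover have "openin X (f -` U \<inter> topspace X)" if U: "U \<in> ?S" for U
  proof -
    obtain p where p: "U = {x. mpoly_eval p x \<noteq> 0}" using U by blast
    have "f -` U \<inter> topspace X = {z \<in> topspace X. mpoly_eval p (f z) \<noteq> 0}" using p by blast
    thus ?thesis using pre by simp
  qed
  ultimately show ?thesis unfolding affine_space_eq by (intro continuous_on_generated_topo)
qed

lemma linear_morphism_proj:
  fixes T :: "'k::field ^ 'm::finite \<Rightarrow> 'k ^ 'l::finite"
  assumes lin: "Vector_Spaces.linear (*s) (*s) T" and "inj T"
  shows "morphism projective_variety projective_variety (image T)"
proof -
  have nz: "T x \<noteq> 0" if "x \<noteq> 0" for x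
    using \<open>inj T\<close> that vec.linear_0[OF lin] by (metis injD)
  have T_lines: "T ` L \<in> lines" if "L \<in> lines" for L
  proof -
    obtain x where "x \<noteq> 0" "L = line_of x" using \<open>L \<in> lines\<close> by (auto simp: lines_iff)
    thus ?thesis using line_of_in_lines[OF nz] by (simp add: linear_image_line_of[OF lin])
  qed
  have pre: "T ` L \<in> proj_principal (mpoly_eval p) \<longleftrightarrow> L \<in> proj_principal (mpoly_eval q)"
    if "homogeneous d p" "homogeneous d q" "\<forall>x. mpoly_eval q x = mpoly_eval p (T x)" "L \<in> lines" for d p q L
  proof -
    obtain x where x: "x \<noteq> 0" "L = line_of x" using \<open>L \<in> lines\<close> by (auto simp: lines_iff)
    thus ?thesis using that nz[OF x(1)]
      by (simp add: linear_image_line_of[OF lin] line_of_in_proj_principal)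
  qed
  have cont: "continuous_map proj_space proj_space (image T)"
  proof (rule continuous_map_proj)
    show "T ` L \<in> lines" if "L \<in> topspace proj_space" for L using T_lines that by simp
    fix d and p :: "('l, 'k) mpoly" assume p: "homogeneous d p"
    obtain q where q: "homogeneous d q" "\<forall>x. mpoly_eval q x = mpoly_eval p (T x)"
      using homogeneous_compose_linear[OF lin p] by blast
    have "{L \<in> topspace proj_space. T ` L \<in> proj_principal (mpoly_eval p)} = proj_principal (mpoly_eval q)"
      using pre[OF p q] by (auto simp: proj_principal_def[of "mpoly_eval q"])
    thus "openin proj_space {L \<in> topspace proj_space. T ` L \<in> proj_principal (mpoly_eval p)}"
      using proj_principal_open[OF q(1)] by simp
  qed
  moreover have "regular_on projective_variety {x \<in> points projective_variety. T ` x \<in> V} (g \<circ> image T)"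
    if V: "openin proj_space V" "regular_on projective_variety V g" for V and g :: "('k ^ 'l) set \<Rightarrow> 'k"
    unfolding regular_on_proj_iff
  proof
    fix L assume L: "L \<in> {x \<in> points projective_variety. T ` x \<in> V}"
    then obtain W p q d where W: "openin proj_space W" "T ` L \<in> W" "W \<subseteq> V" "homogeneous d p" "homogeneous d q"
      "\<forall>M\<in>W. \<forall>x\<in>M - {0}. mpoly_eval q x \<noteq> 0 \<and> g M = mpoly_eval p x / mpoly_eval q x"
      using V(2) unfolding regular_on_proj_iff by (metis (no_types, lifting) mem_Collect_eq)
    obtain p' where p': "homogeneous d p'" "\<forall>x. mpoly_eval p' x = mpoly_eval p (T x)"
      using homogeneous_compose_linear[OF lin W(4)] by blast
    obtain q' where q': "homogeneous d q'" "\<forall>x. mpoly_eval q' x = mpoly_eval q (T x)"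
      using homogeneous_compose_linear[OF lin W(5)] by blast
    let ?W = "{L \<in> topspace proj_space. T ` L \<in> W}"
    have "openin proj_space ?W" by (rule openin_continuous_map_preimage[OF cont W(1)])
    moreover have "mpoly_eval q' x \<noteq> 0 \<and> (g \<circ> image T) M = mpoly_eval p' x / mpoly_eval q' x"
      if "M \<in> ?W" "x \<in> M - {0}" for M x
    proof -
      have "T ` M \<in> W" "T x \<in> T ` M - {0}" using that nz[of x] by auto
      thus ?thesis using W(6) p'(2) q'(2) by simp
    qed
    ultimately show "\<exists>W p q d. openin proj_space W \<and> L \<in> W \<and> W \<subseteq> {x \<in> points projective_variety. T ` x \<in> V} \<and>
        homogeneous d p \<and> homogeneous d q \<and>
        (\<forall>M\<in>W. \<forall>x\<in>M - {0}. mpoly_eval q x \<noteq> 0 \<and> (g \<circ> image T) M = mpoly_eval p x / mpoly_eval q x)"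
      using p'(1) q'(1) W(2,3) L
      by (intro exI[of _ ?W] exI[of _ p'] exI[of _ q'] exI[of _ d]) auto
  qed
  ultimately show ?thesis unfolding morphism_def by (simp del: topspace_proj)
qed

lemma linear_isomorphism_proj:
  fixes T :: "'k::field ^ 'm::finite \<Rightarrow> 'k ^ 'm"
  assumes lin: "Vector_Spaces.linear (*s) (*s) T" and "inj T"
  shows "isomorphism projective_variety projective_variety (image T)"
    and "isomorphism projective_variety projective_variety (image (inv_into UNIV T))"
proof -
  have "surj T" using vec.linear_inj_imp_surj[OF lin \<open>inj T\<close>] .
  have lin': "Vector_Spaces.linear (*s) (*s) (inv_into UNIV T)"
  proof (rule vec_linearI)
    fix x y c
    show "inv_into UNIV T (x + y) = inv_into UNIV T x + inv_into UNIV T y"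
      using \<open>inj T\<close> \<open>surj T\<close> by (metis inv_f_f surj_f_inv_f vec.linear_add[OF lin])
    show "inv_into UNIV T (c *s x) = c *s inv_into UNIV T x"
      using \<open>inj T\<close> \<open>surj T\<close> by (metis inv_f_f surj_f_inv_f vec.linear_scale[OF lin])
  qed
  have "inj (inv_into UNIV T)" using \<open>surj T\<close> by (rule surj_imp_inj_inv)
  have inv: "inv_into UNIV T ` T ` L = L" "T ` inv_into UNIV T ` L = L" for L
    using \<open>inj T\<close> \<open>surj T\<close> by (auto simp: image_image surj_f_inv_f)
  note m = linear_morphism_proj[OF lin \<open>inj T\<close>] linear_morphism_proj[OF lin' \<open>inj (inv_into UNIV T)\<close>]
  show "isomorphism projective_variety projective_variety (image T)"
    unfolding isomorphism_def using m inv by blast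
  show "isomorphism projective_variety projective_variety (image (inv_into UNIV T))"
    unfolding isomorphism_def using m inv by blast
qed

lemma poly_on_coords_mpoly:
  fixes f :: "'k::comm_ring_1 ^ 'n::finite \<Rightarrow> 'k"
  assumes "poly_on (range (\<lambda>i a. a $ i)) f"
  shows "\<exists>q. f = mpoly_eval q"
  using assms
proof induction
  case (const c)
  show ?case by (rule exI[of _ "mpoly_const c"]) (simp add: fun_eq_iff mpoly_eval_const)
next
  case (coord c)
  then obtain i where "c = (\<lambda>a. a $ i)" by blast
  thus ?case by (intro exI[of _ "mpoly_var i"]) (simp add: fun_eq_iff mpoly_eval_var)
next
  case (add f g)
  then obtain p q where "f = mpoly_eval p" "g = mpoly_eval q" by blast
  thus ?case by (intro exI[of _ "p + q"]) (simp add: fun_eq_iff mpoly_eval_add)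
next
  case (mult f g)
  then obtain p q where "f = mpoly_eval p" "g = mpoly_eval q" by blast
  thus ?case by (intro exI[of _ "p * q"]) (simp add: fun_eq_iff mpoly_eval_mult)
qed

lemma mpoly_compose_linear:
  fixes A :: "'k::field ^ 'n::finite \<Rightarrow> 'k ^ 'l::finite"
  assumes "Vector_Spaces.linear (*s) (*s) A"
  shows "\<exists>q. \<forall>x. mpoly_eval q x = mpoly_eval p (A x)"
proof -
  have "poly_on (range (\<lambda>i a. a $ i)) (\<lambda>x. mpoly_eval p (A x))"
  proof (rule poly_on_mpoly_eval)
    fix i
    obtain c where c: "\<And>x. A x $ i = mpoly_eval (linear_form c) x"
      using linear_component[OF assms] by blast
    show "poly_on (range (\<lambda>i a. a $ i)) (\<lambda>x. A x $ i)"
      unfolding c by (intro poly_on_mpoly_eval poly_on.coord) blast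
  qed
  from poly_on_coords_mpoly[OF this] show ?thesis by (metis (no_types))
qed

lemma linear_morphism_affine:
  fixes A :: "'k::field ^ 'n::finite \<Rightarrow> 'k ^ 'l::finite"
  assumes lin: "Vector_Spaces.linear (*s) (*s) A"
  shows "morphism affine_variety affine_variety A"
proof -
  have cont: "continuous_map affine_space affine_space A"
  proof (rule continuous_map_affine)
    fix p :: "('l, 'k) mpoly"
    obtain q where "\<forall>x. mpoly_eval q x = mpoly_eval p (A x)" using mpoly_compose_linear[OF lin] by blast
    thus "openin affine_space {x \<in> topspace affine_space. mpoly_eval p (A x) \<noteq> 0}"
      using affine_principal_open[of q] by simp
  qed
  moreover have "regular_on affine_variety {x \<in> points affine_variety. A x \<in> V} (g \<circ> A)"
    if V: "openin affine_space V" "regular_on affine_variety V g" for V and g :: "'k ^ 'l \<Rightarrow> 'k"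
    unfolding regular_on_affine_iff
  proof
    fix a assume a: "a \<in> {x \<in> points affine_variety. A x \<in> V}"
    then obtain W p q where W: "openin affine_space W" "A a \<in> W" "W \<subseteq> V"
      "\<forall>y\<in>W. mpoly_eval q y \<noteq> 0 \<and> g y = mpoly_eval p y / mpoly_eval q y"
      using V(2) unfolding regular_on_affine_iff by (metis (no_types, lifting) mem_Collect_eq)
    obtain p' where p': "\<forall>x. mpoly_eval p' x = mpoly_eval p (A x)" using mpoly_compose_linear[OF lin] by blast
    obtain q' where q': "\<forall>x. mpoly_eval q' x = mpoly_eval q (A x)" using mpoly_compose_linear[OF lin] by blast
    let ?W = "{x \<in> topspace affine_space. A x \<in> W}"
    have "openin affine_space ?W" by (rule openin_continuous_map_preimage[OF cont W(1)])
    thus "\<exists>W p q. openin affine_space W \<and> a \<in> W \<and> W \<subseteq> {x \<in> points affine_variety. A x \<in> V} \<and>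
        (\<forall>y\<in>W. mpoly_eval q y \<noteq> 0 \<and> (g \<circ> A) y = mpoly_eval p y / mpoly_eval q y)"
      using W(2-4) p' q' by (intro exI[of _ ?W] exI[of _ p'] exI[of _ q']) auto
  qed
  ultimately show ?thesis unfolding morphism_def by (simp del: topspace_affine)
qed

text \<open>Stated for the inverse because the coordinate change is built from the model towards the
  given action, while \<open>equivalent\<close> asks for the opposite direction.\<close>

lemma linear_algebraic_automorphism:
  fixes A :: "'k::field_char_0 ^ 'n::finite \<Rightarrow> 'k ^ 'n"
  assumes lin: "Vector_Spaces.linear (*s) (*s) A" and "inj A"
  shows "algebraic_automorphism additive_group (inv_into UNIV A)"
proof -
  have "surj A" using vec.linear_inj_imp_surj[OF lin \<open>inj A\<close>] .
  have lin': "Vector_Spaces.linear (*s) (*s) (inv_into UNIV A)"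
  proof (rule vec_linearI)
    fix x y c
    show "inv_into UNIV A (x + y) = inv_into UNIV A x + inv_into UNIV A y"
      using \<open>inj A\<close> \<open>surj A\<close> by (metis inv_f_f surj_f_inv_f vec.linear_add[OF lin])
    show "inv_into UNIV A (c *s x) = c *s inv_into UNIV A x"
      using \<open>inj A\<close> \<open>surj A\<close> by (metis inv_f_f surj_f_inv_f vec.linear_scale[OF lin])
  qed
  have "bij (inv_into UNIV A)"
    using bij_betw_inv_into[of A UNIV UNIV] \<open>inj A\<close> \<open>surj A\<close> by (simp add: bij_def)
  hence "inv_into UNIV A \<in> iso additive_group additive_group"
    by (auto simp: iso_def hom_def additive_group_def vec.linear_add[OF lin'])
  moreover have "isomorphism affine_variety affine_variety (inv_into UNIV A)"
    unfolding isomorphism_def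
    using linear_morphism_affine[OF lin] linear_morphism_affine[OF lin'] \<open>inj A\<close> \<open>surj A\<close>
    by (auto simp: surj_f_inv_f intro!: exI[of _ A])
  ultimately show ?thesis by (simp add: algebraic_automorphism_def additive_group_def)
qed

text \<open>The preimage of a principal set is the principal set of the composed function. For
  regular functions, inserting the normalized vector of a chart turns numerator and denominator into
  sums of products of regular functions on the factors.\<close>

lemma bihom_morphism:
  fixes F :: "('k::field ^ 'n::finite) \<times> ('k ^ 'm::finite) \<Rightarrow> 'k ^ 'l::finite"
  assumes F: "\<And>i. bihom 1 (\<lambda>z. F z $ i)" and nz: "\<And>a x. x \<noteq> 0 \<Longrightarrow> F (a, x) \<noteq> 0"
    and \<Phi>: "\<And>a x. x \<noteq> 0 \<Longrightarrow> \<Phi> (a, line_of x) = line_of (F (a, x))"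
  shows "morphism affine_times_proj projective_variety \<Phi>"
proof -
  have \<Phi>_lines: "\<Phi> z \<in> lines" if "snd z \<in> lines" for z
    using that nz \<Phi>[of _ "fst z"] by (auto simp: lines_iff) (metis prod.collapse)
  have pre: "\<Phi> z \<in> proj_principal (mpoly_eval p) \<longleftrightarrow> z \<in> prod_principal (\<lambda>z. mpoly_eval p (F z))"
    if p: "homogeneous d p" and "snd z \<in> lines" for d p z
  proof -
    obtain x where x: "x \<noteq> 0" "snd z = line_of x" using \<open>snd z \<in> lines\<close> by (auto simp: lines_iff)
    hence z: "z = (fst z, line_of x)" by (metis prod.collapse)
    show ?thesis
      using line_of_in_prod_principal[OF bihom_compose[OF p F] x(1), of "fst z"]
        line_of_in_proj_principal[OF p nz[OF x(1)], of "fst z"] \<Phi>[OF x(1), of "fst z"] z by metis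
  qed
  have cont: "continuous_map (zariski affine_times_proj) proj_space \<Phi>"
  proof (rule continuous_map_proj)
    show "\<Phi> z \<in> lines" if "z \<in> topspace (zariski affine_times_proj)" for z
      using \<Phi>_lines that by (auto simp: mem_Times_iff)
    fix d and p :: "('l, 'k) mpoly" assume p: "homogeneous d p"
    have "{z \<in> topspace (zariski affine_times_proj). \<Phi> z \<in> proj_principal (mpoly_eval p)} =
        prod_principal (\<lambda>z. mpoly_eval p (F z))"
      using pre[OF p] by (auto simp: prod_principal_def[of "\<lambda>z. mpoly_eval p (F z)"])
    thus "openin (zariski affine_times_proj)
        {z \<in> topspace (zariski affine_times_proj). \<Phi> z \<in> proj_principal (mpoly_eval p)}"
      using prod_principal_open[OF bihom_compose[OF p F]] by simp
  qed
  moreover have "regular_on affine_times_proj {z \<in> points affine_times_proj. \<Phi> z \<in> V} (g \<circ> \<Phi>)"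
    if V: "openin proj_space V" "regular_on projective_variety V g" for V and g :: "('k ^ 'l) set \<Rightarrow> 'k"
    unfolding regular_on_product_iff
  proof
    fix z assume z: "z \<in> {z \<in> points affine_times_proj. \<Phi> z \<in> V}"
    then obtain W p q d where W: "openin proj_space W" "\<Phi> z \<in> W" "W \<subseteq> V" "homogeneous d p" "homogeneous d q"
      "\<And>M x. M \<in> W \<Longrightarrow> x \<in> M - {0} \<Longrightarrow> mpoly_eval q x \<noteq> 0 \<and> g M = mpoly_eval p x / mpoly_eval q x"
      using V(2) unfolding regular_on_proj_iff by (metis (no_types, lifting) mem_Collect_eq)
    have "snd z \<in> lines" using z by auto
    then obtain j where j: "snd z \<in> chart j" using chart_cover by blast
    define W' where "W' = {z \<in> topspace (zariski affine_times_proj). \<Phi> z \<in> W} \<inter>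
        prod_principal (\<lambda>z. mpoly_eval (mpoly_var j) (snd z))"
    have W': "openin (zariski affine_times_proj) W'" unfolding W'_def
      by (intro openin_Int openin_continuous_map_preimage[OF cont W(1)]
          prod_principal_open[OF bihom_snd[OF homogeneous_var]])
    have sub: "W' \<subseteq> UNIV \<times> chart j"
      by (auto simp: W'_def chart_def prod_principal_def proj_principal_def mpoly_eval_var)
    have "z \<in> W'" using z W(2) j
      by (auto simp: W'_def chart_def prod_principal_def proj_principal_def mpoly_eval_var)
    define h where "h z = mpoly_eval p (F (fst z, chart_vec j (snd z)))" for z
    define k where "k z = mpoly_eval q (F (fst z, chart_vec j (snd z)))" for z
    have hk: "h \<in> product_functions affine_variety projective_variety UNIV (chart j)"
      "k \<in> product_functions affine_variety projective_variety UNIV (chart j)"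
      unfolding h_def[abs_def] k_def[abs_def]
      by (rule bihom_product_function[OF bihom_compose[OF W(4) F]] bihom_product_function[OF bihom_compose[OF W(5) F]])+
    have eq: "k w \<noteq> 0 \<and> (g \<circ> \<Phi>) w = h w / k w" if "w \<in> W'" for w
    proof -
      have "snd w \<in> chart j" using that sub by auto
      note cv = chart_vec_mem[OF this]
      have "snd w \<in> lines" using \<open>snd w \<in> chart j\<close> by (simp add: chart_def proj_principal_def)
      hence "snd w = line_of (chart_vec j (snd w))" using cv lines_line_of by blast
      hence "\<Phi> w = line_of (F (fst w, chart_vec j (snd w)))" using \<Phi>[OF cv(2), of "fst w"] by simp
      hence "F (fst w, chart_vec j (snd w)) \<in> \<Phi> w - {0}" using mem_line_of nz[OF cv(2)] by simp
      moreover have "\<Phi> w \<in> W" using that by (simp add: W'_def)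
      ultimately show ?thesis using W(6) by (simp add: h_def k_def)
    qed
    have "openin affine_space (UNIV :: ('k ^ 'n) set)" using openin_topspace[of affine_space] by simp
    moreover have "W' \<subseteq> {z \<in> points affine_times_proj. \<Phi> z \<in> V}" using W(3) by (auto simp: W'_def)
    ultimately show "\<exists>W' U V' h k. openin (zariski affine_times_proj) W' \<and> z \<in> W' \<and>
        W' \<subseteq> {z \<in> points affine_times_proj. \<Phi> z \<in> V} \<and>
        openin affine_space U \<and> openin proj_space V' \<and> W' \<subseteq> U \<times> V' \<and>
        h \<in> product_functions affine_variety projective_variety U V' \<and>
        k \<in> product_functions affine_variety projective_variety U V' \<and>
        (\<forall>w\<in>W'. k w \<noteq> 0 \<and> (g \<circ> \<Phi>) w = h w / k w)"
      using W' \<open>z \<in> W'\<close> chart_open[of j] sub hk eq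
      by - (rule exI[of _ W'], rule exI[of _ UNIV], rule exI[of _ "chart j"], rule exI[of _ h],
          rule exI[of _ k], blast)
  qed
  ultimately show ?thesis unfolding morphism_def by (simp del: topspace_product)
qed

section \<open>A two-parameter family of structures\<close>

definition vec4 :: "'k \<Rightarrow> 'k \<Rightarrow> 'k \<Rightarrow> 'k \<Rightarrow> 'k ^ 3 option"
  where "vec4 u r s t =
    (\<chi> i. case i of None \<Rightarrow> u | Some j \<Rightarrow> if j = 1 then r else if j = 2 then s else t)"

lemma vec4_nth [simp]:
  "vec4 u r s t $ None = u" "vec4 u r s t $ Some 1 = r"
  "vec4 u r s t $ Some 2 = s" "vec4 u r s t $ Some 3 = t"
  by (simp_all add: vec4_def)

lemma all_option_3: "(\<forall>i :: 3 option. P i) \<longleftrightarrow> P None \<and> P (Some 1) \<and> P (Some 2) \<and> P (Some 3)"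
  by (metis (full_types) exhaust_3 option.exhaust)

lemma vec4_eq_iff:
  "x = y \<longleftrightarrow> x $ None = y $ None \<and> x $ Some 1 = y $ Some 1 \<and> x $ Some 2 = y $ Some 2 \<and> x $ Some 3 = y $ Some 3"
  for x y :: "'k ^ 3 option"
  by (simp add: vec_eq_iff all_option_3)

lemma vec3_eq_iff: "x = y \<longleftrightarrow> x $ 1 = y $ 1 \<and> x $ 2 = y $ 2 \<and> x $ 3 = y $ 3"
  for x y :: "'k ^ 3"
  by (simp add: vec_eq_iff forall_3)

text \<open>The product of the commutative algebra with basis \<open>1, S_1, S_2, S_3\<close> in which
  \<open>S_1\<^sup>2 = p S_2\<close> and \<open>S_1 S_2 = q S_3\<close>, while all other products of basis elements vanish. The ideals
  \<open>I_1, I_2, I_3, I_4\<close> correspond to \<open>(p, q) = (1, 1), (1, 0), (0, 1), (0, 0)\<close>.\<close>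

definition alg_mult :: "'k::comm_ring_1 \<Rightarrow> 'k \<Rightarrow> 'k ^ 3 option \<Rightarrow> 'k ^ 3 option \<Rightarrow> 'k ^ 3 option"
  where "alg_mult p q x y = vec4
    (x $ None * y $ None)
    (x $ None * y $ Some 1 + x $ Some 1 * y $ None)
    (x $ None * y $ Some 2 + x $ Some 2 * y $ None + p * (x $ Some 1 * y $ Some 1))
    (x $ None * y $ Some 3 + x $ Some 3 * y $ None + q * (x $ Some 1 * y $ Some 2 + x $ Some 2 * y $ Some 1))"

text \<open>The exponential series of the element with coordinates \<open>a\<close> in the maximal
  ideal: the terms with only \<open>p\<close> or only \<open>q\<close> come from its square, the one
  with \<open>p * q\<close> from the cube of \<open>S_1\<close>, and nothing survives beyond the
  cube.\<close>

definition alg_exp :: "'k::field_char_0 \<Rightarrow> 'k \<Rightarrow> 'k ^ 3 \<Rightarrow> 'k ^ 3 option"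
  where "alg_exp p q a = vec4 1 (a $ 1) (a $ 2 + p * (a $ 1)\<^sup>2 / 2)
    (a $ 3 + q * (a $ 1 * a $ 2) + p * q * (a $ 1) ^ 3 / 6)"

definition alg_structure :: "'k::field_char_0 \<Rightarrow> 'k \<Rightarrow> 'k ^ 3 \<Rightarrow> ('k ^ 3 option) set \<Rightarrow> ('k ^ 3 option) set"
  where "alg_structure p q a = (\<lambda>L\<in>lines. alg_mult p q (alg_exp p q a) ` L)"

lemma alg_mult_assoc: "alg_mult p q (alg_mult p q x y) z = alg_mult p q x (alg_mult p q y z)"
  by (simp add: vec4_eq_iff alg_mult_def algebra_simps)

lemma alg_exp_add: "alg_mult p q (alg_exp p q a) (alg_exp p q b) = alg_exp p q (a + b)"
  by (simp add: vec4_eq_iff alg_mult_def alg_exp_def field_simps power2_eq_square power3_eq_cube)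

lemma alg_exp_0: "alg_mult p q (alg_exp p q 0) x = x"
  by (simp add: vec4_eq_iff alg_mult_def alg_exp_def)

lemma linear_alg_mult: "Vector_Spaces.linear (*s) (*s) (alg_mult p q x)" for x :: "'k::field ^ 3 option"
  by (rule vec_linearI) (simp_all add: vec4_eq_iff alg_mult_def algebra_simps)

lemma alg_exp_mult_nonzero:
  assumes "x \<noteq> 0"
  shows "alg_mult p q (alg_exp p q a) x \<noteq> 0"
proof
  assume "alg_mult p q (alg_exp p q a) x = 0"
  hence "alg_mult p q (alg_exp p q (- a)) (alg_mult p q (alg_exp p q a) x) = 0"
    using vec.linear_0[OF linear_alg_mult] by metis
  thus False using assms by (simp add: alg_exp_add alg_exp_0 flip: alg_mult_assoc)
qed

lemma alg_structure_line_of: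
  "x \<noteq> 0 \<Longrightarrow> alg_structure p q a (line_of x) = line_of (alg_mult p q (alg_exp p q a) x)"
  by (simp add: alg_structure_def line_of_in_lines linear_image_line_of[OF linear_alg_mult])

lemma alg_structure_lines: "L \<in> lines \<Longrightarrow> alg_structure p q a L \<in> lines"
  by (auto simp: lines_iff[of L] alg_structure_line_of intro!: line_of_in_lines alg_exp_mult_nonzero)

lemma alg_structure_add:
  "L \<in> lines \<Longrightarrow> alg_structure p q (a + b) L = alg_structure p q a (alg_structure p q b L)"
  by (auto simp: lines_iff alg_structure_line_of alg_exp_mult_nonzero alg_mult_assoc simp flip: alg_exp_add)

lemma alg_structure_0: "L \<in> lines \<Longrightarrow> alg_structure p q 0 L = L"
  by (auto simp: lines_iff alg_structure_line_of alg_exp_0)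

lemma alg_structure_Bij: "alg_structure p q a \<in> Bij lines"
proof -
  have "bij_betw (alg_structure p q a) lines lines"
    by (rule bij_betw_byWitness[of _ "alg_structure p q (- a)"])
      (auto simp: alg_structure_lines alg_structure_0 simp flip: alg_structure_add)
  thus ?thesis by (simp add: Bij_def alg_structure_def)
qed

lemma group_additive: "group additive_group"
  by (rule groupI) (auto simp: additive_group_def intro: exI[of _ "- x" for x])

lemma alg_structure_action: "group_action additive_group lines (alg_structure p q)"
  unfolding group_action_def group_hom_def group_hom_axioms_def
proof (intro conjI group_additive group_BijGroup)
  have "alg_structure p q (a + b) = compose lines (alg_structure p q a) (alg_structure p q b)" for a b
  proof
    fix L show "alg_structure p q (a + b) L = compose lines (alg_structure p q a) (alg_structure p q b) L"
      by (cases "L \<in> lines") (simp_all add: compose_def alg_structure_add, simp add: alg_structure_def)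
  qed
  thus "alg_structure p q \<in> hom additive_group (BijGroup lines)"
    by (auto simp: hom_def BijGroup_def additive_group_def alg_structure_Bij)
qed

lemma bihom_times_snd:
  assumes "poly_on (range (\<lambda>i a. a $ i)) f"
  shows "bihom 1 (\<lambda>z :: (('k::comm_ring_1) ^ 'n::finite) \<times> ('k ^ 'm::finite). f (fst z) * snd z $ i)"
proof -
  obtain q where "f = mpoly_eval q" using poly_on_coords_mpoly[OF assms] by blast
  thus ?thesis using bihom.base[OF homogeneous_var[of i], of q] by (simp add: mpoly_eval_var)
qed

lemma alg_exp_poly: "poly_on (range (\<lambda>i a. a $ i)) (\<lambda>a. alg_exp p q a $ i)"
proof -
  have c: "poly_on (range (\<lambda>i a. a $ i)) (\<lambda>a. a $ i)" for i :: 3 by (rule poly_on.coord) blast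
  \<comment> \<open>Division by a constant is rewritten as a scalar multiple, since
    \<open>poly_on\<close> is generated by sums and products.\<close>
  have d: "r * x / s = (r / s) * x" for r x s :: 'a by simp
  have "\<forall>i. poly_on (range (\<lambda>i a. a $ i)) (\<lambda>a. alg_exp p q a $ i)"
    unfolding all_option_3 alg_exp_def vec4_nth d
    by (intro conjI poly_on.add poly_on.mult poly_on_power poly_on.const c)
  thus ?thesis by blast
qed

lemma alg_structure_morphism:
  "morphism affine_times_proj projective_variety (\<lambda>(a, L). alg_structure p q a L)"
proof (rule bihom_morphism[where F = "\<lambda>z. alg_mult p q (alg_exp p q (fst z)) (snd z)"])
  fix i
  have e: "bihom 1 (\<lambda>z. alg_exp p q (fst z) $ i * snd z $ j)" for i j
    by (rule bihom_times_snd[OF alg_exp_poly])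
  have "\<forall>i. bihom 1 (\<lambda>z. alg_mult p q (alg_exp p q (fst z)) (snd z) $ i)"
    unfolding all_option_3 alg_mult_def vec4_nth by (intro conjI bihom.add bihom_cmult e)
  thus "bihom 1 (\<lambda>z. alg_mult p q (alg_exp p q (fst z)) (snd z) $ i)" by blast
qed (simp_all add: alg_exp_mult_nonzero alg_structure_line_of)

section \<open>The dense orbit, consisting of the lines spanned by units, and the stabilizers of all
  points\<close>

definition big_cell :: "('k::field ^ 3 option) set set"
  where "big_cell = proj_principal (\<lambda>x. x $ None)"

lemma big_cell_eq: "big_cell = proj_principal (mpoly_eval (mpoly_var None))"
  by (simp add: big_cell_def mpoly_eval_var[abs_def])

lemma line_of_big_cell: "x \<noteq> 0 \<Longrightarrow> line_of x \<in> big_cell \<longleftrightarrow> x $ None \<noteq> 0"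
  unfolding big_cell_eq by (simp add: line_of_in_proj_principal[OF homogeneous_var] mpoly_eval_var)

text \<open>By irreducibility a form that is nonzero somewhere and the coordinate
  \<open>None\<close> are nonzero at a common vector. A dummy affine factor of dimension 1 brings
  this under \<open>bipoly_nonzero_mult\<close>.\<close>

lemma big_cell_dense: "proj_space closure_of big_cell = (lines :: ('k::field_char_0 ^ 3 option) set set)"
proof (rule antisym)
  show "proj_space closure_of big_cell \<subseteq> (lines :: ('k ^ 3 option) set set)"
    using closure_of_subset_topspace[of proj_space] by simp
  show "(lines :: ('k ^ 3 option) set set) \<subseteq> proj_space closure_of big_cell"
  proof
    fix L :: "('k ^ 3 option) set" assume L: "L \<in> lines"
    have "\<exists>K. K \<in> big_cell \<and> K \<in> W" if W: "L \<in> W" "openin proj_space W" for W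
    proof -
      obtain f d where f: "homogeneous d f" "L \<in> proj_principal (mpoly_eval f)" "proj_principal (mpoly_eval f) \<subseteq> W"
        using proj_open_principal[OF W(2,1)] by blast
      obtain x where x: "x \<noteq> 0" "L = line_of x" using L by (auto simp: lines_iff)
      have fx: "mpoly_eval f x \<noteq> 0" using f(2) x by (simp add: line_of_in_proj_principal[OF f(1)])
      have "bihom d (\<lambda>z :: ('k ^ 1) \<times> ('k ^ 3 option). mpoly_eval f (snd z))" by (rule bihom_snd[OF f(1)])
      hence "bipoly (\<lambda>z :: ('k ^ 1) \<times> ('k ^ 3 option). mpoly_eval f (snd z))" by (rule bihom_bipoly)
      from bipoly_nonzero_mult[OF this bipoly_snd[of None], of "(0, x)" "(0, vec4 1 0 0 0)"]
      obtain y where y: "mpoly_eval f y \<noteq> 0" "y $ None \<noteq> 0" using fx by auto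
      hence "y \<noteq> 0" by auto
      hence "line_of y \<in> big_cell \<and> line_of y \<in> W"
        using y f(3) by (auto simp: line_of_big_cell line_of_in_proj_principal[OF f(1)])
      thus ?thesis by blast
    qed
    thus "L \<in> proj_space closure_of big_cell" using L by (auto simp: in_closure_of)
  qed
qed

text \<open>On the big cell the action is simply transitive because \<open>exp\<close> is a bijection onto the elements with
  leading coordinate 1; the solution is given by the logarithm.\<close>

lemma alg_exp_transitive:
  assumes "x $ None \<noteq> 0"
  shows "\<exists>a c. c \<noteq> 0 \<and> c *s alg_mult p q (alg_exp p q a) (vec4 1 0 0 0) = x"
proof -
  define a1 where "a1 = x $ Some 1 / x $ None"
  define a2 where "a2 = x $ Some 2 / x $ None - p * a1\<^sup>2 / 2"
  define a3 where "a3 = x $ Some 3 / x $ None - q * (a1 * a2) - p * q * a1 ^ 3 / 6"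
  define a :: "'a ^ 3" where "a = vector [a1, a2, a3]"
  have "x $ None *s alg_mult p q (alg_exp p q a) (vec4 1 0 0 0) = x"
    using assms by (simp add: vec4_eq_iff alg_mult_def alg_exp_def a_def a3_def) (simp add: a2_def a1_def)
  thus ?thesis using assms by blast
qed

text \<open>Every line of the cell is reached from the line \<open>K\<close> of the unit element.
  Conversely, multiplication by an exponential leaves the coordinate \<open>None\<close> unchanged,
  so orbits of the cell stay in it.\<close>

lemma alg_structure_orbit:
  assumes L: "L \<in> big_cell"
  shows "orbit additive_group (alg_structure p q) L = big_cell"
proof -
  define K :: "('a ^ 3 option) set" where "K = line_of (vec4 1 0 0 0)"
  have e0: "vec4 1 0 0 0 \<noteq> (0 :: 'a ^ 3 option)" by (simp add: vec4_eq_iff)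
  have K: "\<exists>a. L = alg_structure p q a K" if L: "L \<in> big_cell" for L
  proof -
    have "L \<in> lines" using L by (simp add: big_cell_def proj_principal_def)
    then obtain x where x: "x \<noteq> 0" "L = line_of x" by (auto simp: lines_iff)
    hence "x $ None \<noteq> 0" using L line_of_big_cell by blast
    then obtain a c where c: "c \<noteq> 0" "c *s alg_mult p q (alg_exp p q a) (vec4 1 0 0 0) = x"
      using alg_exp_transitive by blast
    have "L = line_of (alg_mult p q (alg_exp p q a) (vec4 1 0 0 0))"
      unfolding x(2) c(2)[symmetric] by (rule line_of_scale[OF c(1)])
    hence "L = alg_structure p q a K" by (simp only: K_def alg_structure_line_of[OF e0])
    thus ?thesis by blast
  qed
  have "K \<in> lines" using e0 by (simp add: K_def line_of_in_lines)
  show ?thesis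
  proof
    show "orbit additive_group (alg_structure p q) L \<subseteq> big_cell"
    proof
      fix N assume "N \<in> orbit additive_group (alg_structure p q) L"
      then obtain a where N: "N = alg_structure p q a L" by (auto simp: orbit_def)
      have "L \<in> lines" using L by (simp add: big_cell_def proj_principal_def)
      then obtain x where x: "x \<noteq> 0" "L = line_of x" by (auto simp: lines_iff)
      hence "x $ None \<noteq> 0" using L line_of_big_cell by blast
      thus "N \<in> big_cell"
        using alg_exp_mult_nonzero[OF x(1)]
        by (simp add: N x(2) alg_structure_line_of[OF x(1)] line_of_big_cell)
          (simp add: alg_mult_def alg_exp_def)
    qed
    show "big_cell \<subseteq> orbit additive_group (alg_structure p q) L"
    proof
      fix N :: "('a ^ 3 option) set" assume "N \<in> big_cell"
      then obtain a where a: "N = alg_structure p q a K" using K by blast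
      obtain b where b: "L = alg_structure p q b K" using K[OF L] by blast
      have "N = alg_structure p q (a - b) L"
        using alg_structure_add[OF \<open>K \<in> lines\<close>, of p q "a - b" b] by (simp add: a b)
      thus "N \<in> orbit additive_group (alg_structure p q) L"
        by (auto simp: orbit_def additive_group_def)
    qed
  qed
qed

text \<open>Exponentials act unipotently, so an element that stabilizes a line fixes its vectors.
  Where \<open>None\<close> is 0, the quadratic part of the last equation is a multiple of the first
  condition, which leaves conditions linear in \<open>a\<close>; elsewhere the coordinates of
  \<open>a\<close> are forced to be 0 one after the other.\<close>

lemma alg_stabilizer:
  assumes "x \<noteq> 0"
  shows "stabilizer additive_group (alg_structure p q) (line_of x) =
    (if x $ None = 0 then {a. p * (a $ 1 * x $ Some 1) = 0 \<and> q * (a $ 1 * x $ Some 2 + a $ 2 * x $ Some 1) = 0}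
     else {0})"
proof -
  define y where "y a = alg_mult p q (alg_exp p q a) x" for a
  have y: "y a $ None = x $ None" "y a $ Some 1 = x $ Some 1 + a $ 1 * x $ None"
    "y a $ Some 2 = x $ Some 2 + (a $ 2 + p * (a $ 1)\<^sup>2 / 2) * x $ None + p * (a $ 1 * x $ Some 1)"
    "y a $ Some 3 = x $ Some 3 + (a $ 3 + q * (a $ 1 * a $ 2) + p * q * (a $ 1) ^ 3 / 6) * x $ None
       + q * (a $ 1 * x $ Some 2 + (a $ 2 + p * (a $ 1)\<^sup>2 / 2) * x $ Some 1)" for a
    by (simp_all add: y_def alg_mult_def alg_exp_def)
  have stab: "a \<in> stabilizer additive_group (alg_structure p q) (line_of x) \<longleftrightarrow> y a = x" for a
  proof -
    have "a \<in> stabilizer additive_group (alg_structure p q) (line_of x) \<longleftrightarrow> line_of (y a) = line_of x"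
      by (simp add: stabilizer_def additive_group_def alg_structure_line_of[OF assms] y_def)
    also have "\<dots> \<longleftrightarrow> y a = x"
    proof
      assume "line_of (y a) = line_of x"
      hence "y a \<in> line_of x" using mem_line_of by metis
      then obtain c where c: "y a = c *s x" by (auto simp: line_of_def)
      have c4: "y a $ None = c * x $ None" "y a $ Some 1 = c * x $ Some 1" "y a $ Some 2 = c * x $ Some 2"
        "y a $ Some 3 = c * x $ Some 3" by (simp_all add: c)
      \<comment> \<open>The action is triangular: the first nonzero coordinate of \<open>x\<close>
        is left unchanged.\<close>
      have "c = 1"
      proof (cases "x $ None = 0")
        case False
        thus ?thesis using c4(1) by (simp add: y)
      next
        case n: True
        show ?thesis
        proof (cases "x $ Some 1 = 0")
          case False
          thus ?thesis using c4(2) n by (simp add: y)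
        next
          case s1: True
          show ?thesis
          proof (cases "x $ Some 2 = 0")
            case False
            thus ?thesis using c4(3) n s1 by (simp add: y)
          next
            case True
            hence "x $ Some 3 \<noteq> 0" using assms n s1 by (simp add: vec4_eq_iff)
            thus ?thesis using c4(4) n s1 True by (simp add: y)
          qed
        qed
      qed
      thus "y a = x" by (simp add: c)
    qed simp
    finally show ?thesis .
  qed
  show ?thesis
  proof (cases "x $ None = 0")
    case True
    have "y a = x \<longleftrightarrow> p * (a $ 1 * x $ Some 1) = 0 \<and> q * (a $ 1 * x $ Some 2 + a $ 2 * x $ Some 1) = 0" for a
    proof -
      have "q * (a $ 1 * x $ Some 2 + (a $ 2 + p * (a $ 1)\<^sup>2 / 2) * x $ Some 1) =
          q * (a $ 1 * x $ Some 2 + a $ 2 * x $ Some 1) + q * a $ 1 * (p * (a $ 1 * x $ Some 1)) / 2"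
        by (simp add: field_simps power2_eq_square)
      thus ?thesis unfolding vec4_eq_iff[of "y a" x] by (auto simp: y True)
    qed
    thus ?thesis using stab True by auto
  next
    case False
    have "y a = x \<longleftrightarrow> a = 0" for a
      unfolding vec4_eq_iff[of "y a" x] vec3_eq_iff using False by (auto simp: y)
    thus ?thesis using stab False by auto
  qed
qed

lemma alg_structure_is_structure:
  "is_structure additive_group projective_variety (alg_structure p q)"
  unfolding is_structure_def
proof (intro conjI exI[of _ big_cell] ballI)
  show "group_action additive_group (points projective_variety) (alg_structure p q)"
    using alg_structure_action by simp
  show "morphism (product_variety (variety additive_group) projective_variety) projective_variety
      (\<lambda>(g, x). alg_structure p q g x)"
    using alg_structure_morphism by (simp add: additive_group_def)
  show "openin proj_space (big_cell :: ('a ^ 3 option) set set)" unfolding big_cell_eq by (rule proj_principal_open[OF homogeneous_var])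
  show "proj_space closure_of (big_cell :: ('a ^ 3 option) set set) = points projective_variety"
    by (simp add: big_cell_dense)
  fix L :: "('a ^ 3 option) set" assume L: "L \<in> big_cell"
  show "proj_space closure_of orbit additive_group (alg_structure p q) L = points projective_variety"
    by (simp add: alg_structure_orbit[OF L] big_cell_dense)
  have "L \<in> lines" using L by (simp add: big_cell_def proj_principal_def)
  then obtain x where x: "x \<noteq> 0" "L = line_of x" by (auto simp: lines_iff)
  hence "x $ None \<noteq> 0" using L line_of_big_cell by blast
  thus "stabilizer additive_group (alg_structure p q) L = {\<one>\<^bsub>additive_group\<^esub>}"
    unfolding x(2) alg_stabilizer[OF x(1)] by (simp add: additive_group_def)
qed

section \<open>Reduction of an arbitrary structure to the family\<close>

lemma alg_exp_series:
  "(\<Sum>k<4. (1 / fact k) *s ((alg_mult p q (vec4 0 (v $ 1) (v $ 2) (v $ 3)) ^^ k) r)) = alg_mult p q (alg_exp p q v) r"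
  by (simp add: eval_nat_numeral vec4_eq_iff alg_mult_def alg_exp_def field_simps)

lemma alg_nilpotent:
  "(alg_mult p q (vec4 0 u v w) ^^ 4) r = 0"
  by (simp add: eval_nat_numeral vec4_eq_iff alg_mult_def)

text \<open>The map \<open>T\<close>, which applies algebra elements to \<open>w\<close>, identifies
  the regular representation of the model algebra with the given one, and \<open>\<beta>\<close> is
  the matching change of basis on the group. Corresponding nilpotent operators have corresponding
  exponentials, so the inverses of \<open>\<beta>\<close> and \<open>T\<close> form the
  equivalence.\<close>

lemma structure_equivalent_alg_structure:
  assumes str: "is_structure Ga3 P3 \<phi>"
  shows "\<exists>p q. (p = 0 \<or> p = 1) \<and> (q = 0 \<or> q = 1) \<and> equivalent Ga3 P3 \<phi> P3 (alg_structure p q)"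
proof -
  obtain D mul w where
    add: "\<And>u v x. D (u + v) *v x = D u *v x + D v *v x"
    and scale: "\<And>c v x. D (c *s v) *v x = c *s (D v *v x)"
    and mul: "\<And>u v x. D u *v (D v *v x) = D (mul u v) *v x"
    and comm: "\<And>u v x. D u *v (D v *v x) = D v *v (D u *v x)"
    and nil: "\<And>v. \<exists>k. \<forall>x. ((*v) (D v) ^^ k) x = 0"
    and inj: "\<And>c v. c *s w + D v *v w = 0 \<Longrightarrow> c = 0 \<and> v = 0"
    and exp: "\<And>v x. (\<And>y. ((*v) (D v) ^^ 4) y = 0) \<Longrightarrow> x \<noteq> 0 \<Longrightarrow>
      \<phi> v (line_of x) = line_of (\<Sum>k<4. (1 / fact k) *s ((*v) (D v) ^^ k) x)"
    by (rule structure_algebra[OF str]) blast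
  have D_eq: "u = v" if "D u *v w = D v *v w" for u v
  proof -
    have "D (u + (- 1) *s v) *v w = 0" unfolding add scale that by simp
    hence "u + (- 1) *s v = 0" using inj[of 0 "u + (- 1) *s v"] by simp
    thus ?thesis by simp
  qed
  have D0: "D 0 *v x = 0" for x using scale[of 0 0 x] by simp
  \<comment> \<open>The laws hold for products of the matrices \<open>D v\<close>; they descend to
    \<open>mul\<close> because \<open>D v *v w\<close> determines \<open>v\<close>.\<close>
  interpret nil_algebra mul
  proof
    show "mul (x + y) z = mul x z + mul y z" for x y z
      by (rule D_eq) (simp add: add flip: mul)
    show "mul (c *s x) z = c *s mul x z" for c x z
      by (rule D_eq) (simp add: scale flip: mul)
    show "mul x y = mul y x" for x y
      by (rule D_eq) (use comm in \<open>simp flip: mul\<close>)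
    show "mul (mul x y) z = mul x (mul y z)" for x y z
      by (rule D_eq) (simp flip: mul)
    show "\<exists>k. (mul u ^^ k) x = 0" for u x
    proof -
      obtain k where k: "\<forall>x. ((*v) (D u) ^^ k) x = 0" using nil by blast
      have "D ((mul u ^^ k) x) *v w = ((*v) (D u) ^^ k) (D x *v w)" for k
        by (induction k) (simp_all flip: mul)
      hence "D ((mul u ^^ k) x) *v w = D 0 *v w" by (simp add: k D0)
      thus ?thesis using D_eq by blast
    qed
  qed
  obtain p q b1 b2 b3 where pq: "p = 0 \<or> p = 1" "q = 0 \<or> q = 1"
    and tab: "mul b1 b1 = p *s b2" "mul b1 b2 = q *s b3" "mul b1 b3 = 0"
      "mul b2 b2 = 0" "mul b2 b3 = 0" "mul b3 b3 = 0"
    and ind: "\<And>r s t. r *s b1 + s *s b2 + t *s b3 = 0 \<Longrightarrow> r = 0 \<and> s = 0 \<and> t = 0"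
    by (rule classification, rule that)
  define \<beta> where "\<beta> v = v $ 1 *s b1 + v $ 2 *s b2 + v $ 3 *s b3" for v :: "qbar ^ 3"
  have lin\<beta>: "Vector_Spaces.linear (*s) (*s) \<beta>"
    by (rule vec_linearI) (simp_all add: \<beta>_def vec_eq_iff algebra_simps)
  have "inj \<beta>"
  proof (rule injI)
    fix u v assume "\<beta> u = \<beta> v"
    hence "\<beta> (u - v) = 0" by (simp add: vec.linear_diff[OF lin\<beta>])
    hence "(u - v) $ 1 = 0 \<and> (u - v) $ 2 = 0 \<and> (u - v) $ 3 = 0" unfolding \<beta>_def by (rule ind)
    thus "u = v" by (simp add: vec3_eq_iff)
  qed
  have \<beta>_mul: "mul (\<beta> u) (\<beta> v) = (p * (u $ 1 * v $ 1)) *s b2 + (q * (u $ 1 * v $ 2 + u $ 2 * v $ 1)) *s b3" for u v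
  proof -
    have tab': "mul b2 b1 = q *s b3" "mul b3 b1 = 0" "mul b3 b2 = 0"
      using tab commute by metis+
    show ?thesis by (simp add: \<beta>_def expand tab tab') (simp add: vec_eq_iff algebra_simps)
  qed
  define tail :: "qbar ^ 3 option \<Rightarrow> qbar ^ 3" where "tail r = (\<chi> i. r $ Some i)" for r
  have tail [simp]: "tail r $ i = r $ Some i" for r i by (simp add: tail_def)
  define T where "T r = r $ None *s w + D (\<beta> (tail r)) *v w" for r
  have linT: "Vector_Spaces.linear (*s) (*s) T"
  proof (rule vec_linearI)
    fix r s c
    have e: "tail (r + s) = tail r + tail s" "tail (c *s r) = c *s tail r" by (simp_all add: vec_eq_iff)
    show "T (r + s) = T r + T s"
      by (simp only: T_def e vec.linear_add[OF lin\<beta>] add) (simp add: vec_eq_iff algebra_simps)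
    show "T (c *s r) = c *s T r"
      by (simp only: T_def e vec.linear_scale[OF lin\<beta>] scale) (simp add: vec_eq_iff algebra_simps)
  qed
  have "inj T"
  proof (rule injI)
    fix r s assume "T r = T s"
    hence "T (r - s) = 0" by (simp add: vec.linear_diff[OF linT])
    hence "(r - s) $ None = 0 \<and> \<beta> (tail (r - s)) = 0" unfolding T_def by (rule inj)
    hence *: "(r - s) $ None = 0" "\<beta> (tail (r - s)) = \<beta> 0" by (simp_all add: vec.linear_0[OF lin\<beta>])
    have "tail (r - s) = 0" by (rule injD[OF \<open>inj \<beta>\<close> *(2)])
    with *(1) show "r = s" by (simp add: vec4_eq_iff vec3_eq_iff)
  qed
  have surjT: "surj T" using vec.linear_inj_imp_surj[OF linT \<open>inj T\<close>] .
  have surj\<beta>: "surj \<beta>" using vec.linear_inj_imp_surj[OF lin\<beta> \<open>inj \<beta>\<close>] .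
  define N where "N v = alg_mult p q (vec4 0 (v $ 1) (v $ 2) (v $ 3))" for v :: "qbar ^ 3"
  \<comment> \<open>Multiplication by a nilpotent element of the model becomes
    \<open>D (\<beta> v)\<close>: the coordinate \<open>None\<close> of \<open>r\<close> contributes
    \<open>\<beta> v\<close> itself, the other coordinates the product in the nilpotent
    algebra.\<close>
  have DT: "D (\<beta> v) *v T r = T (N v r)" for v r
  proof -
    have e: "\<beta> (tail (N v r)) = r $ None *s \<beta> v + mul (\<beta> v) (\<beta> (tail r))"
      unfolding \<beta>_mul by (simp add: \<beta>_def N_def alg_mult_def vec_eq_iff algebra_simps)
    have n: "N v r $ None = 0" by (simp add: N_def alg_mult_def)
    have "T (N v r) = r $ None *s (D (\<beta> v) *v w) + D (mul (\<beta> v) (\<beta> (tail r))) *v w"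
      unfolding T_def e n add scale by simp
    also have "\<dots> = D (\<beta> v) *v T r"
      unfolding T_def matrix_vector_right_distrib vector_scalar_commute mul by (rule refl)
    finally show ?thesis by (rule sym)
  qed
  have DT_pow: "((*v) (D (\<beta> v)) ^^ k) (T r) = T ((N v ^^ k) r)" for v k r
    by (induction k) (simp_all add: DT)
  have D4: "((*v) (D (\<beta> v)) ^^ 4) y = 0" for v y
  proof -
    obtain r where "y = T r" using surjT by (metis surjD)
    thus ?thesis by (simp add: DT_pow N_def alg_nilpotent vec.linear_0[OF linT])
  qed
  have \<phi>T: "\<phi> (\<beta> v) (line_of (T r)) = line_of (T (alg_mult p q (alg_exp p q v) r))" if "r \<noteq> 0" for v r
  proof -
    have "T r \<noteq> 0" using that \<open>inj T\<close> vec.linear_0[OF linT] by (metis injD)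
    moreover have "(\<Sum>k<4. (1 / fact k) *s ((*v) (D (\<beta> v)) ^^ k) (T r)) = T (\<Sum>k<4. (1 / fact k) *s ((N v ^^ k) r))"
      unfolding vec.linear_sum[OF linT] vec.linear_scale[OF linT] DT_pow by (rule refl)
    ultimately show ?thesis using exp[OF D4] by (simp add: N_def alg_exp_series)
  qed
  have invT: "inv_into UNIV T ` line_of (T r) = line_of r" for r
    using \<open>inj T\<close> by (simp add: image_image flip: linear_image_line_of[OF linT])
  have "equivalent Ga3 P3 \<phi> P3 (alg_structure p q)"
    unfolding equivalent_def
  proof (intro exI conjI ballI)
    show "algebraic_automorphism Ga3 (inv_into UNIV \<beta>)"
      by (rule linear_algebraic_automorphism[OF lin\<beta> \<open>inj \<beta>\<close>])
    show "isomorphism P3 P3 (image (inv_into UNIV T))"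
      by (rule linear_isomorphism_proj(2)[OF linT \<open>inj T\<close>])
    fix g and L :: "(qbar ^ 3 option) set" assume "L \<in> points P3"
    then obtain y where y: "y \<noteq> 0" "L = line_of y" by (auto simp: lines_iff)
    obtain r where r: "y = T r" using surjT by (metis surjD)
    obtain v where v: "g = \<beta> v" using surj\<beta> by (metis surjD)
    have "r \<noteq> 0" using y(1) r vec.linear_0[OF linT] by auto
    thus "inv_into UNIV T ` \<phi> g L = alg_structure p q (inv_into UNIV \<beta> g) (inv_into UNIV T ` L)"
      by (simp add: y(2) r v \<phi>T invT alg_structure_line_of inv_f_f[OF \<open>inj \<beta>\<close>])
  qed
  thus ?thesis using pq by blast
qed

section \<open>Equivalence\<close>

lemma morphism_comp:
  assumes "morphism X Y f" "morphism Y Z g"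
  shows "morphism X Z (g \<circ> f)"
proof -
  have cf: "continuous_map (zariski X) (zariski Y) f" and cg: "continuous_map (zariski Y) (zariski Z) g"
    using assms unfolding morphism_def by blast+
  have "regular_on X {x \<in> points X. (g \<circ> f) x \<in> V} (h \<circ> (g \<circ> f))"
    if V: "openin (zariski Z) V" "regular_on Z V h" for V h
  proof -
    let ?W = "{y \<in> points Y. g y \<in> V}"
    have "regular_on Y ?W (h \<circ> g)" using assms(2) V unfolding morphism_def by blast
    moreover have "openin (zariski Y) ?W" by (rule openin_continuous_map_preimage[OF cg V(1)])
    ultimately have "regular_on X {x \<in> points X. f x \<in> ?W} ((h \<circ> g) \<circ> f)"
      using assms(1) unfolding morphism_def by blast
    moreover have "{x \<in> points X. f x \<in> ?W} = {x \<in> points X. (g \<circ> f) x \<in> V}"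
      using continuous_map_image_subset_topspace[OF cf] by auto
    ultimately show ?thesis by (simp add: o_assoc)
  qed
  thus ?thesis using continuous_map_compose[OF cf cg] unfolding morphism_def by blast
qed

lemma morphism_points: "morphism X Y f \<Longrightarrow> x \<in> points X \<Longrightarrow> f x \<in> points Y"
  unfolding morphism_def using continuous_map_image_subset_topspace by blast

lemma isomorphism_comp:
  assumes "isomorphism X Y f" "isomorphism Y Z g"
  shows "isomorphism X Z (g \<circ> f)"
proof -
  obtain f' g' where f: "morphism X Y f" "morphism Y X f'" "\<forall>x\<in>points X. f' (f x) = x" "\<forall>y\<in>points Y. f (f' y) = y"
    and g: "morphism Y Z g" "morphism Z Y g'" "\<forall>x\<in>points Y. g' (g x) = x" "\<forall>y\<in>points Z. g (g' y) = y"
    using assms unfolding isomorphism_def by blast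
  have "\<forall>x\<in>points X. (f' \<circ> g') ((g \<circ> f) x) = x" "\<forall>z\<in>points Z. (g \<circ> f) ((f' \<circ> g') z) = z"
    using f g morphism_points[OF f(1)] morphism_points[OF g(2)] by simp_all
  thus ?thesis using morphism_comp[OF f(1) g(1)] morphism_comp[OF g(2) f(2)]
    unfolding isomorphism_def by blast
qed

lemma morphism_id: "morphism X X id"
  by (auto simp: morphism_def o_def intro: back_subst[of "\<lambda>U. regular_on X U _"] dest: openin_subset)

lemma isomorphism_id: "isomorphism X X id"
  unfolding isomorphism_def using morphism_id by (intro conjI exI[of _ id]) auto

lemma structure_points:
  assumes "\<phi> \<in> structures G X" "g \<in> carrier G" "x \<in> points X"
  shows "\<phi> g x \<in> points X"
proof -
  interpret group_action G "points X" \<phi> using assms(1) by (simp add: structures_def is_structure_def)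
  show ?thesis using element_image assms by blast
qed

lemma equivalent_refl:
  assumes "group G"
  shows "equivalent G X \<phi> X \<phi>"
proof -
  have "id \<in> iso G G" by (simp add: iso_def hom_def)
  thus ?thesis unfolding equivalent_def algebraic_automorphism_def
    using isomorphism_id[of X] isomorphism_id[of "variety G"]
    by (intro exI[of _ id] conjI) auto
qed

lemma equivalent_trans:
  assumes "equivalent G X \<phi> X \<psi>" "equivalent G X \<psi> X \<omega>"
  shows "equivalent G X \<phi> X \<omega>"
proof -
  obtain \<alpha> j where j: "\<alpha> \<in> iso G G" "isomorphism (variety G) (variety G) \<alpha>" "isomorphism X X j"
    "\<forall>g\<in>carrier G. \<forall>x\<in>points X. j (\<phi> g x) = \<psi> (\<alpha> g) (j x)"
    using assms(1) unfolding equivalent_def algebraic_automorphism_def by blast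
  obtain \<beta> k where k: "\<beta> \<in> iso G G" "isomorphism (variety G) (variety G) \<beta>" "isomorphism X X k"
    "\<forall>g\<in>carrier G. \<forall>x\<in>points X. k (\<psi> g x) = \<omega> (\<beta> g) (k x)"
    using assms(2) unfolding equivalent_def algebraic_automorphism_def by blast
  have mj: "morphism X X j" using j(3) unfolding isomorphism_def by (rule conjunct1)
  show ?thesis
    unfolding equivalent_def algebraic_automorphism_def
  proof (intro exI conjI ballI)
    show "\<beta> \<circ> \<alpha> \<in> iso G G" by (rule iso_set_trans[OF j(1) k(1)])
    show "isomorphism (variety G) (variety G) (\<beta> \<circ> \<alpha>)" by (rule isomorphism_comp[OF j(2) k(2)])
    show "isomorphism X X (k \<circ> j)" by (rule isomorphism_comp[OF j(3) k(3)])
    fix g x assume gx: "g \<in> carrier G" "x \<in> points X"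
    have "\<alpha> g \<in> carrier G" using j(1) gx(1) by (auto simp: iso_def hom_def)
    thus "(k \<circ> j) (\<phi> g x) = \<omega> ((\<beta> \<circ> \<alpha>) g) ((k \<circ> j) x)"
      using j(4) k(4) gx morphism_points[OF mj gx(2)] by simp
  qed
qed

text \<open>Inverse morphisms are two-sided inverses only on points. Identifying
  \<open>carrier G\<close> with the points of its variety makes the inverse of
  \<open>\<alpha>\<close> a group homomorphism, and \<open>\<phi>\<close> preserves
  \<open>points X\<close>, so \<open>j\<close> can be cancelled.\<close>

lemma equivalent_sym:
  assumes eq: "equivalent G X \<phi> X \<psi>" and "group G" and pts: "carrier G = points (variety G)"
    and \<phi>: "\<phi> \<in> structures G X"
  shows "equivalent G X \<psi> X \<phi>"
proof -
  obtain \<alpha> j where j: "\<alpha> \<in> iso G G" "isomorphism (variety G) (variety G) \<alpha>" "isomorphism X X j"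
    "\<forall>g\<in>carrier G. \<forall>x\<in>points X. j (\<phi> g x) = \<psi> (\<alpha> g) (j x)"
    using eq unfolding equivalent_def algebraic_automorphism_def by blast
  obtain \<alpha>' where \<alpha>: "morphism (variety G) (variety G) \<alpha>" "morphism (variety G) (variety G) \<alpha>'"
    "\<forall>x\<in>carrier G. \<alpha>' (\<alpha> x) = x" "\<forall>y\<in>carrier G. \<alpha> (\<alpha>' y) = y"
    using j(2) unfolding isomorphism_def pts by blast
  obtain j' where j': "morphism X X j" "morphism X X j'"
    "\<forall>x\<in>points X. j' (j x) = x" "\<forall>y\<in>points X. j (j' y) = y"
    using j(3) unfolding isomorphism_def by blast
  have \<alpha>'_car: "\<alpha>' g \<in> carrier G" if "g \<in> carrier G" for g
    using that morphism_points[OF \<alpha>(2)] by (simp add: pts)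
  have "\<alpha>' \<in> iso G G"
  proof (rule isoI)
    show "bij_betw \<alpha>' (carrier G) (carrier G)"
      by (rule bij_betw_byWitness[of _ \<alpha>]) (use \<alpha> \<alpha>'_car morphism_points[OF \<alpha>(1)] pts in auto)
    show "\<alpha>' \<in> hom G G"
    proof (rule homI)
      fix x y assume xy: "x \<in> carrier G" "y \<in> carrier G"
      have "\<alpha> (\<alpha>' x \<otimes>\<^bsub>G\<^esub> \<alpha>' y) = x \<otimes>\<^bsub>G\<^esub> y"
        using j(1) \<alpha>'_car[OF xy(1)] \<alpha>'_car[OF xy(2)] \<alpha>(4) xy by (simp add: iso_def hom_def)
      moreover have "\<alpha>' x \<otimes>\<^bsub>G\<^esub> \<alpha>' y \<in> carrier G"
        using \<alpha>'_car xy \<open>group G\<close> by (simp add: group.is_monoid monoid.m_closed)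
      ultimately show "\<alpha>' (x \<otimes>\<^bsub>G\<^esub> y) = \<alpha>' x \<otimes>\<^bsub>G\<^esub> \<alpha>' y" using \<alpha>(3) by metis
    qed (rule \<alpha>'_car)
  qed
  moreover have "j' (\<psi> g x) = \<phi> (\<alpha>' g) (j' x)" if "g \<in> carrier G" "x \<in> points X" for g x
  proof -
    have "j' x \<in> points X" using morphism_points[OF j'(2) that(2)] .
    hence "j (\<phi> (\<alpha>' g) (j' x)) = \<psi> g x" using j(4) \<alpha>'_car[OF that(1)] \<alpha>(4) j'(4) that by simp
    thus ?thesis
      using j'(3) structure_points[OF \<phi> \<alpha>'_car[OF that(1)] \<open>j' x \<in> points X\<close>] by metis
  qed
  moreover have "isomorphism (variety G) (variety G) \<alpha>'" "isomorphism X X j'"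
    using \<alpha> j' unfolding isomorphism_def pts by blast+
  ultimately show ?thesis unfolding equivalent_def algebraic_automorphism_def by blast
qed

lemma equiv_equivalence_rel:
  assumes "group G" "carrier G = points (variety G)"
  shows "equiv (structures G X) (equivalence_rel G X)"
proof (rule equivI)
  show "equivalence_rel G X \<subseteq> structures G X \<times> structures G X"
    by (auto simp: equivalence_rel_def)
  show "refl_on (structures G X) (equivalence_rel G X)"
    by (auto simp: refl_on_def equivalence_rel_def equivalent_refl[OF assms(1)])
  show "sym (equivalence_rel G X)"
    by (auto simp: sym_def equivalence_rel_def intro: equivalent_sym[OF _ assms])
  show "trans (equivalence_rel G X)"
    by (auto simp: trans_def equivalence_rel_def intro: equivalent_trans)
qed

text \<open>The stabilizer of \<open>j x\<close> is the image under \<open>\<alpha>\<close> of that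
  of \<open>x\<close>, and \<open>\<alpha>\<close> acts injectively on subsets of the group. So the
  number of distinct subgroups occurring as stabilizers is an invariant.\<close>

lemma equivalent_card_stabilizers:
  assumes eq: "equivalent G X \<phi> X \<psi>" and \<phi>: "\<phi> \<in> structures G X"
  shows "card (stabilizer G \<phi> ` points X) = card (stabilizer G \<psi> ` points X)"
proof -
  obtain \<alpha> j where \<alpha>: "\<alpha> \<in> iso G G" and j: "isomorphism X X j"
    and int: "\<And>g x. g \<in> carrier G \<Longrightarrow> x \<in> points X \<Longrightarrow> j (\<phi> g x) = \<psi> (\<alpha> g) (j x)"
    using eq unfolding equivalent_def algebraic_automorphism_def by blast
  obtain j' where j': "morphism X X j" "morphism X X j'"
    "\<And>x. x \<in> points X \<Longrightarrow> j' (j x) = x" "\<And>y. y \<in> points X \<Longrightarrow> j (j' y) = y"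
    using j unfolding isomorphism_def by blast
  have bij: "bij_betw \<alpha> (carrier G) (carrier G)" using \<alpha> by (simp add: iso_def)
  have stab: "stabilizer G \<psi> (j x) = \<alpha> ` stabilizer G \<phi> x" if x: "x \<in> points X" for x
  proof (intro antisym subsetI)
    fix h assume "h \<in> stabilizer G \<psi> (j x)"
    hence h: "h \<in> carrier G" "\<psi> h (j x) = j x" by (simp_all add: stabilizer_def)
    then obtain g where g: "g \<in> carrier G" "h = \<alpha> g" using bij by (auto simp: bij_betw_def)
    hence "j (\<phi> g x) = j x" using int[OF g(1) x] h by simp
    hence "\<phi> g x = x" using j'(3) structure_points[OF \<phi> g(1) x] x by metis
    thus "h \<in> \<alpha> ` stabilizer G \<phi> x" using g by (auto simp: stabilizer_def)
  next
    fix h assume "h \<in> \<alpha> ` stabilizer G \<phi> x"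
    then obtain g where g: "g \<in> carrier G" "\<phi> g x = x" "h = \<alpha> g" by (auto simp: stabilizer_def)
    thus "h \<in> stabilizer G \<psi> (j x)"
      using int[OF g(1) x] bij_betwE[OF bij] by (simp add: stabilizer_def)
  qed
  have "j ` points X = points X"
    using morphism_points[OF j'(1)] morphism_points[OF j'(2)] j'(4) by (metis image_eqI subsetI image_subsetI subset_antisym)
  hence "stabilizer G \<psi> ` points X = (\<lambda>x. stabilizer G \<psi> (j x)) ` points X"
    by (metis image_image)
  also have "\<dots> = image \<alpha> ` stabilizer G \<phi> ` points X"
    by (simp add: stab image_image)
  finally have img: "stabilizer G \<psi> ` points X = image \<alpha> ` stabilizer G \<phi> ` points X" .
  have "inj_on \<alpha> (carrier G)" using bij by (simp add: bij_betw_def)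
  hence "inj_on (image \<alpha>) (Pow (carrier G))" by (rule inj_on_image_Pow)
  moreover have "stabilizer G \<phi> ` points X \<subseteq> Pow (carrier G)" by (auto simp: stabilizer_def)
  ultimately have "inj_on (image \<alpha>) (stabilizer G \<phi> ` points X)" by (rule inj_on_subset)
  thus ?thesis unfolding img by (rule card_image[symmetric])
qed

section \<open>Counting the stabilizers in the family\<close>

lemma alg_stabilizers:
  "stabilizer additive_group (alg_structure p q) ` lines =
    insert {0} (range (\<lambda>(r, s). {a. p * (a $ 1 * r) = 0 \<and> q * (a $ 1 * s + a $ 2 * r) = 0}))"
  (is "?A = insert {0} (range ?S)")
proof (intro antisym subsetI)
  fix Z assume "Z \<in> ?A"
  then obtain x where x: "x \<noteq> 0" "Z = stabilizer additive_group (alg_structure p q) (line_of x)"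
    by (auto simp: lines_iff)
  show "Z \<in> insert {0} (range ?S)"
  proof (cases "x $ None = 0")
    case True
    hence "Z = ?S (x $ Some 1, x $ Some 2)" by (simp add: x(2) alg_stabilizer[OF x(1)])
    thus ?thesis by blast
  qed (simp add: x(2) alg_stabilizer[OF x(1)])
next
  fix Z assume "Z \<in> insert {0} (range ?S)"
  then consider "Z = {0}" | r s where "Z = ?S (r, s)" by auto
  thus "Z \<in> ?A"
  proof cases
    case 1
    have nz: "vec4 1 0 0 0 \<noteq> (0 :: 'a ^ 3 option)" by (simp add: vec4_eq_iff)
    have "Z = stabilizer additive_group (alg_structure p q) (line_of (vec4 1 0 0 0))"
      by (simp add: alg_stabilizer[OF nz] 1)
    thus ?thesis using line_of_in_lines[OF nz] by blast
  next
    case 2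
    \<comment> \<open>The last coordinate does not enter the conditions; the value 1 keeps the
      vector nonzero when \<open>r\<close> and \<open>s\<close> are 0.\<close>
    have nz: "vec4 0 r s 1 \<noteq> (0 :: 'a ^ 3 option)" by (simp add: vec4_eq_iff)
    have "Z = stabilizer additive_group (alg_structure p q) (line_of (vec4 0 r s 1))"
      by (simp add: alg_stabilizer[OF nz] 2)
    thus ?thesis using line_of_in_lines[OF nz] by blast
  qed
qed

text \<open>The trivial and the whole group always occur. \<open>(1, 0)\<close> adds one plane, and
  \<open>(1, 1)\<close> adds this plane and a line in it. For \<open>(0, 1)\<close> the planes given
  by \<open>a $ 1 * s + a $ 2 * r = 0\<close> form an infinite family, on which \<open>card\<close>
  is 0, a value that still differs from the other three.\<close>

lemma card_alg_stabilizers: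
  fixes p q :: "'k::field_char_0"
  assumes "p = 0 \<or> p = 1" "q = 0 \<or> q = 1"
  shows "card (stabilizer additive_group (alg_structure p q) ` lines) =
    (if q = 0 then (if p = 0 then 2 else 3) else (if p = 0 then 0 else 4))"
proof -
  let ?S = "\<lambda>p q (r, s). {a :: 'k ^ 3. p * (a $ 1 * r) = 0 \<and> q * (a $ 1 * s + a $ 2 * r) = 0}"
  have w: "vector [1, 0, 0] \<noteq> (0 :: 'k ^ 3)" "vector [0, 1, 0] \<noteq> (0 :: 'k ^ 3)" "vector [0, 0, 1] \<noteq> (0 :: 'k ^ 3)"
    by (simp_all add: vec3_eq_iff)
  have ne: "{0} \<noteq> (UNIV :: ('k ^ 3) set)" "{0} \<noteq> {a :: 'k ^ 3. a $ 1 = 0}" "{a :: 'k ^ 3. a $ 1 = 0} \<noteq> UNIV"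
    "{0} \<noteq> {a :: 'k ^ 3. a $ 1 = 0 \<and> a $ 2 = 0}" "{a :: 'k ^ 3. a $ 1 = 0 \<and> a $ 2 = 0} \<noteq> UNIV"
    "{a :: 'k ^ 3. a $ 1 = 0 \<and> a $ 2 = 0} \<noteq> {a. a $ 1 = 0}"
  proof -
    have a: "vector [1, 0, 0] \<in> (UNIV :: ('k ^ 3) set)" "vector [1, 0, 0] \<notin> {a :: 'k ^ 3. a $ 1 = 0}"
      "vector [1, 0, 0] \<notin> {a :: 'k ^ 3. a $ 1 = 0 \<and> a $ 2 = 0}" "vector [1, 0, 0] \<notin> {0 :: 'k ^ 3}"
      "vector [0, 1, 0] \<in> {a :: 'k ^ 3. a $ 1 = 0}" "vector [0, 1, 0] \<notin> {a :: 'k ^ 3. a $ 1 = 0 \<and> a $ 2 = 0}"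
      "vector [0, 0, 1] \<in> {a :: 'k ^ 3. a $ 1 = 0}" "vector [0, 0, 1] \<in> {a :: 'k ^ 3. a $ 1 = 0 \<and> a $ 2 = 0}"
      "vector [0, 0, 1] \<notin> {0 :: 'k ^ 3}"
      using w by simp_all
    show "{0} \<noteq> (UNIV :: ('k ^ 3) set)" "{0} \<noteq> {a :: 'k ^ 3. a $ 1 = 0}" "{a :: 'k ^ 3. a $ 1 = 0} \<noteq> UNIV"
      "{0} \<noteq> {a :: 'k ^ 3. a $ 1 = 0 \<and> a $ 2 = 0}" "{a :: 'k ^ 3. a $ 1 = 0 \<and> a $ 2 = 0} \<noteq> UNIV"
      "{a :: 'k ^ 3. a $ 1 = 0 \<and> a $ 2 = 0} \<noteq> {a. a $ 1 = 0}"
      using a by metis+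
  qed
  consider "p = 0" "q = 0" | "p = 1" "q = 0" | "p = 0" "q = 1" | "p = 1" "q = 1" using assms by blast
  thus ?thesis
  proof cases
    case 1
    have "range (?S 0 0) = {UNIV}" by auto
    thus ?thesis using ne by (simp add: alg_stabilizers 1)
  next
    case 2
    have "range (?S 1 0) = {UNIV, {a. a $ 1 = 0}}"
    proof (intro antisym subsetI)
      fix Z assume "Z \<in> range (?S 1 0)"
      then obtain r s where Z: "Z = ?S 1 0 (r, s)" by auto
      show "Z \<in> {UNIV, {a. a $ 1 = 0}}" unfolding Z by (cases "r = 0") auto
    next
      fix Z :: "('k ^ 3) set" assume "Z \<in> {UNIV, {a. a $ 1 = 0}}"
      moreover have "UNIV = ?S 1 0 (0, 0)" "{a. a $ 1 = 0} = ?S 1 0 (1, 0)" by auto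
      ultimately show "Z \<in> range (?S 1 0)" by blast
    qed
    thus ?thesis using ne by (simp add: alg_stabilizers 2)
  next
    case 3
    have "inj (\<lambda>t. ?S 0 1 (1, t))"
    proof (rule injI)
      fix s t assume eq: "?S 0 1 (1, s) = ?S 0 1 (1, t)"
      \<comment> \<open>This vector separates the planes: it satisfies the condition with parameter
        \<open>t\<close> only for \<open>t = s\<close>.\<close>
      have "vector [1, - s, 0] \<in> ?S 0 1 (1, s)" by simp
      hence "vector [1, - s, 0] \<in> ?S 0 1 (1, t)" unfolding eq .
      thus "s = t" by simp
    qed
    hence "infinite (range (\<lambda>t. ?S 0 1 (1, t)))" using infinite_UNIV_char_0 by (simp add: range_inj_infinite finite_image_iff)
    moreover have "range (\<lambda>t. ?S 0 1 (1, t)) \<subseteq> range (?S 0 1)" by blast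
    ultimately have "infinite (range (?S 0 1))" using finite_subset by blast
    thus ?thesis by (simp add: alg_stabilizers 3)
  next
    case 4
    have "range (?S 1 1) = {UNIV, {a. a $ 1 = 0}, {a. a $ 1 = 0 \<and> a $ 2 = 0}}"
    proof (intro antisym subsetI)
      fix Z assume "Z \<in> range (?S 1 1)"
      then obtain r s where Z: "Z = ?S 1 1 (r, s)" by auto
      show "Z \<in> {UNIV, {a. a $ 1 = 0}, {a. a $ 1 = 0 \<and> a $ 2 = 0}}" unfolding Z
        by (cases "r = 0"; cases "s = 0") auto
    next
      fix Z :: "('k ^ 3) set" assume "Z \<in> {UNIV, {a. a $ 1 = 0}, {a. a $ 1 = 0 \<and> a $ 2 = 0}}"
      moreover have "UNIV = ?S 1 1 (0, 0)" "{a. a $ 1 = 0} = ?S 1 1 (0, 1)"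
        "{a. a $ 1 = 0 \<and> a $ 2 = 0} = ?S 1 1 (1, 0)" by auto
      ultimately show "Z \<in> range (?S 1 1)" by blast
    qed
    thus ?thesis using ne by (simp add: alg_stabilizers 4)
  qed
qed

section \<open>The quotients of the polynomial ring\<close>

lemma mpoly_single_var: "Poly_Mapping.single (Poly_Mapping.single i 1 + m) c = mpoly_var i * Poly_Mapping.single m c"
  by (simp add: mpoly_var_def mult_single)

text \<open>Monomials arise by multiplying with one variable at a time, by induction on the total
  degree; multiplicativity of a map then needs checking only against constants and
  variables.\<close>

lemma mpoly_induct [case_names const add var]:
  fixes f :: "('n::finite, 'k::comm_ring_1) mpoly"
  assumes const: "\<And>c. P (mpoly_const c)" and add: "\<And>f g. P f \<Longrightarrow> P g \<Longrightarrow> P (f + g)"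
    and var: "\<And>i f. P f \<Longrightarrow> P (mpoly_var i * f)"
  shows "P f"
proof (induction f rule: mpoly_single_induct)
  case (single m c)
  show ?case
  proof (induction "\<Sum>i\<in>UNIV. Poly_Mapping.lookup m i" arbitrary: m)
    case 0
    hence "m = 0" by (intro poly_mapping_eqI) simp
    thus ?case using const by (simp add: mpoly_const_def)
  next
    case (Suc n)
    then obtain i where i: "Poly_Mapping.lookup m i \<noteq> 0" by (metis Zero_not_Suc sum.neutral)
    define m' where "m' = m - Poly_Mapping.single i 1"
    have m: "m = Poly_Mapping.single i 1 + m'"
      using i by (intro poly_mapping_eqI) (auto simp: m'_def lookup_add lookup_minus lookup_single when_def)
    have "(\<Sum>j\<in>UNIV. Poly_Mapping.lookup m j) =
        (\<Sum>j\<in>UNIV. Poly_Mapping.lookup (Poly_Mapping.single i (1::nat)) j) + (\<Sum>j\<in>UNIV. Poly_Mapping.lookup m' j)"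
      by (simp add: m lookup_add sum.distrib)
    also have "(\<Sum>j\<in>UNIV. Poly_Mapping.lookup (Poly_Mapping.single i (1::nat)) j) = 1"
      by (simp add: lookup_single when_def)
    finally have "n = (\<Sum>j\<in>UNIV. Poly_Mapping.lookup m' j)" using Suc(2) by simp
    hence "P (Poly_Mapping.single m' c)" by (rule Suc(1))
    thus ?case unfolding m mpoly_single_var by (rule var)
  qed
qed (rule add)

text \<open>The algebra homomorphism sending \<open>S_1, S_2, S_3\<close> to the basis elements of the algebra
  with parameters \<open>p, q\<close>; a monomial not mentioned is sent to 0.\<close>

definition to_alg :: "'k::field \<Rightarrow> 'k \<Rightarrow> (3, 'k) mpoly \<Rightarrow> 'k ^ 3 option"
  where "to_alg p q f = (let c = (\<lambda>i j k. Poly_Mapping.lookup f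
      (Poly_Mapping.single 1 i + Poly_Mapping.single 2 j + Poly_Mapping.single 3 k))
    in vec4 (c 0 0 0) (c 1 0 0) (c 0 1 0 + p * c 2 0 0) (c 0 0 1 + q * c 1 1 0 + p * q * c 3 0 0))"

definition basis_vec :: "3 \<Rightarrow> 'k::field ^ 3 option"
  where "basis_vec i = axis (Some i) 1"

lemma to_alg_add: "to_alg p q (f + g) = to_alg p q f + to_alg p q g"
  by (simp add: to_alg_def Let_def vec4_eq_iff lookup_add algebra_simps)

lemma exponent_eq_iff:
  "m = Poly_Mapping.single 1 i + Poly_Mapping.single 2 j + Poly_Mapping.single 3 k \<longleftrightarrow>
    Poly_Mapping.lookup m 1 = i \<and> Poly_Mapping.lookup m 2 = j \<and> Poly_Mapping.lookup m 3 = k"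
  for m :: "3 \<Rightarrow>\<^sub>0 nat"
  by (auto simp: poly_mapping_eq_iff fun_eq_iff forall_3 lookup_add lookup_single when_def)

lemma to_alg_single:
  "to_alg p q (Poly_Mapping.single m c) = c *s
    (let c = (\<lambda>i j k. if Poly_Mapping.lookup m 1 = i \<and> Poly_Mapping.lookup m 2 = j \<and> Poly_Mapping.lookup m 3 = k
      then 1 else 0)
    in vec4 (c 0 0 0) (c 1 0 0) (c 0 1 0 + p * c 2 0 0) (c 0 0 1 + q * c 1 1 0 + p * q * c 3 0 0))"
  by (simp only: to_alg_def Let_def lookup_single when_def exponent_eq_iff vec4_eq_iff vec4_nth vector_smult_component)
    (simp add: algebra_simps)

lemma alg_mult_add_right: "alg_mult p q x (y + z) = alg_mult p q x y + alg_mult p q x z" for x :: "'k::field ^ 3 option"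
  by (rule vec.linear_add[OF linear_alg_mult])

lemma alg_mult_scale_right: "alg_mult p q x (c *s z) = c *s alg_mult p q x z" for x :: "'k::field ^ 3 option"
  by (rule vec.linear_scale[OF linear_alg_mult])

lemma alg_mult_commute: "alg_mult p q x y = alg_mult p q y x"
  by (simp add: alg_mult_def vec4_eq_iff algebra_simps)

lemma alg_mult_one: "alg_mult p q (vec4 1 0 0 0) x = x"
  by (simp add: alg_mult_def vec4_eq_iff)

lemma basis_vec: "basis_vec 1 = vec4 0 1 0 0" "basis_vec 2 = vec4 0 0 1 0" "basis_vec 3 = vec4 0 0 0 1"
  by (simp_all add: basis_vec_def vec4_eq_iff axis_def)

lemma to_alg_var: "to_alg p q (mpoly_var i * f) = alg_mult p q (basis_vec i) (to_alg p q f)"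
proof (induction f rule: mpoly_single_induct)
  case (single m c)
  have "\<forall>i. to_alg p q (mpoly_var i * Poly_Mapping.single m c) =
      alg_mult p q (basis_vec i) (to_alg p q (Poly_Mapping.single m c))"
    unfolding forall_3 mpoly_single_var[symmetric] to_alg_single lookup_add lookup_single Let_def basis_vec
    by (simp add: vec4_eq_iff alg_mult_def when_def)
  thus ?case by blast
next
  case (add f g)
  thus ?case by (simp add: distrib_left to_alg_add alg_mult_add_right)
qed

lemma to_alg_const_mult: "to_alg p q (mpoly_const c * f) = c *s to_alg p q f"
proof (induction f rule: mpoly_single_induct)
  case (single m d)
  show ?case by (simp add: mpoly_const_def mult_single to_alg_single)
next
  case (add f g)
  thus ?case by (simp add: distrib_left to_alg_add vector_add_ldistrib)
qed

lemma to_alg_one: "to_alg p q 1 = vec4 1 0 0 0"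
  unfolding single_one[symmetric] to_alg_single by (simp add: vec4_eq_iff)

lemma mpoly_const_1: "mpoly_const 1 = 1" and mpoly_const_0: "mpoly_const 0 = 0"
  by (simp_all add: mpoly_const_def single_one)

lemma to_alg_const: "to_alg p q (mpoly_const c) = vec4 c 0 0 0"
  using to_alg_const_mult[of p q c 1] by (simp add: to_alg_one vec4_eq_iff)

lemma to_alg_mult: "to_alg p q (f * g) = alg_mult p q (to_alg p q f) (to_alg p q g)"
proof (induction f rule: mpoly_induct)
  case (const c)
  show ?case by (simp add: to_alg_const_mult to_alg_const vec4_eq_iff alg_mult_def)
next
  case (add f h)
  thus ?case by (simp add: distrib_right to_alg_add alg_mult_add_right alg_mult_commute[of p q _ "to_alg p q g"])
next
  case (var i f)
  thus ?case by (simp add: mult.assoc to_alg_var alg_mult_assoc)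
qed

lemma to_alg_0: "to_alg p q 0 = 0"
  using to_alg_const[of p q 0] by (simp add: mpoly_const_0 vec4_eq_iff)

lemma to_alg_minus: "to_alg p q (- f) = - to_alg p q f"
  using to_alg_add[of p q f "- f"] by (simp add: to_alg_0 eq_neg_iff_add_eq_0 add.commute)

lemma to_alg_diff: "to_alg p q (f - g) = to_alg p q f - to_alg p q g"
  using to_alg_add[of p q f "- g"] by (simp add: to_alg_minus)

lemma to_alg_mpoly_var: "to_alg p q (mpoly_var i) = basis_vec i"
  using to_alg_var[of p q i 1] by (simp add: to_alg_one alg_mult_commute[of p q "basis_vec i"] alg_mult_one)

text \<open>The representative of degree at most 1, a right inverse of \<open>to_alg p q\<close> for
  all parameters at once; it is also the polynomial inside \<open>to_quotient\<close>.\<close>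

definition normal_form :: "'k::field ^ 3 option \<Rightarrow> (3, 'k) mpoly"
  where "normal_form x = mpoly_const (x $ None) + linear_form (\<chi> i. x $ Some i)"

lemma normal_form_eq:
  "normal_form x = mpoly_const (x $ None) + (mpoly_const (x $ Some 1) * mpoly_var 1 +
    mpoly_const (x $ Some 2) * mpoly_var 2 + mpoly_const (x $ Some 3) * mpoly_var 3)"
  by (simp add: normal_form_def linear_form_def sum_3)

lemma to_alg_normal_form: "to_alg p q (normal_form x) = x"
  by (simp add: normal_form_eq to_alg_add to_alg_const_mult to_alg_const to_alg_mpoly_var basis_vec vec4_eq_iff)

lemma mpoly_const_add: "mpoly_const (c + d) = mpoly_const c + mpoly_const d"
  and mpoly_const_mult: "mpoly_const (c * d) = mpoly_const c * mpoly_const d"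
  by (simp_all add: mpoly_const_def single_add mult_single)

lemma normal_form_add: "normal_form (x + y) = normal_form x + normal_form y"
  by (simp add: normal_form_eq mpoly_const_add algebra_simps)

lemma poly_ring_simps [simp]:
  "carrier poly_ring = UNIV" "f \<otimes>\<^bsub>poly_ring\<^esub> g = f * g" "f \<oplus>\<^bsub>poly_ring\<^esub> g = f + g"
  "\<zero>\<^bsub>poly_ring\<^esub> = 0" "\<one>\<^bsub>poly_ring\<^esub> = 1"
  by (simp_all add: ring_of_type_algebra_def)

lemma cring_poly_ring: "cring (poly_ring :: ('n::finite, 'k::comm_ring_1) mpoly ring)"
  by (rule cring_from_type_algebra)

lemma poly_idealI:
  fixes I :: "('n::finite, 'k::comm_ring_1) mpoly set"
  assumes "0 \<in> I" "\<And>f g. f \<in> I \<Longrightarrow> g \<in> I \<Longrightarrow> f + g \<in> I" "\<And>f g. g \<in> I \<Longrightarrow> f * g \<in> I"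
  shows "ideal I poly_ring"
proof -
  interpret R: cring "poly_ring :: ('n, 'k) mpoly ring" by (rule cring_poly_ring)
  have neg: "\<ominus>\<^bsub>poly_ring\<^esub> f = - f" for f :: "('n, 'k) mpoly"
    by (rule R.minus_equality) simp_all
  show ?thesis
  proof (rule idealI)
    show "subgroup I (add_monoid poly_ring)"
    proof (rule R.add.subgroupI)
      fix f assume "f \<in> I"
      thus "\<ominus>\<^bsub>poly_ring\<^esub> f \<in> I" using assms(3)[of f "- 1"] by (simp add: neg)
    qed (use assms in auto)
  qed (use assms(3) R.ring_axioms in \<open>auto simp: mult.commute\<close>)
qed

lemma poly_idealD:
  fixes I :: "('n::finite, 'k::comm_ring_1) mpoly set"
  assumes "ideal I poly_ring"
  shows "0 \<in> I" "f \<in> I \<Longrightarrow> g \<in> I \<Longrightarrow> f + g \<in> I" "g \<in> I \<Longrightarrow> f * g \<in> I"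
    "f \<in> I \<Longrightarrow> g \<in> I \<Longrightarrow> f - g \<in> I"
proof -
  show z: "0 \<in> I" using additive_subgroup.zero_closed[OF ideal.axioms(1)[OF assms]] by simp
  show a: "f + g \<in> I" if "f \<in> I" "g \<in> I" for f g
    using additive_subgroup.a_closed[OF ideal.axioms(1)[OF assms] that] by simp
  show m: "f * g \<in> I" if "g \<in> I" for f g
    using ideal.I_l_closed[OF assms that, of f] by simp
  show "f - g \<in> I" if "f \<in> I" "g \<in> I"
    using a[OF that(1) m[OF that(2), of "- 1"]] by simp
qed

lemma to_alg_kernel_ideal: "ideal {f. to_alg p q f = 0} poly_ring"
  by (rule poly_idealI) (simp_all add: to_alg_0 to_alg_add to_alg_mult vec.linear_0[OF linear_alg_mult])

text \<open>The six relations are the full multiplication table, so a variable times a normal form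
  reduces to a normal form modulo \<open>I\<close>. Hence every polynomial is congruent to the
  normal form of its image, which is 0 on the kernel.\<close>

lemma mem_ideal_iff_to_alg_eq_0:
  fixes I :: "(3, 'k::field) mpoly set"
  assumes I: "ideal I poly_ring" and kernel: "\<And>f. f \<in> I \<Longrightarrow> to_alg p q f = 0"
    and rels: "mpoly_var 1 * mpoly_var 1 - mpoly_const p * mpoly_var 2 \<in> I"
      "mpoly_var 1 * mpoly_var 2 - mpoly_const q * mpoly_var 3 \<in> I"
      "mpoly_var 1 * mpoly_var 3 \<in> I" "mpoly_var 2 * mpoly_var 2 \<in> I"
      "mpoly_var 2 * mpoly_var 3 \<in> I" "mpoly_var 3 * mpoly_var 3 \<in> I"
  shows "f \<in> I \<longleftrightarrow> to_alg p q f = 0"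
proof -
  note add = poly_idealD(2)[OF I] and mult = poly_idealD(3)[OF I]
  have "f - normal_form (to_alg p q f) \<in> I" for f
  proof (induction f rule: mpoly_induct)
    case (const c)
    have "mpoly_const c - normal_form (to_alg p q (mpoly_const c)) = 0"
      by (simp add: to_alg_const normal_form_eq mpoly_const_0)
    thus ?case using poly_idealD(1)[OF I] by simp
  next
    case (add f g)
    have eq: "f + g - normal_form (to_alg p q (f + g)) =
        (f - normal_form (to_alg p q f)) + (g - normal_form (to_alg p q g))"
      by (simp add: to_alg_add normal_form_add)
    show ?case unfolding eq by (rule poly_idealD(2)[OF I add])
  next
    case (var i f)
    define x where "x = to_alg p q f"
    \<comment> \<open>The discrepancy is the combination of table relations whose coefficients are
      the coordinates of \<open>x\<close>.\<close>
    have "\<forall>i. mpoly_var i * normal_form x - normal_form (alg_mult p q (basis_vec i) x) \<in> I"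
      unfolding forall_3
    proof (intro conjI)
      have "mpoly_var 1 * normal_form x - normal_form (alg_mult p q (basis_vec 1) x) =
          mpoly_const (x $ Some 1) * (mpoly_var 1 * mpoly_var 1 - mpoly_const p * mpoly_var 2) +
          mpoly_const (x $ Some 2) * (mpoly_var 1 * mpoly_var 2 - mpoly_const q * mpoly_var 3) +
          mpoly_const (x $ Some 3) * (mpoly_var 1 * mpoly_var 3)"
        by (simp add: normal_form_eq alg_mult_def basis_vec mpoly_const_0 mpoly_const_mult algebra_simps)
      thus "mpoly_var 1 * normal_form x - normal_form (alg_mult p q (basis_vec 1) x) \<in> I"
        using rels by (simp only: poly_idealD(2,3)[OF I])
      have "mpoly_var 2 * normal_form x - normal_form (alg_mult p q (basis_vec 2) x) =
          mpoly_const (x $ Some 1) * (mpoly_var 1 * mpoly_var 2 - mpoly_const q * mpoly_var 3) +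
          mpoly_const (x $ Some 2) * (mpoly_var 2 * mpoly_var 2) +
          mpoly_const (x $ Some 3) * (mpoly_var 2 * mpoly_var 3)"
        by (simp add: normal_form_eq alg_mult_def basis_vec mpoly_const_0 mpoly_const_mult algebra_simps)
      thus "mpoly_var 2 * normal_form x - normal_form (alg_mult p q (basis_vec 2) x) \<in> I"
        using rels by (simp only: poly_idealD(2,3)[OF I])
      have "mpoly_var 3 * normal_form x - normal_form (alg_mult p q (basis_vec 3) x) =
          mpoly_const (x $ Some 1) * (mpoly_var 1 * mpoly_var 3) +
          mpoly_const (x $ Some 2) * (mpoly_var 2 * mpoly_var 3) +
          mpoly_const (x $ Some 3) * (mpoly_var 3 * mpoly_var 3)"
        by (simp add: normal_form_eq alg_mult_def basis_vec mpoly_const_0 mpoly_const_mult algebra_simps)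
      thus "mpoly_var 3 * normal_form x - normal_form (alg_mult p q (basis_vec 3) x) \<in> I"
        using rels by (simp only: poly_idealD(2,3)[OF I])
    qed
    hence "mpoly_var i * normal_form x - normal_form (alg_mult p q (basis_vec i) x) \<in> I" by blast
    from add[OF mult[OF var, of "mpoly_var i"] this[unfolded x_def]]
    show ?case by (simp add: to_alg_var right_diff_distrib)
  qed
  from this[of f] show ?thesis
    using kernel by (auto simp: normal_form_eq mpoly_const_0)
qed

text \<open>\<open>I\<close> is exactly the kernel of \<open>to_alg p q\<close>, so the quotient is
  the coordinate algebra with product \<open>alg_mult p q\<close>, in which its ring properties can
  be read off.\<close>

locale presentation =
  fixes p q :: "'k::field_char_0" and I :: "(3, 'k) mpoly set"
  assumes I: "ideal I poly_ring" and mem_iff: "f \<in> I \<longleftrightarrow> to_alg p q f = 0"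
begin

abbreviation "R \<equiv> poly_ring Quot I"

abbreviation coset :: "(3, 'k) mpoly \<Rightarrow> (3, 'k) mpoly set"
  where "coset f \<equiv> I +>\<^bsub>poly_ring\<^esub> f"

definition cl :: "'k ^ 3 option \<Rightarrow> (3, 'k) mpoly set"
  where "cl x = coset (normal_form x)"

lemma coset_eq_iff: "coset f = coset g \<longleftrightarrow> to_alg p q f = to_alg p q g"
proof -
  have coset: "coset f = (\<lambda>h. h + f) ` I" for f by (auto simp: a_r_coset_def')
  have "coset f = coset g \<longleftrightarrow> f - g \<in> I"
  proof
    assume "coset f = coset g"
    moreover have "f \<in> coset f" unfolding coset using poly_idealD(1)[OF I] by force
    ultimately obtain h where "h \<in> I" "f = h + g" unfolding coset by auto
    thus "f - g \<in> I" by simp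
  next
    assume fg: "f - g \<in> I"
    show "coset f = coset g"
    proof (intro antisym subsetI)
      fix a assume "a \<in> coset f"
      then obtain h where "h \<in> I" "a = (h + (f - g)) + g" unfolding coset by auto
      thus "a \<in> coset g" unfolding coset using poly_idealD(2)[OF I _ fg] by blast
    next
      fix a assume "a \<in> coset g"
      then obtain h where "h \<in> I" "a = (h - (f - g)) + f" unfolding coset by auto
      thus "a \<in> coset f" unfolding coset using poly_idealD(4)[OF I _ fg] by blast
    qed
  qed
  thus ?thesis by (simp add: mem_iff to_alg_diff)
qed

lemma coset_cl: "coset f = cl (to_alg p q f)"
  by (simp add: cl_def coset_eq_iff to_alg_normal_form)

lemma cl_eq_iff: "cl x = cl y \<longleftrightarrow> x = y"
  by (simp add: cl_def coset_eq_iff to_alg_normal_form)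

lemma carrier_R: "carrier R = range cl"
proof -
  have "carrier R = range coset" by (auto simp: FactRing_def A_RCOSETS_def')
  also have "\<dots> = range cl"
    unfolding coset_cl by (auto intro: range_eqI[of _ _ "normal_form x" for x] simp: to_alg_normal_form)
  finally show ?thesis .
qed

lemma R_mult: "cl x \<otimes>\<^bsub>R\<^esub> cl y = cl (alg_mult p q x y)"
  unfolding cl_def
  using ideal.rcoset_mult_add[OF I, of "normal_form x" "normal_form y"]
  by (simp add: FactRing_def) (simp add: coset_eq_iff to_alg_mult to_alg_normal_form)

lemma R_add: "cl x \<oplus>\<^bsub>R\<^esub> cl y = cl (x + y)"
proof -
  interpret ideal I poly_ring by (rule I)
  show ?thesis
    unfolding cl_def using a_rcos_sum[of "normal_form x" "normal_form y"]
    by (simp add: FactRing_def normal_form_add)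
qed

lemma R_zero: "\<zero>\<^bsub>R\<^esub> = cl 0"
proof -
  have "coset 0 = I" by (auto simp: a_r_coset_def')
  thus ?thesis by (simp add: FactRing_def coset_cl to_alg_0)
qed

lemma cring_R: "cring R"
  by (rule ideal.quotient_is_cring[OF I cring_poly_ring])

section \<open>Ideals of the quotient as invariant subspaces of the coordinate algebra\<close>

lemma ideal_cl_image:
  assumes V: "vec.subspace V" and mult: "\<And>x y. y \<in> V \<Longrightarrow> alg_mult p q x y \<in> V"
  shows "ideal (cl ` V) R"
proof -
  interpret R: cring R by (rule cring_R)
  have neg: "\<ominus>\<^bsub>R\<^esub> cl x = cl (- x)" for x
    by (rule R.minus_equality) (simp_all add: carrier_R R_add R_zero)
  show ?thesis
  proof (rule idealI)
    show "subgroup (cl ` V) (add_monoid R)"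
    proof (rule R.add.subgroupI)
      show "cl ` V \<subseteq> carrier R" by (auto simp: carrier_R)
      show "cl ` V \<noteq> {}" using vec.subspace_0[OF V] by blast
      show "\<ominus>\<^bsub>R\<^esub> a \<in> cl ` V" if "a \<in> cl ` V" for a
        using that vec.subspace_neg[OF V] by (auto simp: neg)
      show "a \<oplus>\<^bsub>R\<^esub> b \<in> cl ` V" if "a \<in> cl ` V" "b \<in> cl ` V" for a b
        using that vec.subspace_add[OF V] by (auto simp: R_add)
    qed
    fix a x assume "a \<in> cl ` V" "x \<in> carrier R"
    then obtain v y where v: "v \<in> V" "a = cl v" "x = cl y" by (auto simp: carrier_R)
    show "x \<otimes>\<^bsub>R\<^esub> a \<in> cl ` V" using mult v by (simp add: R_mult)
    show "a \<otimes>\<^bsub>R\<^esub> x \<in> cl ` V" using mult v by (simp add: R_mult alg_mult_commute[of p q v])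
  qed (rule R.ring_axioms)
qed

definition space :: "(3, 'k) mpoly set set \<Rightarrow> ('k ^ 3 option) set"
  where "space J = {x. cl x \<in> J}"

lemma ideal_space:
  assumes J: "ideal J R"
  shows "J = cl ` space J" "vec.subspace (space J)" "y \<in> space J \<Longrightarrow> alg_mult p q x y \<in> space J"
proof -
  have sub: "J \<subseteq> carrier R" using additive_subgroup.a_subset[OF ideal.axioms(1)[OF J]] .
  show "J = cl ` space J" using sub by (auto simp: space_def carrier_R)
  show m: "alg_mult p q x y \<in> space J" if "y \<in> space J" for x y
    using ideal.I_l_closed[OF J, of "cl y" "cl x"] that by (simp add: space_def R_mult carrier_R)
  show "vec.subspace (space J)"
  proof (rule vec.subspaceI)
    show "0 \<in> space J"
      using additive_subgroup.zero_closed[OF ideal.axioms(1)[OF J]] by (simp add: space_def R_zero)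
    show "x + y \<in> space J" if "x \<in> space J" "y \<in> space J" for x y
      using additive_subgroup.a_closed[OF ideal.axioms(1)[OF J], of "cl x" "cl y"] that
      by (simp add: space_def R_add)
    show "c *s x \<in> space J" if "x \<in> space J" for c x
    proof -
      \<comment> \<open>The algebra contains the scalars, so its ideals are subspaces.\<close>
      have "c *s x = alg_mult p q (vec4 c 0 0 0) x" by (simp add: alg_mult_def vec4_eq_iff)
      thus ?thesis using m[OF that] by simp
    qed
  qed
qed

lemma ideal_dim_less:
  assumes "ideal J R" "ideal K R" "J \<subset> K"
  shows "vec.dim (space J) < vec.dim (space K)"
proof -
  have sub: "space J \<subseteq> space K" using assms(3) by (auto simp: space_def)
  have "space J \<noteq> space K" using ideal_space(1)[OF assms(1)] ideal_space(1)[OF assms(2)] assms(3) by auto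
  hence "\<not> vec.dim (space K) \<le> vec.dim (space J)"
    using vec.subspace_dim_equal[OF ideal_space(2)[OF assms(1)] ideal_space(2)[OF assms(2)] sub] by blast
  thus ?thesis by simp
qed

lemma artinian_R: "artinian R"
  unfolding artinian_def
  by (rule wf_subset[OF wf_measure[of "\<lambda>J. vec.dim (space J)"]]) (auto intro: ideal_dim_less)

text \<open>The span of the last \<open>n\<close> among the basis elements
  \<open>1, S_1, S_2, S_3\<close>. In this order multiplication moves only towards the end, so every
  step is an ideal for all \<open>p\<close> and \<open>q\<close>; step 3 is the maximal
  ideal.\<close>

definition flag :: "nat \<Rightarrow> ('k ^ 3 option) set"
  where "flag n = {x. (n \<le> 3 \<longrightarrow> x $ None = 0) \<and> (n \<le> 2 \<longrightarrow> x $ Some 1 = 0) \<and>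
    (n \<le> 1 \<longrightarrow> x $ Some 2 = 0) \<and> (n = 0 \<longrightarrow> x $ Some 3 = 0)}"

lemma flag_ideal: "ideal (cl ` flag n) R"
proof (rule ideal_cl_image)
  show "vec.subspace (flag n)" by (rule vec.subspaceI) (auto simp: flag_def)
  show "alg_mult p q x y \<in> flag n" if "y \<in> flag n" for x y
    using that by (auto simp: flag_def alg_mult_def)
qed

lemma flag_inj: "inj_on flag {..4}"
proof (rule linorder_inj_onI)
  fix m n :: nat assume "m < n" "m \<in> {..4}" "n \<in> {..4}"
  then consider "m = 0" "n \<ge> 1" | "m = 1" "n \<ge> 2" | "m = 2" "n \<ge> 3" | "m = 3" "n = 4" by fastforce
  thus "flag m \<noteq> flag n"
  proof cases
    case 1
    hence "vec4 0 0 0 1 \<in> flag n" "vec4 0 0 0 1 \<notin> flag m" by (simp_all add: flag_def)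
    thus ?thesis by blast
  next
    case 2
    hence "vec4 0 0 1 0 \<in> flag n" "vec4 0 0 1 0 \<notin> flag m" by (simp_all add: flag_def)
    thus ?thesis by blast
  next
    case 3
    hence "vec4 0 1 0 0 \<in> flag n" "vec4 0 1 0 0 \<notin> flag m" by (simp_all add: flag_def)
    thus ?thesis by blast
  next
    case 4
    hence "vec4 1 0 0 0 \<in> flag n" "vec4 1 0 0 0 \<notin> flag m" by (simp_all add: flag_def)
    thus ?thesis by blast
  qed
qed auto

lemma inj_image_cl: "inj (image cl)"
  by (rule injI) (simp add: inj_image_eq_iff inj_def cl_eq_iff)

text \<open>The steps 0 to 4 of the flag form a chain of five ideals. Conversely, the dimension is
  injective on a chain and takes its values in 0 to 4.\<close>

lemma has_length_R: "has_length R 4"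
  unfolding has_length_def Let_def
proof (intro conjI ballI)
  let ?C = "(\<lambda>n. cl ` flag n) ` {..4}"
  have "inj_on (\<lambda>n. cl ` flag n) {..4}"
    using comp_inj_on[OF flag_inj inj_on_subset[OF inj_image_cl]] by (simp add: o_def)
  hence "card ?C = 4 + 1" by (simp add: card_image)
  moreover have "flag m \<subseteq> flag n" if "m \<le> n" for m n using that by (auto simp: flag_def)
  hence "\<forall>J\<in>?C. \<forall>K\<in>?C. J \<subseteq> K \<or> K \<subseteq> J" by (auto intro: image_mono) (meson image_mono nle_le subsetD imageI)
  ultimately show "\<exists>C\<in>{C. finite C \<and> (\<forall>J\<in>C. ideal J R) \<and> (\<forall>J\<in>C. \<forall>K\<in>C. J \<subseteq> K \<or> K \<subseteq> J)}. card C = 4 + 1"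
    using flag_ideal by (intro bexI[of _ ?C]) auto
  fix C assume "C \<in> {C. finite C \<and> (\<forall>J\<in>C. ideal J R) \<and> (\<forall>J\<in>C. \<forall>K\<in>C. J \<subseteq> K \<or> K \<subseteq> J)}"
  hence C: "\<And>J. J \<in> C \<Longrightarrow> ideal J R" "\<And>J K. J \<in> C \<Longrightarrow> K \<in> C \<Longrightarrow> J \<subseteq> K \<or> K \<subseteq> J" by auto
  have "inj_on (\<lambda>J. vec.dim (space J)) C"
  proof (rule inj_onI)
    fix J K assume "J \<in> C" "K \<in> C" "vec.dim (space J) = vec.dim (space K)"
    thus "J = K" using C ideal_dim_less by (metis less_irrefl psubsetI)
  qed
  moreover have "vec.dim (space J) \<le> 4" for J
    using vec.dim_subset[of "space J" UNIV] unfolding vec_dim_card by simp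
  hence "(\<lambda>J. vec.dim (space J)) ` C \<subseteq> {..4}" by auto
  ultimately have "card C \<le> card {..4::nat}" by (intro card_inj_on_le) auto
  thus "card C \<le> 4 + 1" by simp
qed

text \<open>Such an element is a nonzero scalar times an exponential, by
  \<open>alg_exp_transitive\<close>, and the exponential of \<open>- a\<close> inverts it.\<close>

lemma alg_inverse:
  assumes "x $ None \<noteq> 0"
  shows "\<exists>y. alg_mult p q y x = vec4 1 0 0 0"
proof -
  obtain a c where c: "c \<noteq> 0" "c *s alg_mult p q (alg_exp p q a) (vec4 1 0 0 0) = x"
    using alg_exp_transitive[OF assms] by blast
  have "alg_mult p q ((1 / c) *s alg_exp p q (- a)) x = (1 / c) *s alg_mult p q (alg_exp p q (- a)) x"
    by (simp add: alg_mult_commute[of p q _ x] alg_mult_scale_right)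
  also have "\<dots> = vec4 1 0 0 0"
    using c(1) by (simp add: alg_mult_scale_right alg_exp_add alg_exp_0 flip: c(2) alg_mult_assoc)
  finally show ?thesis by blast
qed

text \<open>A member with nonzero coordinate \<open>None\<close> is a unit and would generate the
  whole ring.\<close>

lemma proper_ideal_flag:
  assumes J: "ideal J R" and "J \<noteq> carrier R"
  shows "J \<subseteq> cl ` flag 3"
proof -
  have "x $ None = 0" if x: "x \<in> space J" for x
  proof (rule ccontr)
    assume "x $ None \<noteq> 0"
    then obtain y where "alg_mult p q y x = vec4 1 0 0 0" using alg_inverse by blast
    hence "vec4 1 0 0 0 \<in> space J" using ideal_space(3)[OF J x, of y] by simp
    hence "z \<in> space J" for z
      using ideal_space(3)[OF J, of "vec4 1 0 0 0" z] by (simp add: alg_mult_commute[of p q z] alg_mult_one)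
    hence "space J = UNIV" by blast
    hence "J = carrier R" using ideal_space(1)[OF J] by (simp add: carrier_R)
    thus False using assms(2) by simp
  qed
  hence "space J \<subseteq> flag 3" by (auto simp: flag_def)
  thus ?thesis using ideal_space(1)[OF J] by blast
qed

lemma maximalideal_iff: "maximalideal M R \<longleftrightarrow> M = cl ` flag 3"
proof -
  have ne: "carrier R \<noteq> cl ` flag 3"
  proof
    assume "carrier R = cl ` flag 3"
    hence "cl (vec4 1 0 0 0) \<in> cl ` flag 3" by (auto simp: carrier_R)
    thus False by (auto simp: cl_eq_iff flag_def)
  qed
  have max: "maximalideal (cl ` flag 3) R"
  proof (rule maximalidealI[OF flag_ideal ne])
    fix J assume "ideal J R" "cl ` flag 3 \<subseteq> J" "J \<subseteq> carrier R"
    thus "J = cl ` flag 3 \<or> J = carrier R" using proper_ideal_flag by blast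
  qed
  show ?thesis
  proof
    assume M: "maximalideal M R"
    have id: "ideal M R" using M by (rule maximalideal.axioms)
    have "M \<subseteq> cl ` flag 3" using proper_ideal_flag[OF id] maximalideal.I_notcarr[OF M] by blast
    moreover have "cl ` flag 3 \<subseteq> carrier R" by (auto simp: carrier_R)
    ultimately show "M = cl ` flag 3" using maximalideal.I_maximal[OF M flag_ideal] ne by blast
  qed (simp add: max)
qed

lemma defines_structure: "defines_structure I"
  unfolding defines_structure_def Let_def
proof (intro conjI)
  show "ideal I poly_ring" by (rule I)
  show "artinian R" by (rule artinian_R)
  show "local_ring R" unfolding local_ring_def using cring_R by (simp add: maximalideal_iff)
  show "has_length R (CARD(3) + 1)" using has_length_R by simp
  have the: "(THE M. maximalideal M R) = cl ` flag 3" by (simp add: maximalideal_iff)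
  have lf: "coset (linear_form c) = cl (vec4 0 (c $ 1) (c $ 2) (c $ 3))" for c
  proof -
    have "(\<chi> i. vec4 0 (c $ 1) (c $ 2) (c $ 3) $ Some i) = c" by (simp add: vec3_eq_iff)
    thus ?thesis by (simp add: cl_def normal_form_def mpoly_const_0)
  qed
  show "bij_betw (\<lambda>c. coset (linear_form c)) UNIV (THE M. maximalideal M R)"
    unfolding the lf
  proof (rule bij_betw_imageI)
    show "inj (\<lambda>c :: 'k ^ 3. cl (vec4 0 (c $ 1) (c $ 2) (c $ 3)))"
      by (rule injI) (simp add: cl_eq_iff vec4_eq_iff vec3_eq_iff)
    have "x \<in> range (\<lambda>c :: 'k ^ 3. vec4 0 (c $ 1) (c $ 2) (c $ 3))" if "x \<in> flag 3" for x
      by (rule range_eqI[of _ _ "\<chi> i. x $ Some i"]) (use that in \<open>simp add: flag_def vec4_eq_iff\<close>)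
    moreover have "vec4 0 (c $ 1) (c $ 2) (c $ 3) \<in> flag 3" for c :: "'k ^ 3" by (simp add: flag_def)
    ultimately have "range (\<lambda>c :: 'k ^ 3. vec4 0 (c $ 1) (c $ 2) (c $ 3)) = flag 3" by blast
    thus "range (\<lambda>c :: 'k ^ 3. cl (vec4 0 (c $ 1) (c $ 2) (c $ 3))) = cl ` flag 3" by (metis image_image)
  qed
qed

lemma to_alg_exp_mod: "to_alg p q (exp_mod I (linear_form a)) = alg_exp p q a"
proof -
  define N where "N = alg_mult p q (vec4 0 (a $ 1) (a $ 2) (a $ 3))"
  have "(\<chi> i. vec4 0 (a $ 1) (a $ 2) (a $ 3) $ Some i) = a" by (simp add: vec3_eq_iff)
  hence lf: "to_alg p q (linear_form a) = vec4 0 (a $ 1) (a $ 2) (a $ 3)"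
    using to_alg_normal_form[of p q "vec4 0 (a $ 1) (a $ 2) (a $ 3)"]
    by (simp add: normal_form_def mpoly_const_0)
  have pow: "to_alg p q (linear_form a ^ k) = (N ^^ k) (vec4 1 0 0 0)" for k
    by (induction k) (simp_all add: to_alg_one to_alg_mult lf N_def)
  have zero: "(N ^^ k) x = 0" if k: "k \<ge> 4" for k x
  proof -
    have "(N ^^ k) x = (N ^^ (k - 4)) ((N ^^ 4) x)"
      using k by (simp flip: funpow_add[unfolded o_def fun_eq_iff, rule_format])
    also have "(N ^^ 4) x = 0" unfolding N_def by (rule alg_nilpotent)
    also have "(N ^^ n) 0 = 0" for n
      by (induction n) (simp_all add: N_def vec.linear_0[OF linear_alg_mult])
    finally show ?thesis .
  qed
  have to_alg_sum: "to_alg p q (\<Sum>k\<in>A. f k) = (\<Sum>k\<in>A. to_alg p q (f k))" for f and A :: "nat set"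
    by (induction A rule: infinite_finite_induct) (simp_all add: to_alg_0 to_alg_add)
  have "to_alg p q (exp_mod I (linear_form a)) =
      (\<Sum>k | linear_form a ^ k \<notin> I. (1 / fact k) *s (N ^^ k) (vec4 1 0 0 0))"
    by (simp add: exp_mod_def to_alg_sum to_alg_const_mult pow)
  \<comment> \<open>Powers from 4 on lie in \<open>I\<close>, and smaller ones that lie in
    \<open>I\<close> contribute 0, so four terms can be taken for all parameters.\<close>
  also have "\<dots> = (\<Sum>k<4. (1 / fact k) *s (N ^^ k) (vec4 1 0 0 0))"
  proof (rule sum.mono_neutral_left)
    show "{k. linear_form a ^ k \<notin> I} \<subseteq> {..<4}"
      using zero by (auto simp: mem_iff pow) (meson not_le)
  qed (auto simp: mem_iff pow)
  also have "\<dots> = alg_exp p q a"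
    unfolding N_def alg_exp_series by (simp add: alg_mult_commute[of p q "alg_exp p q a"] alg_mult_one)
  finally show ?thesis .
qed

lemma structure_of_eq: "structure_of I = alg_structure p q"
proof
  fix a
  have "to_quotient I x = cl x" for x by (simp add: to_quotient_def cl_def normal_form_def)
  hence "{y. \<exists>x\<in>L. to_quotient I y = coset (exp_mod I (linear_form a)) \<otimes>\<^bsub>R\<^esub> to_quotient I x} =
      alg_mult p q (alg_exp p q a) ` L" for L
    by (auto simp: coset_cl to_alg_exp_mod R_mult cl_eq_iff)
  thus "structure_of I a = alg_structure p q a" by (simp add: structure_of_def alg_structure_def)
qed

end

section \<open>The presentations of the four quotients\<close>

lemma genideal_poly_ring:
  "ideal (genideal poly_ring S) (poly_ring :: ('n::finite, 'k::comm_ring_1) mpoly ring)"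
  "S \<subseteq> genideal poly_ring S"
  "ideal J poly_ring \<Longrightarrow> S \<subseteq> J \<Longrightarrow> genideal poly_ring S \<subseteq> J"
proof -
  interpret R: cring "poly_ring :: ('n, 'k) mpoly ring" by (rule cring_poly_ring)
  show "ideal (genideal poly_ring S) (poly_ring :: ('n, 'k) mpoly ring)"
    by (rule R.genideal_ideal) simp
  show "S \<subseteq> genideal poly_ring S" by (rule R.genideal_self) simp
  show "ideal J poly_ring \<Longrightarrow> S \<subseteq> J \<Longrightarrow> genideal poly_ring S \<subseteq> J" by (rule R.genideal_minimal)
qed

text \<open>Finitely many checks suffice: the generators vanish in the coordinate algebra, which
  bounds the ideal from above by the kernel, and the entries of the multiplication table follow from
  them, which bounds it from below.\<close>

lemma presentation_genideal:
  fixes S :: "(3, 'k::field_char_0) mpoly set"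
  assumes gens: "\<And>f. f \<in> S \<Longrightarrow> to_alg p q f = 0"
    and rels: "mpoly_var 1 * mpoly_var 1 - mpoly_const p * mpoly_var 2 \<in> genideal poly_ring S"
      "mpoly_var 1 * mpoly_var 2 - mpoly_const q * mpoly_var 3 \<in> genideal poly_ring S"
      "mpoly_var 1 * mpoly_var 3 \<in> genideal poly_ring S" "mpoly_var 2 * mpoly_var 2 \<in> genideal poly_ring S"
      "mpoly_var 2 * mpoly_var 3 \<in> genideal poly_ring S" "mpoly_var 3 * mpoly_var 3 \<in> genideal poly_ring S"
  shows "presentation p q (genideal poly_ring S)"
proof (rule presentation.intro)
  show "ideal (genideal poly_ring S) poly_ring" by (rule genideal_poly_ring)
  have "genideal poly_ring S \<subseteq> {f. to_alg p q f = 0}"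
    by (rule genideal_poly_ring(3)[OF to_alg_kernel_ideal]) (use gens in blast)
  thus "f \<in> genideal poly_ring S \<longleftrightarrow> to_alg p q f = 0" for f
    by (intro mem_ideal_iff_to_alg_eq_0[OF genideal_poly_ring(1) _ rels]) blast
qed

lemmas to_alg_simps = to_alg_diff to_alg_mult to_alg_mpoly_var basis_vec alg_mult_def vec4_eq_iff power2_eq_square

lemma presentation_I1: "presentation 1 1 I1"
  unfolding I1_def
proof (rule presentation_genideal)
  let ?S = "{S1\<^sup>2 - S2, S1 * S2 - S3, S1 * S3}"
  let ?I = "genideal poly_ring ?S"
  show "to_alg 1 1 f = 0" if "f \<in> ?S" for f using that by (auto simp: to_alg_simps)
  note I = genideal_poly_ring(1)[of ?S]
  have A: "S1 * S1 - S2 \<in> ?I" and B: "S1 * S2 - S3 \<in> ?I" and C: "S1 * S3 \<in> ?I"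
    using genideal_poly_ring(2)[of ?S] by (simp_all add: power2_eq_square)
  show "S1 * S1 - mpoly_const 1 * S2 \<in> ?I" "S1 * S2 - mpoly_const 1 * S3 \<in> ?I" "S1 * S3 \<in> ?I"
    using A B C by (simp_all add: mpoly_const_1)
  \<comment> \<open>Modulo the first two generators \<open>S2 * S2\<close> becomes
    \<open>S1 * S1 * S2\<close> and then \<open>S1 * S3\<close>, which is the third.\<close>
  have "S2 * S2 = - S2 * (S1 * S1 - S2) + (S1 * (S1 * S2 - S3) + S1 * S3)" by (simp add: algebra_simps)
  thus "S2 * S2 \<in> ?I" using A B C by (simp only: poly_idealD(2,3)[OF I])
  have "S2 * S3 = - S3 * (S1 * S1 - S2) + S1 * (S1 * S3)" by (simp add: algebra_simps)
  thus "S2 * S3 \<in> ?I" using A C by (simp only: poly_idealD(2,3)[OF I])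
  have "S3 * S3 = - S3 * (S1 * S2 - S3) + S2 * (S1 * S3)" by (simp add: algebra_simps)
  thus "S3 * S3 \<in> ?I" using B C by (simp only: poly_idealD(2,3)[OF I])
qed

lemma presentation_I2: "presentation 1 0 I2"
  unfolding I2_def
proof (rule presentation_genideal)
  let ?S = "{S1\<^sup>2 - S2, S1 * S2, S1 * S3, S3\<^sup>2}"
  let ?I = "genideal poly_ring ?S"
  show "to_alg 1 0 f = 0" if "f \<in> ?S" for f using that by (auto simp: to_alg_simps)
  note I = genideal_poly_ring(1)[of ?S]
  have A: "S1 * S1 - S2 \<in> ?I" and B: "S1 * S2 \<in> ?I" and C: "S1 * S3 \<in> ?I" and E: "S3 * S3 \<in> ?I"
    using genideal_poly_ring(2)[of ?S] by (simp_all add: power2_eq_square)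
  show "S1 * S1 - mpoly_const 1 * S2 \<in> ?I" "S1 * S2 - mpoly_const 0 * S3 \<in> ?I" "S1 * S3 \<in> ?I"
    "S3 * S3 \<in> ?I"
    using A B C E by (simp_all add: mpoly_const_1 mpoly_const_0)
  have "S2 * S2 = - S2 * (S1 * S1 - S2) + S1 * (S1 * S2)" by (simp add: algebra_simps)
  thus "S2 * S2 \<in> ?I" using A B by (simp only: poly_idealD(2,3)[OF I])
  have "S2 * S3 = - S3 * (S1 * S1 - S2) + S1 * (S1 * S3)" by (simp add: algebra_simps)
  thus "S2 * S3 \<in> ?I" using A C by (simp only: poly_idealD(2,3)[OF I])
qed

lemma presentation_I3: "presentation 0 1 I3"
  unfolding I3_def
proof (rule presentation_genideal)
  let ?S = "{S1\<^sup>2, S1 * S2 - S3, S2\<^sup>2}"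
  let ?I = "genideal poly_ring ?S"
  show "to_alg 0 1 f = 0" if "f \<in> ?S" for f using that by (auto simp: to_alg_simps)
  note I = genideal_poly_ring(1)[of ?S]
  have A: "S1 * S1 \<in> ?I" and B: "S1 * S2 - S3 \<in> ?I" and C: "S2 * S2 \<in> ?I"
    using genideal_poly_ring(2)[of ?S] by (simp_all add: power2_eq_square)
  show "S1 * S1 - mpoly_const 0 * S2 \<in> ?I" "S1 * S2 - mpoly_const 1 * S3 \<in> ?I" "S2 * S2 \<in> ?I"
    using A B C by (simp_all add: mpoly_const_1 mpoly_const_0)
  have "S1 * S3 = - S1 * (S1 * S2 - S3) + S2 * (S1 * S1)" by (simp add: algebra_simps)
  thus "S1 * S3 \<in> ?I" using A B by (simp only: poly_idealD(2,3)[OF I])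
  have "S2 * S3 = - S2 * (S1 * S2 - S3) + S1 * (S2 * S2)" by (simp add: algebra_simps)
  thus "S2 * S3 \<in> ?I" using B C by (simp only: poly_idealD(2,3)[OF I])
  \<comment> \<open>The difference of the squares of \<open>S3\<close> and \<open>S1 * S2\<close> is
    a multiple of the generator \<open>S1 * S2 - S3\<close>.\<close>
  have "S3 * S3 = (- S3 - S1 * S2) * (S1 * S2 - S3) + (S2 * S2) * (S1 * S1)" by (simp add: algebra_simps)
  thus "S3 * S3 \<in> ?I" using A B by (simp only: poly_idealD(2,3)[OF I])
qed

lemma presentation_I4: "presentation 0 0 I4"
  unfolding I4_def
proof (rule presentation_genideal)
  let ?S = "{S1\<^sup>2, S1 * S2, S2\<^sup>2, S2 * S3, S3\<^sup>2, S1 * S3}"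
  let ?I = "genideal poly_ring ?S"
  show "to_alg 0 0 f = 0" if "f \<in> ?S" for f using that by (auto simp: to_alg_simps)
  show "S1 * S1 - mpoly_const 0 * S2 \<in> ?I" "S1 * S2 - mpoly_const 0 * S3 \<in> ?I" "S1 * S3 \<in> ?I"
    "S2 * S2 \<in> ?I" "S2 * S3 \<in> ?I" "S3 * S3 \<in> ?I"
    using genideal_poly_ring(2)[of ?S] by (simp_all add: power2_eq_square mpoly_const_0)
qed

theorem proposition3p3:
  shows "card (structures Ga3 P3 // equivalence_rel Ga3 P3) = 4 \<and>
    (\<forall>I\<in>{I1, I2, I3, I4}. defines_structure I \<and> structure_of I \<in> structures Ga3 P3) \<and>
    bij_betw (\<lambda>I. equivalence_rel Ga3 P3 `` {structure_of I}) {I1, I2, I3, I4}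
           (structures Ga3 P3 // equivalence_rel Ga3 P3)"
proof -
  let ?S = "structures Ga3 P3" and ?E = "equivalence_rel Ga3 P3" and ?A = "{I1, I2, I3, I4}"
  note pres = presentation_I1 presentation_I2 presentation_I3 presentation_I4
  have eqs: "structure_of I1 = alg_structure 1 1" "structure_of I2 = alg_structure 1 0"
    "structure_of I3 = alg_structure 0 1" "structure_of I4 = alg_structure 0 0"
    using pres[THEN presentation.structure_of_eq] by simp_all
  have defs: "\<forall>I\<in>?A. defines_structure I" using pres[THEN presentation.defines_structure] by simp
  have alg: "alg_structure p q \<in> ?S" for p q
    by (simp add: structures_def alg_structure_is_structure)
  have strs: "\<forall>I\<in>?A. structure_of I \<in> ?S" by (simp add: eqs alg)
  have equiv: "equiv ?S ?E"
    by (rule equiv_equivalence_rel) (simp_all add: group_additive, simp add: additive_group_def)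
  \<comment> \<open>The invariant that separates the classes; its value 0 at \<open>I3\<close>
    stands for infinitely many stabilizers.\<close>
  define \<kappa> where "\<kappa> I = card (stabilizer Ga3 (structure_of I) ` lines)" for I
  have \<kappa>: "\<kappa> I1 = 4" "\<kappa> I2 = 3" "\<kappa> I3 = 0" "\<kappa> I4 = 2"
    by (simp_all add: \<kappa>_def eqs card_alg_stabilizers)
  have inj: "inj_on (\<lambda>I. ?E `` {structure_of I}) ?A"
  proof (rule inj_onI)
    fix I J assume IJ: "I \<in> ?A" "J \<in> ?A" and "?E `` {structure_of I} = ?E `` {structure_of J}"
    hence "(structure_of I, structure_of J) \<in> ?E"
      using eq_equiv_class[OF _ equiv] bspec[OF strs IJ(2)] by blast
    hence "equivalent Ga3 P3 (structure_of I) P3 (structure_of J)" by (simp add: equivalence_rel_def)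
    moreover have "structure_of I \<in> ?S" using strs IJ(1) by (rule bspec)
    ultimately have "card (stabilizer Ga3 (structure_of I) ` points P3) =
        card (stabilizer Ga3 (structure_of J) ` points P3)" by (rule equivalent_card_stabilizers)
    hence "\<kappa> I = \<kappa> J" by (simp add: \<kappa>_def)
    thus "I = J" using IJ \<kappa> by (elim insertE emptyE) simp_all
  qed
  have "(\<lambda>I. ?E `` {structure_of I}) ` ?A = ?S // ?E"
  proof (intro antisym subsetI)
    fix X assume "X \<in> (\<lambda>I. ?E `` {structure_of I}) ` ?A"
    then obtain I where "X = ?E `` {structure_of I}" "I \<in> ?A" by (rule imageE)
    thus "X \<in> ?S // ?E" using quotientI[OF bspec[OF strs]] by simp
  next
    fix X assume "X \<in> ?S // ?E"
    then obtain \<phi> where \<phi>: "\<phi> \<in> ?S" "X = ?E `` {\<phi>}" by (rule quotientE)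
    have "is_structure Ga3 P3 \<phi>" using \<phi>(1) unfolding structures_def by (rule CollectD)
    from structure_equivalent_alg_structure[OF this] obtain p q where pq: "p = 0 \<or> p = 1" "q = 0 \<or> q = 1"
      and "equivalent Ga3 P3 \<phi> P3 (alg_structure p q)" by (elim exE conjE)
    hence "(\<phi>, alg_structure p q) \<in> ?E" using \<phi>(1) alg by (simp add: equivalence_rel_def)
    hence "X = ?E `` {alg_structure p q}" using equiv_class_eq[OF equiv] \<phi>(2) by simp
    moreover have "\<exists>I\<in>?A. structure_of I = alg_structure p q"
      using pq by (elim disjE) (simp_all add: eqs)
    then obtain I where "I \<in> ?A" "structure_of I = alg_structure p q" by (rule bexE)
    ultimately show "X \<in> (\<lambda>I. ?E `` {structure_of I}) ` ?A" by (intro image_eqI[of _ _ I]) simp_all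
  qed
  hence bij: "bij_betw (\<lambda>I. ?E `` {structure_of I}) ?A (?S // ?E)" using inj by (simp add: bij_betw_def)
  \<comment> \<open>The number of classes is 4 only if the four ideals differ as sets; the invariant
    is a function of the ideal and shows this as well.\<close>
  have "distinct (map \<kappa> [I1, I2, I3, I4])" by (simp add: \<kappa>)
  hence "distinct [I1, I2, I3, I4]" unfolding distinct_map by (rule conjunct1)
  from distinct_card[OF this] have "card ?A = 4" by simp
  hence "card (?S // ?E) = 4" using bij_betw_same_card[OF bij] by simp
  thus ?thesis using bij bspec[OF defs] bspec[OF strs] by (intro conjI ballI)
qed

end
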